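(* Let $\mathcal P\subset\mathbb Z$ be the set of (positive) prime numbers and $\widehat{\mathcal P}$ its closure in $\widehat{\mathbb Z}$. For $f_1,\dots,f_k\in\widehat{\mathbb Z}[x]$, let $\mathbf f\colon\widehat{\mathbb Z}\to\widehat{\mathbb Z}^k$ be the map $a\mapsto(f_1(a),\dots,f_k(a))$. Assume that $\mathbf f(\widehat{\mathbb Z})\cap(\widehat{\mathbb Z}^* )^k$ is nonempty. Then both $$\big(\mathcal P,\ \widehat{\mathbb Z}^*\big)\qquad\text{and}\qquad\big(\mathbf f^{-1}(\widehat{\mathcal P}^k),\ \mathbf f^{-1}((\widehat{\mathbb Z}^* )^k)\big)$$ form a close pair, so that the following procounting measures exist and $$\mu_{\mathcal P}=\mu_{\widehat{\mathbb Z}^*}\qquad\text{and}\qquad\mu_{\mathbf f^{-1}(\widehat{\mathcal P}^k)}=\mu_{\mathbf f^{-1}((\widehat{\mathbb Z}^* )^k)}.$$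
   Context: $\widehat{\mathbb Z}=\varprojlim_n\mathbb Z/n\mathbb Z$ (over positive integers ordered by divisibility), with projections $\widehat\pi_n\colon\widehat{\mathbb Z}\to\mathbb Z/n\mathbb Z$, unit group $\widehat{\mathbb Z}^*$ and normalized Haar measure $\mu_{\widehat{\mathbb Z}}$. Limits "$n\to0$" are limits of nets indexed by positive integers ordered by divisibility. Close pair: subsets $S,T\subseteq\widehat{\mathbb Z}$ (not both empty) form a close pair if $$\lim_{n\to0}\frac{|\widehat\pi_n(S)\,\triangle\,\widehat\pi_n(T)|}{|\widehat\pi_n(S\cup T)|}=0,$$ where $\triangle$ is the symmetric difference. Procounting measure: for nonempty $S\subseteq\widehat{\mathbb Z}$ let $\widetilde\mu_{S,n}:=\frac{n}{|\widehat\pi_n(S)|}\mathbf 1_{\widehat\pi_n^{-1}(\widehat\pi_n(S))}\cdot\mu_{\widehat{\mathbb Z}}$, a probability measure on $\widehat{\mathbb Z}$. The procounting measure of $S$ is $\mu_S:=\lim_{n\to0}\widetilde\mu_{S,n}$, if the limit exists in the weak-* topology, i.e. if $\widetilde\mu_{S,n}(U)$ converges for every compact open $U\subseteq\widehat{\mathbb Z}$. *)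

theory Defs
  imports "HOL-Probability.Probability" "HOL-Computational_Algebra.Polynomial"
    "HOL-Computational_Algebra.Primes"
begin

text \<open>
  The inverse limit of the rings of integers modulo \<open>n\<close>, over the positive integers ordered by
  divisibility. A residue class modulo \<open>n\<close> is represented by its element in \<open>{0..<n}\<close>. The
  index \<open>0\<close> is excluded; there the functions take the default value of \<open>PiE\<close>.
\<close>

typedef zhat = "{x \<in> (\<Pi>\<^sub>E n\<in>{0<..}. {0..<int n}). \<forall>m n. 0 < n \<and> m dvd n \<longrightarrow> x n mod int m = x m}"
  morphisms zhat_fun Abs_zhat
  by (rule exI[of _ "\<lambda>n\<in>{0<..}. 0"]) (auto dest: dvd_pos_nat)

setup_lifting type_definition_zhat

definition zproj :: "nat \<Rightarrow> zhat \<Rightarrow> int" where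
  "zproj n x = zhat_fun x n"

lemma zproj_range: "0 < n \<Longrightarrow> 0 \<le> zproj n x \<and> zproj n x < int n"
  using zhat_fun[of x] by (auto simp: zproj_def PiE_def Pi_def)

lemma zproj_mod: "0 < n \<Longrightarrow> m dvd n \<Longrightarrow> zproj n x mod int m = zproj m x"
  using zhat_fun[of x] by (auto simp: zproj_def)

lemma zproj_mod_self [simp]: "0 < n \<Longrightarrow> zproj n x mod int n = zproj n x"
  using zproj_range[of n x] by simp

lemma zhat_eqI: "(\<And>n. 0 < n \<Longrightarrow> zproj n x = zproj n y) \<Longrightarrow> x = y"
proof -
  assume *: "\<And>n. 0 < n \<Longrightarrow> zproj n x = zproj n y"
  have "zhat_fun x = zhat_fun y"
  proof (rule PiE_ext)
    show "zhat_fun x \<in> (\<Pi>\<^sub>E n\<in>{0<..}. {0..<int n})" "zhat_fun y \<in> (\<Pi>\<^sub>E n\<in>{0<..}. {0..<int n})"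
      using zhat_fun[of x] zhat_fun[of y] by auto
  qed (use * in \<open>auto simp: zproj_def\<close>)
  then show "x = y" by (simp add: zhat_fun_inject)
qed

lemma compatibleD:
  "P \<and> (\<forall>m n. 0 < n \<and> m dvd n \<longrightarrow> x n mod int m = x m) \<Longrightarrow> 0 < n \<Longrightarrow> m dvd n \<Longrightarrow> x n mod int m = x m"
  by blast

lemma residues_compatible:
  assumes g: "\<And>m n. 0 < n \<Longrightarrow> m dvd n \<Longrightarrow> g n mod int m = g m mod int m"
  defines "h \<equiv> \<lambda>n\<in>{0<..}. g n mod int n"
  shows "h \<in> (\<Pi>\<^sub>E n\<in>{0<..}. {0..<int n}) \<and> (\<forall>m n. 0 < n \<and> m dvd n \<longrightarrow> h n mod int m = h m)"
proof -
  have "g n mod int n mod int m = g m mod int m" "0 < m" if "0 < n" "m dvd n" for m n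
    using g[OF that] that by (simp_all add: mod_mod_cancel dvd_pos_nat)
  then show ?thesis by (simp add: h_def)
qed

instantiation zhat :: comm_ring_1
begin

lift_definition zero_zhat :: zhat is "\<lambda>n\<in>{0<..}. 0 mod int n"
  by (rule residues_compatible) simp

lift_definition one_zhat :: zhat is "\<lambda>n\<in>{0<..}. 1 mod int n"
  by (rule residues_compatible) simp

lift_definition plus_zhat :: "zhat \<Rightarrow> zhat \<Rightarrow> zhat" is "\<lambda>x y. \<lambda>n\<in>{0<..}. (x n + y n) mod int n"
proof (rule residues_compatible, goal_cases)
  case (1 x y m n)
  from compatibleD[OF 1(1) 1(3,4)] compatibleD[OF 1(2) 1(3,4)]
  show ?case by (metis mod_add_eq)
qed

lift_definition minus_zhat :: "zhat \<Rightarrow> zhat \<Rightarrow> zhat" is "\<lambda>x y. \<lambda>n\<in>{0<..}. (x n - y n) mod int n"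
proof (rule residues_compatible, goal_cases)
  case (1 x y m n)
  from compatibleD[OF 1(1) 1(3,4)] compatibleD[OF 1(2) 1(3,4)]
  show ?case by (metis mod_diff_eq)
qed

lift_definition uminus_zhat :: "zhat \<Rightarrow> zhat" is "\<lambda>x. \<lambda>n\<in>{0<..}. (- x n) mod int n"
proof (rule residues_compatible, goal_cases)
  case (1 x m n)
  from compatibleD[OF 1(1) 1(2,3)] show ?case by (metis mod_minus_eq)
qed

lift_definition times_zhat :: "zhat \<Rightarrow> zhat \<Rightarrow> zhat" is "\<lambda>x y. \<lambda>n\<in>{0<..}. (x n * y n) mod int n"
proof (rule residues_compatible, goal_cases)
  case (1 x y m n)
  from compatibleD[OF 1(1) 1(3,4)] compatibleD[OF 1(2) 1(3,4)]
  show ?case by (metis mod_mult_eq)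
qed

lemma zproj_ring [simp]:
  assumes "0 < n"
  shows "zproj n 0 = 0" "zproj n 1 = 1 mod int n"
    "zproj n (x + y) = (zproj n x + zproj n y) mod int n"
    "zproj n (x - y) = (zproj n x - zproj n y) mod int n"
    "zproj n (- x) = (- zproj n x) mod int n"
    "zproj n (x * y) = (zproj n x * zproj n y) mod int n"
  using assms unfolding zproj_def by (transfer; simp)+

instance
proof
  fix a b c :: zhat
  show "a * b * c = a * (b * c)" by (rule zhat_eqI) (simp add: mod_simps mult.assoc)
  show "a * b = b * a" by (rule zhat_eqI) (simp add: mult.commute)
  show "1 * a = a" by (rule zhat_eqI) (simp add: mod_simps)
  show "a + b + c = a + (b + c)" by (rule zhat_eqI) (simp add: mod_simps add.assoc)
  show "a + b = b + a" by (rule zhat_eqI) (simp add: add.commute)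
  show "0 + a = a" by (rule zhat_eqI) simp
  show "- a + a = 0" by (rule zhat_eqI) (simp add: mod_simps)
  show "a - b = a + - b" by (rule zhat_eqI) (simp add: mod_simps)
  show "(a + b) * c = a * c + b * c" by (rule zhat_eqI) (simp add: mod_simps distrib_right)
  have "zproj 2 0 \<noteq> zproj 2 1" by simp
  then show "(0::zhat) \<noteq> 1" by metis
qed

end

lemma zproj_of_nat: "0 < n \<Longrightarrow> zproj n (of_nat k) = int k mod int n"
  by (induction k) (simp_all add: mod_simps)

text \<open>The coarsest topology making all projections to the discrete finite rings continuous.\<close>

instantiation zhat :: topological_space
begin

definition open_zhat :: "zhat set \<Rightarrow> bool" where
  "open_zhat = generate_topology {zproj n -` A | n A. 0 < n}"

instance
proof
  show "open (UNIV :: zhat set)" by (simp add: open_zhat_def generate_topology.UNIV)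
qed (auto simp: open_zhat_def intro: generate_topology.intros)

end

text \<open>The filter of the limits \<open>n \<rightarrow> 0\<close>.\<close>

definition dvd_filter :: "nat filter" where
  "dvd_filter = (INF m\<in>{0<..}. principal {n. 0 < n \<and> m dvd n})"

lemma eventually_dvd_filter:
  "eventually P dvd_filter \<longleftrightarrow> (\<exists>m>0. \<forall>n>0. m dvd n \<longrightarrow> P n)"
  unfolding dvd_filter_def
proof (subst eventually_INF_base)
  show "{0<..} \<noteq> ({} :: nat set)" by (metis empty_iff greaterThan_iff zero_less_one)
  fix a b :: nat
  assume "a \<in> {0<..}" "b \<in> {0<..}"
  then show "\<exists>x\<in>{0<..}. principal {n. 0 < n \<and> x dvd n}
      \<le> inf (principal {n. 0 < n \<and> a dvd n}) (principal {n. 0 < n \<and> b dvd n})"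
    by (intro bexI[of _ "a * b"]) (auto intro: dvd_mult_left dvd_mult_right)
qed (auto simp: eventually_principal)

lemma dvd_filter_neq_bot [simp]: "dvd_filter \<noteq> bot"
  unfolding trivial_limit_def eventually_dvd_filter by auto

definition zhat_units :: "zhat set" where
  "zhat_units = {u. u dvd 1}"

definition zhat_primes :: "zhat set" where
  "zhat_primes = of_nat ` {p. prime p}"

definition poly_tuple :: "nat \<Rightarrow> (nat \<Rightarrow> zhat poly) \<Rightarrow> zhat \<Rightarrow> nat \<Rightarrow> zhat" where
  "poly_tuple k f a = (\<lambda>i\<in>{1..k}. poly (f i) a)"

definition close_pair :: "zhat set \<Rightarrow> zhat set \<Rightarrow> bool" where
  "close_pair S T \<longleftrightarrow> S \<union> T \<noteq> {} \<and>
    ((\<lambda>n. real (card (sym_diff (zproj n ` S) (zproj n ` T))) / real (card (zproj n ` (S \<union> T))))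
      \<longlongrightarrow> 0) dvd_filter"

definition normalized_haar :: "zhat measure \<Rightarrow> bool" where
  "normalized_haar M \<longleftrightarrow> prob_space M \<and> sets M = sets borel \<and> (\<forall>a. distr M borel (\<lambda>x. a + x) = M)"

text \<open>This is well-defined; see \<open>ex1_normalized_haar\<close> below.\<close>

definition zhat_haar :: "zhat measure" where
  "zhat_haar = (THE M. normalized_haar M)"

definition approx_measure :: "zhat set \<Rightarrow> nat \<Rightarrow> zhat measure" where
  "approx_measure S n = density zhat_haar
    (\<lambda>x. ennreal (real n / real (card (zproj n ` S))) * indicator (zproj n -` zproj n ` S) x)"

text \<open>
  Weak-* convergence, tested on the compact open sets. By
  \<open>procounting_measure_exists_iff\<close> below, convergence of all these values already provides the
  limit measure, and by \<open>has_procounting_measure_unique\<close> that measure is unique.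
\<close>

definition has_procounting_measure :: "zhat set \<Rightarrow> zhat measure \<Rightarrow> bool" where
  "has_procounting_measure S \<nu> \<longleftrightarrow> S \<noteq> {} \<and> prob_space \<nu> \<and> sets \<nu> = sets borel \<and>
    (\<forall>U. compact U \<and> open U \<longrightarrow>
      ((\<lambda>n. measure (approx_measure S n) U) \<longlongrightarrow> measure \<nu> U) dvd_filter)"

definition procounting_measure_exists :: "zhat set \<Rightarrow> bool" where
  "procounting_measure_exists S \<longleftrightarrow> (\<exists>\<nu>. has_procounting_measure S \<nu>)"

definition procounting_measure :: "zhat set \<Rightarrow> zhat measure" where
  "procounting_measure S = (THE \<nu>. has_procounting_measure S \<nu>)"

subsection \<open>Well-definedness of the Haar measure and of the procounting measure\<close>

lemma zproj_eq_dvd: "0 < n \<Longrightarrow> m dvd n \<Longrightarrow> zproj n x = zproj n y \<Longrightarrow> zproj m x = zproj m y"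
  by (metis zproj_mod)

lemma open_zhat_iff: "open U \<longleftrightarrow> (\<forall>x\<in>U. \<exists>n>0. zproj n -` {zproj n x} \<subseteq> U)" for U :: "zhat set"
proof
  assume "open U"
  then have "generate_topology {zproj n -` A | n A. 0 < n} U"
    by (simp add: open_zhat_def)
  then show "\<forall>x\<in>U. \<exists>n>0. zproj n -` {zproj n x} \<subseteq> U"
  proof induction
    case UNIV
    then show ?case by auto
  next
    case (Int U V)
    show ?case
    proof
      fix x assume "x \<in> U \<inter> V"
      then obtain m n where mn: "0 < m" "zproj m -` {zproj m x} \<subseteq> U" "0 < n" "zproj n -` {zproj n x} \<subseteq> V"
        using Int.IH by blast
      have "zproj (m * n) -` {zproj (m * n) x} \<subseteq> U \<inter> V"
      proof
        fix y assume "y \<in> zproj (m * n) -` {zproj (m * n) x}"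
        then have "zproj m y = zproj m x" "zproj n y = zproj n x"
          using zproj_eq_dvd[of "m * n" m y x] zproj_eq_dvd[of "m * n" n y x] mn(1,3) by auto
        then show "y \<in> U \<inter> V" using mn(2,4) by auto
      qed
      then show "\<exists>n>0. zproj n -` {zproj n x} \<subseteq> U \<inter> V"
        using mn by (intro exI[of _ "m * n"]) simp
    qed
  next
    case (UN K)
    then show ?case by (meson Union_upper UnionE order_trans)
  next
    case (Basis s)
    then show ?case by auto
  qed
next
  assume *: "\<forall>x\<in>U. \<exists>n>0. zproj n -` {zproj n x} \<subseteq> U"
  have "U = \<Union>{zproj n -` A | n A. 0 < n \<and> zproj n -` A \<subseteq> U}"
  proof (intro equalityI subsetI)
    fix x assume "x \<in> U"
    then obtain n where "0 < n" "zproj n -` {zproj n x} \<subseteq> U" using * by blast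
    then show "x \<in> \<Union>{zproj n -` A | n A. 0 < n \<and> zproj n -` A \<subseteq> U}"
      by (intro UnionI[of "zproj n -` {zproj n x}"]) auto
  qed blast
  also have "open \<dots>"
    unfolding open_zhat_def
    by (rule generate_topology.UN) (auto intro: generate_topology.Basis)
  finally show "open U" .
qed

lemma open_zproj_vimage: "0 < n \<Longrightarrow> open (zproj n -` A)"
  unfolding open_zhat_def by (auto intro: generate_topology.Basis)

lemma closed_zproj_vimage: "0 < n \<Longrightarrow> closed (zproj n -` A)"
  unfolding closed_def using open_zproj_vimage[of n "- A"] by (simp add: vimage_Compl)

instance zhat :: t2_space
proof
  fix x y :: zhat
  assume "x \<noteq> y"
  then obtain n where n: "0 < n" "zproj n x \<noteq> zproj n y"
    using zhat_eqI by blast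
  then show "\<exists>U V. open U \<and> open V \<and> x \<in> U \<and> y \<in> V \<and> U \<inter> V = {}"
    by (intro exI[of _ "zproj n -` {zproj n x}"] exI[of _ "zproj n -` {zproj n y}"])
      (auto simp: open_zproj_vimage)
qed

lemma compact_UNIV_zhat: "compact (UNIV :: zhat set)"
proof -
  let ?T = "product_topology (\<lambda>n. discrete_topology {0..<int n}) {0<..}"
  define C where "C = {x \<in> (\<Pi>\<^sub>E n\<in>{0<..}. {0..<int n}). \<forall>m n. 0 < n \<and> m dvd n \<longrightarrow> x n mod int m = x m}"
  have top: "topspace ?T = (\<Pi>\<^sub>E n\<in>{0<..}. {0..<int n})"
    by simp
  have proj: "openin ?T {x \<in> topspace ?T. x n \<in> A}" if "0 < n" for n A
  proof -
    have "continuous_map ?T (discrete_topology {0..<int n}) (\<lambda>x. x n)"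
      using continuous_map_product_projection[of n "{0<..}" "\<lambda>n. discrete_topology {0..<int n}"] that
      by simp
    then have "openin ?T {x \<in> topspace ?T. x n \<in> A \<inter> {0..<int n}}"
      by (rule openin_continuous_map_preimage) simp
    also have "{x \<in> topspace ?T. x n \<in> A \<inter> {0..<int n}} = {x \<in> topspace ?T. x n \<in> A}"
      using that by (fastforce simp: PiE_iff)
    finally show ?thesis .
  qed
  have closed: "closedin ?T C"
    unfolding closedin_def
  proof
    show "C \<subseteq> topspace ?T" by (auto simp: C_def)
    have "topspace ?T - C = (\<Union>(m, n, a) \<in> {(m, n, a). 0 < n \<and> m dvd n}.
        {x \<in> topspace ?T. x n \<in> {a}} \<inter> {x \<in> topspace ?T. x m \<in> - {a mod int m}})" (is "_ = ?W")
    proof (intro equalityI subsetI)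
      fix x assume x: "x \<in> topspace ?T - C"
      then obtain m n where "0 < n" "m dvd n" "x n mod int m \<noteq> x m"
        unfolding C_def top by blast
      then show "x \<in> ?W"
        using x by (intro UN_I[of "(m, n, x n)"]) auto
    next
      fix x assume "x \<in> ?W"
      then obtain m n where "x \<in> topspace ?T" "0 < n" "m dvd n" "x m \<noteq> x n mod int m"
        by blast
      moreover from this have "x \<notin> C"
        unfolding C_def mem_Collect_eq by metis
      ultimately show "x \<in> topspace ?T - C" by blast
    qed
    also have "openin ?T \<dots>"
    proof (intro openin_Union ballI, clarify)
      fix m n :: nat and a :: int
      assume "0 < n" "m dvd n"
      then show "openin ?T ({x \<in> topspace ?T. x n \<in> {a}} \<inter> {x \<in> topspace ?T. x m \<in> - {a mod int m}})"
        by (intro openin_Int proj) (auto dest: dvd_pos_nat)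
    qed
    finally show "openin ?T (topspace ?T - C)" .
  qed
  have "compact_space ?T"
    by (simp add: compact_space_product_topology compact_space_discrete_topology)
  then have "compactin ?T C"
    using closed by (rule closedin_compact_space)
  then have "compactin (subtopology ?T C) C"
    by simp
  moreover have "continuous_map (subtopology ?T C) euclidean Abs_zhat"
    unfolding continuous_map
  proof (intro conjI allI impI)
    fix U :: "zhat set"
    assume "openin euclidean U"
    then have U: "open U" by simp
    show "openin (subtopology ?T C) {x \<in> topspace (subtopology ?T C). Abs_zhat x \<in> U}"
    proof (subst openin_subopen, clarify)
      fix x assume x: "x \<in> topspace (subtopology ?T C)" "Abs_zhat x \<in> U"
      have Rep: "zproj n (Abs_zhat y) = y n" if "y \<in> C" for y n
        using that by (simp add: zproj_def C_def Abs_zhat_inverse)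
      obtain n where n: "0 < n" "zproj n -` {zproj n (Abs_zhat x)} \<subseteq> U"
        using U x(2) unfolding open_zhat_iff by blast
      have "openin (subtopology ?T C) ({y \<in> topspace ?T. y n \<in> {x n}} \<inter> C)"
        using proj[OF n(1)] by (rule openin_subtopology_Int)
      moreover have "x \<in> {y \<in> topspace ?T. y n \<in> {x n}} \<inter> C"
        using x by (auto simp: topspace_subtopology)
      moreover have "{y \<in> topspace ?T. y n \<in> {x n}} \<inter> C \<subseteq> {x \<in> topspace (subtopology ?T C). Abs_zhat x \<in> U}"
        using n(2) x(1) Rep by (auto simp: topspace_subtopology subset_iff)
      ultimately show "\<exists>V. openin (subtopology ?T C) V \<and> x \<in> V \<and>
          V \<subseteq> {x \<in> topspace (subtopology ?T C). Abs_zhat x \<in> U}"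
        by blast
    qed
  qed auto
  ultimately have "compact (Abs_zhat ` C)"
    by (metis compactin_euclidean_iff image_compactin)
  moreover have "Abs_zhat ` C = UNIV"
    unfolding C_def using Abs_zhat_cases by (auto simp: image_iff) metis
  ultimately show ?thesis by simp
qed

lemma compact_zhat_iff_closed: "compact U \<longleftrightarrow> closed U" for U :: "zhat set"
  using compact_UNIV_zhat compact_Int_closed[of UNIV U] compact_imp_closed by auto

lemma zproj_of_int: "0 < n \<Longrightarrow> zproj n (of_int k) = k mod int n"
  by (cases k rule: int_cases2) (simp_all add: zproj_of_nat mod_minus_eq)

lemma zproj_of_int_surj: "0 < n \<Longrightarrow> a \<in> {0..<int n} \<Longrightarrow> zproj n (of_int a) = a"
  by (simp add: zproj_of_int)

lemma finite_zproj_image: "0 < n \<Longrightarrow> finite (zproj n ` S)"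
  by (rule finite_subset[of _ "{0..<int n}"]) (use zproj_range in auto)

definition zhat_level :: "zhat set \<Rightarrow> nat \<Rightarrow> bool" where
  "zhat_level U n \<longleftrightarrow> 0 < n \<and> zproj n -` zproj n ` U = U"

lemma zhat_level_dvd: "zhat_level U m \<Longrightarrow> m dvd n \<Longrightarrow> 0 < n \<Longrightarrow> zhat_level U n"
proof -
  assume U: "zhat_level U m" and n: "m dvd n" "0 < n"
  have "y \<in> U" if "x \<in> U" "zproj n y = zproj n x" for x y
  proof -
    have "zproj m y = zproj m x" using zproj_eq_dvd[OF n(2,1) that(2)] .
    then have "y \<in> zproj m -` zproj m ` U" using that(1) by auto
    then show "y \<in> U" using U unfolding zhat_level_def by metis
  qed
  then show "zhat_level U n" using n by (auto simp: zhat_level_def)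
qed

lemma ex_zhat_level:
  assumes "open U" "compact U"
  shows "\<exists>n. zhat_level U n"
proof -
  let ?F = "{zproj n -` {a} | n a. 0 < n \<and> zproj n -` {a} \<subseteq> U}"
  have cover: "U \<subseteq> \<Union>?F"
  proof
    fix x assume "x \<in> U"
    then obtain n where "0 < n" "zproj n -` {zproj n x} \<subseteq> U"
      using assms(1) unfolding open_zhat_iff by blast
    then show "x \<in> \<Union>?F"
      by (intro UnionI[of "zproj n -` {zproj n x}"]) auto
  qed
  have op: "open B" if "B \<in> ?F" for B
    using that by (auto simp: open_zproj_vimage)
  obtain F where F: "F \<subseteq> ?F" "finite F" "U \<subseteq> \<Union>F"
    by (rule compactE[OF assms(2) cover op])
  have "\<exists>l. \<forall>B\<in>F. 0 < l B \<and> (\<exists>a. B = zproj (l B) -` {a} \<and> B \<subseteq> U)"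
  proof (rule bchoice, rule)
    fix B assume "B \<in> F"
    from subsetD[OF F(1) this] obtain n a where "B = zproj n -` {a}" "0 < n" "B \<subseteq> U"
      by auto
    then show "\<exists>n. 0 < n \<and> (\<exists>a. B = zproj n -` {a} \<and> B \<subseteq> U)" by metis
  qed
  then obtain l where l': "\<forall>B\<in>F. 0 < l B \<and> (\<exists>a. B = zproj (l B) -` {a} \<and> B \<subseteq> U)" ..
  have l: "0 < l B" "\<exists>a. B = zproj (l B) -` {a} \<and> B \<subseteq> U" if "B \<in> F" for B
    using bspec[OF l' that] by simp_all
  define n where "n = (\<Prod>B\<in>F. l B)"
  have n: "0 < n" using l(1) by (auto simp: n_def intro!: prod_pos)
  have "y \<in> U" if "x \<in> U" "zproj n y = zproj n x" for x y
  proof -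
    have "x \<in> \<Union>F" using F(3) that(1) by (rule subsetD)
    then obtain B where B: "B \<in> F" "x \<in> B" by (rule UnionE)
    have "l B dvd n" unfolding n_def using F(2) B(1) by (rule dvd_prodI)
    then have "zproj (l B) y = zproj (l B) x" using n that(2) zproj_eq_dvd by blast
    moreover obtain a where a: "B = zproj (l B) -` {a}" "B \<subseteq> U" using l(2)[OF B(1)] by (elim exE conjE)
    ultimately have "y \<in> B" using B(2) by (metis vimage_singleton_eq)
    then show "y \<in> U" using a(2) by (rule subsetD[rotated])
  qed
  then have "zhat_level U n" using n by (auto simp: zhat_level_def)
  then show ?thesis ..
qed

lemma card_zproj_image_level:
  assumes U: "zhat_level U m" and "m dvd n" "0 < n"
  shows "card (zproj n ` U) * m = card (zproj m ` U) * n"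
proof -
  obtain q where q: "n = m * q" using assms(2) by blast
  have pos: "0 < m" "0 < q" using q assms(3) by auto
  let ?g = "\<lambda>(a, j). a + int m * j"
  have "bij_betw ?g (zproj m ` U \<times> {0..<int q}) (zproj n ` U)"
    unfolding bij_betw_def
  proof
    show "inj_on ?g (zproj m ` U \<times> {0..<int q})"
    proof (rule inj_onI, clarify)
      fix x y i j
      assume eq: "zproj m x + int m * i = zproj m y + int m * j"
      then have "(zproj m x + int m * i) mod int m = (zproj m y + int m * j) mod int m" by simp
      then have "zproj m x = zproj m y" using pos by simp
      then show "zproj m x = zproj m y \<and> i = j" using eq pos by simp
    qed
    show "?g ` (zproj m ` U \<times> {0..<int q}) = zproj n ` U"
    proof (intro equalityI subsetI)
      fix b assume "b \<in> ?g ` (zproj m ` U \<times> {0..<int q})"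
      then obtain x j where b: "b = zproj m x + int m * j" "x \<in> U" "0 \<le> j" "j < int q" by auto
      have "int m * (j + 1) \<le> int n"
        unfolding q using b(4) by (simp only: of_nat_mult) (intro mult_left_mono; simp)
      then have "b \<in> {0..<int n}"
        using b zproj_range[OF pos(1), of x] by (auto simp: distrib_left)
      then have y: "zproj n (of_int b) = b" using assms(3) by (intro zproj_of_int_surj)
      have "zproj m (of_int b) = b mod int m" using zproj_mod[OF assms(3,2)] y by metis
      also have "\<dots> = zproj m x" using pos by (simp add: b(1))
      finally have "of_int b \<in> U" using U b(2) unfolding zhat_level_def by blast
      then show "b \<in> zproj n ` U" using y by (metis imageI)
    next
      fix b assume "b \<in> zproj n ` U"
      then obtain x where x: "b = zproj n x" "x \<in> U" by blast
      have "b mod int m = zproj m x" using x zproj_mod[OF assms(3,2)] by simp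
      moreover have "b = b mod int m + int m * (b div int m)" by simp
      moreover have "0 \<le> b div int m" "b div int m < int q"
      proof -
        have "0 \<le> b" "b < int n" using x zproj_range[OF assms(3), of x] by auto
        then show "0 \<le> b div int m" using pos by (simp add: pos_imp_zdiv_nonneg_iff)
        have "int m * (b div int m) \<le> b"
          using pos mult_div_mod_eq[of "int m" b] pos_mod_sign[of "int m" b] by linarith
        then have "int m * (b div int m) < int m * int q" using \<open>b < int n\<close> by (simp add: q)
        then show "b div int m < int q" using pos by simp
      qed
      ultimately show "b \<in> ?g ` (zproj m ` U \<times> {0..<int q})"
        using x(2) by (intro image_eqI[of _ _ "(zproj m x, b div int m)"]) auto
    qed
  qed
  from bij_betw_same_card[OF this] show ?thesis
    using pos by (simp add: q card_cartesian_product)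
qed

definition zhat_density :: "zhat set \<Rightarrow> real" where
  "zhat_density U = (let n = (SOME n. zhat_level U n) in card (zproj n ` U) / n)"

lemma zhat_density_eq:
  assumes "zhat_level U n"
  shows "zhat_density U = card (zproj n ` U) / n"
proof -
  define m where "m = (SOME n. zhat_level U n)"
  have m: "zhat_level U m" unfolding m_def using assms by (rule someI)
  have pos: "0 < m" "0 < n" using m assms by (auto simp: zhat_level_def)
  have "card (zproj (m * n) ` U) / (real m * real n) = card (zproj k ` U) / k" if "k = m \<or> k = n" for k
  proof -
    have "card (zproj (m * n) ` U) * k = card (zproj k ` U) * (m * n)"
      using card_zproj_image_level[of U k "m * n"] that m assms pos by auto
    then have "real (card (zproj (m * n) ` U)) * real k = real (card (zproj k ` U)) * (real m * real n)"
      by (metis of_nat_mult)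
    then show ?thesis using pos that by (auto simp: field_simps)
  qed
  from this[of m] this[of n] show ?thesis
    by (simp add: zhat_density_def Let_def m_def[symmetric])
qed

lemma sets_borel_zhat: "sets borel = sigma_sets UNIV {U :: zhat set. open U \<and> compact U}"
proof -
  let ?R = "{U :: zhat set. open U \<and> compact U}"
  have "sigma_sets UNIV {U :: zhat set. open U} = sigma_sets UNIV ?R"
  proof (rule sigma_sets_eqI)
    fix U :: "zhat set" assume "U \<in> {U. open U}"
    then have "\<forall>x\<in>U. \<exists>n>0. zproj n -` {zproj n x} \<subseteq> U" by (simp add: open_zhat_iff)
    then have "U \<subseteq> \<Union>((\<lambda>(n, a). zproj n -` {a}) ` {(n, a). 0 < n \<and> zproj n -` {a} \<subseteq> U})"
      by fastforce
    then have "U = \<Union>((\<lambda>(n, a). zproj n -` {a}) ` {(n, a). 0 < n \<and> zproj n -` {a} \<subseteq> U})"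
      by auto
    moreover have "\<Union>((\<lambda>(n, a). zproj n -` {a}) ` {(n, a). 0 < n \<and> zproj n -` {a} \<subseteq> U}) \<in> sigma_sets UNIV ?R"
      by (intro sigma_sets_UNION)
        (auto intro!: sigma_sets.Basic simp: open_zproj_vimage closed_zproj_vimage compact_zhat_iff_closed)
    ultimately show "U \<in> sigma_sets UNIV ?R" by simp
  qed auto
  then show ?thesis by (simp add: borel_def)
qed

lemma borel_measure_eqI_zhat:
  fixes M N :: "zhat measure"
  assumes M: "finite_measure M" "sets M = sets borel" and N: "sets N = sets borel"
    and eq: "\<And>U. open U \<Longrightarrow> compact U \<Longrightarrow> emeasure M U = emeasure N U"
  shows "M = N"
proof (rule measure_eqI_generator_eq[of "{U. open U \<and> compact U}" UNIV M N "\<lambda>_. UNIV"])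
  show "Int_stable {U :: zhat set. open U \<and> compact U}"
    by (auto simp: Int_stable_def compact_zhat_iff_closed)
  show "emeasure M UNIV \<noteq> \<infinity>"
    using finite_measure.emeasure_finite[OF M(1)] by simp
qed (use assms compact_UNIV_zhat in \<open>auto simp: sets_borel_zhat\<close>)

lemma zhat_measure_extension:
  fixes v :: "zhat set \<Rightarrow> real"
  assumes nonneg: "\<And>U. open U \<Longrightarrow> compact U \<Longrightarrow> 0 \<le> v U"
    and add: "\<And>U V. open U \<Longrightarrow> compact U \<Longrightarrow> open V \<Longrightarrow> compact V \<Longrightarrow> U \<inter> V = {} \<Longrightarrow> v (U \<union> V) = v U + v V"
  obtains M where "sets M = sets borel" "\<And>U. open U \<Longrightarrow> compact U \<Longrightarrow> emeasure M U = ennreal (v U)"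
proof -
  let ?R = "{U :: zhat set. open U \<and> compact U}"
  have v0: "v {} = 0" using add[of "{}" "{}"] by simp
  interpret ring_of_sets UNIV ?R
    by (rule ring_of_setsI) (auto simp: compact_zhat_iff_closed)
  have "\<exists>\<mu> :: zhat set \<Rightarrow> ennreal. (\<forall>s\<in>?R. \<mu> s = ennreal (v s)) \<and> measure_space UNIV (sigma_sets UNIV ?R) \<mu>"
  proof (rule caratheodory_empty_continuous)
    show "positive ?R (\<lambda>U. ennreal (v U))" by (simp add: positive_def v0)
    show "additive ?R (\<lambda>U. ennreal (v U))"
      by (auto simp: Measure_Space.additive_def add nonneg)
    fix A :: "nat \<Rightarrow> zhat set"
    assume A: "range A \<subseteq> ?R" "decseq A" "(\<Inter>i. A i) = {}"
    have "\<exists>i. A i = {}"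
    proof (rule ccontr)
      assume *: "\<nexists>i. A i = {}"
      have "UNIV \<inter> (\<Inter>i. A i) \<noteq> {}"
      proof (rule compact_imp_fip_image[OF compact_UNIV_zhat])
        show "\<And>i. closed (A i)" using A(1) by (auto simp: compact_zhat_iff_closed)
        fix I :: "nat set" assume "finite I"
        then obtain k where "\<And>i. i \<in> I \<Longrightarrow> i \<le> k"
          unfolding finite_nat_set_iff_bounded_le by metis
        then have "A k \<subseteq> (\<Inter>i\<in>I. A i)" using decseqD[OF A(2)] by (meson INT_greatest)
        then show "UNIV \<inter> (\<Inter>i\<in>I. A i) \<noteq> {}" using * by auto
      qed
      then show False using A(3) by simp
    qed
    then obtain i where i: "A i = {}" by blast
    have "A j = {}" if "j \<ge> i" for j using A(2) i that unfolding decseq_def by blast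
    then have "\<forall>\<^sub>F j in sequentially. ennreal (v (A j)) = 0"
      unfolding eventually_sequentially using v0 by (intro exI[of _ i]) simp
    then show "(\<lambda>j. ennreal (v (A j))) \<longlonglongrightarrow> 0"
      by (rule tendsto_eventually)
  qed auto
  then obtain \<mu> :: "zhat set \<Rightarrow> ennreal"
    where \<mu>: "\<And>s. s \<in> ?R \<Longrightarrow> \<mu> s = ennreal (v s)" "measure_space UNIV (sigma_sets UNIV ?R) \<mu>"
    by blast
  let ?M = "measure_of UNIV ?R \<mu>"
  show ?thesis
  proof (rule that[of ?M])
    show "sets ?M = sets borel" by (simp add: sets_borel_zhat)
    fix U :: "zhat set" assume U: "open U" "compact U"
    then have "emeasure ?M U = \<mu> U"
      using \<mu>(2) by (intro emeasure_measure_of[OF refl])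
        (auto simp: measure_space_def sets_borel_zhat[symmetric] borel_open)
    then show "emeasure ?M U = ennreal (v U)" using \<mu>(1) U by simp
  qed
qed

lemma zhat_density_Un:
  assumes "open U" "compact U" "open V" "compact V" "U \<inter> V = {}"
  shows "zhat_density (U \<union> V) = zhat_density U + zhat_density V"
proof -
  obtain k l where kl: "zhat_level U k" "zhat_level V l" using ex_zhat_level assms by metis
  define n where "n = k * l"
  have n: "0 < n" using kl by (simp add: n_def zhat_level_def)
  have UV: "zhat_level U n" "zhat_level V n"
    using zhat_level_dvd[OF kl(1), of n] zhat_level_dvd[OF kl(2), of n] n by (simp_all add: n_def)
  then have "zhat_level (U \<union> V) n" by (simp add: zhat_level_def image_Un)
  moreover have "zproj n ` U \<inter> zproj n ` V = {}"
    using UV assms(5) unfolding zhat_level_def by blast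
  then have "card (zproj n ` (U \<union> V)) = card (zproj n ` U) + card (zproj n ` V)"
    by (simp add: image_Un card_Un_disjoint finite_zproj_image n)
  ultimately show ?thesis using UV by (simp add: zhat_density_eq add_divide_distrib)
qed

lemma continuous_on_zhat_add: "continuous_on UNIV (\<lambda>x. a + x)" for a :: zhat
  unfolding continuous_on_open_vimage[OF open_UNIV]
proof (intro allI impI)
  fix U :: "zhat set" assume U: "open U"
  show "open ((\<lambda>x. a + x) -` U \<inter> UNIV)"
    unfolding open_zhat_iff
  proof
    fix x assume "x \<in> (\<lambda>x. a + x) -` U \<inter> UNIV"
    then obtain n where n: "0 < n" "zproj n -` {zproj n (a + x)} \<subseteq> U"
      using U by (auto simp: open_zhat_iff)
    have "zproj n -` {zproj n x} \<subseteq> (\<lambda>x. a + x) -` U \<inter> UNIV"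
    proof
      fix y assume "y \<in> zproj n -` {zproj n x}"
      then have "zproj n (a + y) = zproj n (a + x)" using n(1) by simp
      then show "y \<in> (\<lambda>x. a + x) -` U \<inter> UNIV" using n(2) by blast
    qed
    then show "\<exists>n>0. zproj n -` {zproj n x} \<subseteq> (\<lambda>x. a + x) -` U \<inter> UNIV"
      using n(1) by blast
  qed
qed

lemma zhat_density_translate:
  assumes "open U" "compact U"
  shows "zhat_density ((\<lambda>x. a + x) -` U) = zhat_density U"
proof -
  obtain n where n: "zhat_level U n" using ex_zhat_level assms by blast
  then have pos: "0 < n" by (simp add: zhat_level_def)
  have lev: "zhat_level ((\<lambda>x. a + x) -` U) n"
    unfolding zhat_level_def
  proof (intro conjI pos equalityI subsetI)
    fix y assume "y \<in> zproj n -` zproj n ` (\<lambda>x. a + x) -` U"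
    then obtain x where "a + x \<in> U" "zproj n y = zproj n x" by auto
    then have "zproj n (a + y) \<in> zproj n ` U" using pos by (auto simp: image_iff intro!: bexI[of _ "a + x"])
    then show "y \<in> (\<lambda>x. a + x) -` U" using n unfolding zhat_level_def by blast
  qed auto
  have "bij_betw (\<lambda>b. (zproj n a + b) mod int n) (zproj n ` (\<lambda>x. a + x) -` U) (zproj n ` U)"
    unfolding bij_betw_def
  proof
    show "inj_on (\<lambda>b. (zproj n a + b) mod int n) (zproj n ` (\<lambda>x. a + x) -` U)"
    proof (rule inj_onI, clarify)
      fix x y assume "(zproj n a + zproj n x) mod int n = (zproj n a + zproj n y) mod int n"
      then have "(zproj n a + zproj n x - zproj n a) mod int n = (zproj n a + zproj n y - zproj n a) mod int n"
        by (rule mod_diff_cong) simp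
      then show "zproj n x = zproj n y" using pos by simp
    qed
    have "(\<lambda>b. (zproj n a + b) mod int n) ` zproj n ` W = zproj n ` (\<lambda>x. a + x) ` W" for W
      using pos by (simp add: image_image)
    then have "(\<lambda>b. (zproj n a + b) mod int n) ` zproj n ` (\<lambda>x. a + x) -` U
        = zproj n ` (\<lambda>x. a + x) ` (\<lambda>x. a + x) -` U" .
    also have "surj (\<lambda>x. a + x)" by (metis surj_plus)
    then have "(\<lambda>x. a + x) ` (\<lambda>x. a + x) -` U = U" by (simp add: surj_image_vimage_eq)
    finally show "(\<lambda>b. (zproj n a + b) mod int n) ` zproj n ` (\<lambda>x. a + x) -` U = zproj n ` U" .
  qed
  from bij_betw_same_card[OF this] show ?thesis
    using n lev by (simp add: zhat_density_eq)
qed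

lemma normalized_haar_density:
  assumes M: "normalized_haar M" and U: "open U" "compact U"
  shows "measure M U = zhat_density U"
proof -
  interpret prob_space M using M by (simp add: normalized_haar_def)
  have sets: "sets M = sets borel" using M by (simp add: normalized_haar_def)
  then have sp: "space M = UNIV" using sets_eq_imp_space_eq[OF sets] by simp
  obtain n where n: "zhat_level U n" using ex_zhat_level U by blast
  then have pos: "0 < n" by (simp add: zhat_level_def)
  have cyl: "zproj n -` A \<in> sets M" for A
    unfolding sets by (rule borel_open[OF open_zproj_vimage[OF pos]])
  have shift: "measure M (zproj n -` {b}) = measure M (zproj n -` {0})" if "b \<in> {0..<int n}" for b
  proof -
    let ?a = "of_int b :: zhat"
    have vim: "(\<lambda>x. ?a + x) -` (zproj n -` {b}) = zproj n -` {0}"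
    proof (intro equalityI subsetI)
      fix x assume "x \<in> (\<lambda>x. ?a + x) -` (zproj n -` {b})"
      then have "(b + zproj n x) mod int n = b"
        using pos zproj_of_int_surj[OF pos that] by simp
      then have "(b + zproj n x - b) mod int n = (b - b) mod int n"
        by (metis mod_diff_left_eq)
      then show "x \<in> zproj n -` {0}" using pos by simp
    qed (use pos that zproj_of_int_surj[OF pos that] in simp)
    have "measure M (zproj n -` {b}) = measure (distr M borel (\<lambda>x. ?a + x)) (zproj n -` {b})"
      using M by (simp add: normalized_haar_def)
    also have "\<dots> = measure M ((\<lambda>x. ?a + x) -` (zproj n -` {b}) \<inter> space M)"
    proof (rule measure_distr)
      show "(\<lambda>x. ?a + x) \<in> measurable M borel"
        using borel_measurable_continuous_onI[OF continuous_on_zhat_add[of ?a]] sets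
        by (simp cong: measurable_cong_sets)
    qed (use cyl sets in auto)
    finally show ?thesis by (simp add: vim sp)
  qed
  have union: "measure M (zproj n -` A) = card A * measure M (zproj n -` {0})" if "A \<subseteq> {0..<int n}" for A
  proof -
    have "measure M (\<Union>b\<in>A. zproj n -` {b}) = (\<Sum>b\<in>A. measure M (zproj n -` {b}))"
      using that cyl by (intro finite_measure_finite_Union)
        (auto simp: disjoint_family_on_def intro: finite_subset)
    also have "\<dots> = (\<Sum>b\<in>A. measure M (zproj n -` {0}))"
      by (intro sum.cong refl shift) (use that in blast)
    also have "(\<Union>b\<in>A. zproj n -` {b}) = zproj n -` A" by auto
    finally show ?thesis by simp
  qed
  have "zproj n -` {0..<int n} = space M" using zproj_range[OF pos] sp by auto
  then have "1 = real n * measure M (zproj n -` {0})"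
    using union[of "{0..<int n}"] prob_space by simp
  then have "measure M (zproj n -` {0}) = 1 / n" using pos by (simp add: field_simps)
  moreover have "zproj n ` U \<subseteq> {0..<int n}" using zproj_range[OF pos] by auto
  ultimately show ?thesis
    using union[of "zproj n ` U"] n by (simp add: zhat_density_eq[OF n]) (simp add: zhat_level_def)
qed

theorem ex1_normalized_haar: "\<exists>!M. normalized_haar M"
proof (rule ex_ex1I)
  obtain M where M: "sets M = sets borel"
    "\<And>U. open U \<Longrightarrow> compact U \<Longrightarrow> emeasure M U = ennreal (zhat_density U)"
  proof (rule zhat_measure_extension[of zhat_density])
    show "0 \<le> zhat_density U" for U by (simp add: zhat_density_def Let_def)
  qed (simp_all add: zhat_density_Un)
  have sp: "space M = UNIV" using sets_eq_imp_space_eq[OF M(1)] by simp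
  have "zhat_level UNIV 1" by (auto simp: zhat_level_def)
  moreover have "zproj 1 ` UNIV = {0}"
  proof (intro equalityI subsetI)
    show "b \<in> {0}" if "b \<in> zproj 1 ` UNIV" for b
    proof -
      from that obtain x where "b = zproj 1 x" by (rule imageE)
      then show ?thesis using zproj_range[of 1 x] by simp
    qed
    show "b \<in> zproj 1 ` UNIV" if "b \<in> {0}" for b
      using that by (intro image_eqI[of _ _ 0]) simp_all
  qed
  ultimately have "zhat_density UNIV = 1" using zhat_density_eq by fastforce
  then interpret prob_space M
    using M(2)[of UNIV] compact_UNIV_zhat by (intro prob_spaceI) (simp add: sp)
  have "distr M borel (\<lambda>x. a + x) = M" for a
  proof -
    have meas: "(\<lambda>x. a + x) \<in> measurable M borel"
      using borel_measurable_continuous_onI[OF continuous_on_zhat_add[of a]] M(1)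
      by (simp cong: measurable_cong_sets)
    show ?thesis
    proof (rule borel_measure_eqI_zhat)
      show "finite_measure (distr M borel (\<lambda>x. a + x))"
        using prob_space_distr[OF meas] by (simp add: prob_space_def)
      fix U :: "zhat set" assume U: "open U" "compact U"
      then have vim: "open ((\<lambda>x. a + x) -` U)" "closed ((\<lambda>x. a + x) -` U)"
        using continuous_on_zhat_add[of a]
        by (auto simp: compact_zhat_iff_closed intro: open_vimage closed_vimage)
      have "emeasure (distr M borel (\<lambda>x. a + x)) U = emeasure M ((\<lambda>x. a + x) -` U)"
        using U meas by (simp add: emeasure_distr sp)
      then show "emeasure (distr M borel (\<lambda>x. a + x)) U = emeasure M U"
        using U vim by (simp add: M(2) zhat_density_translate compact_zhat_iff_closed)
    qed (simp_all add: M(1))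
  qed
  then show "\<exists>M. normalized_haar M"
    using M(1) prob_space_axioms by (auto simp: normalized_haar_def)
next
  fix M N assume MN: "normalized_haar M" "normalized_haar N"
  then interpret M: prob_space M + N: prob_space N by (simp_all add: normalized_haar_def)
  show "M = N"
    using MN
    by (intro borel_measure_eqI_zhat)
      (auto simp: M.emeasure_eq_measure N.emeasure_eq_measure normalized_haar_density
        normalized_haar_def[of M] normalized_haar_def[of N] M.finite_measure_axioms)
qed

lemma normalized_haar_zhat_haar: "normalized_haar zhat_haar"
  unfolding zhat_haar_def by (rule theI'[OF ex1_normalized_haar])

lemma prob_space_approx_measure:
  assumes "S \<noteq> {}" "0 < n"
  shows "prob_space (approx_measure S n)"
proof
  interpret prob_space zhat_haar using normalized_haar_zhat_haar by (simp add: normalized_haar_def)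
  have sets: "sets zhat_haar = sets borel" using normalized_haar_zhat_haar by (simp add: normalized_haar_def)
  let ?U = "zproj n -` zproj n ` S"
  have U: "open ?U" "compact ?U" "zhat_level ?U n" "zproj n ` ?U = zproj n ` S"
    using assms(2)
    by (auto simp: open_zproj_vimage closed_zproj_vimage compact_zhat_iff_closed zhat_level_def)
  then have "measure zhat_haar ?U = card (zproj n ` S) / n"
    using normalized_haar_density[OF normalized_haar_zhat_haar] zhat_density_eq by simp
  moreover have "0 < card (zproj n ` S)"
    using assms by (simp add: card_gt_0_iff finite_zproj_image)
  moreover have "?U \<in> sets zhat_haar" using sets U(1) by simp
  ultimately show "emeasure (approx_measure S n) (space (approx_measure S n)) = 1"
    using assms(2) unfolding approx_measure_def
    by (simp add: emeasure_density emeasure_eq_measure nn_integral_cmult ennreal_mult'[symmetric]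
        flip: ennreal_1)
qed

lemma sets_approx_measure [simp]: "sets (approx_measure S n) = sets borel"
  using normalized_haar_zhat_haar by (simp add: approx_measure_def normalized_haar_def)

lemma has_procounting_measure_unique:
  assumes "has_procounting_measure S M" "has_procounting_measure S N"
  shows "M = N"
proof -
  interpret M: prob_space M + N: prob_space N using assms by (simp_all add: has_procounting_measure_def)
  show ?thesis
  proof (rule borel_measure_eqI_zhat)
    fix U :: "zhat set" assume "open U" "compact U"
    then have "measure M U = measure N U"
      using assms tendsto_unique[OF dvd_filter_neq_bot] unfolding has_procounting_measure_def by blast
    then show "emeasure M U = emeasure N U" by (simp add: M.emeasure_eq_measure N.emeasure_eq_measure)
  qed (use assms in \<open>auto simp: has_procounting_measure_def M.finite_measure_axioms\<close>)
qed

lemma procounting_measure_eqI: "has_procounting_measure S M \<Longrightarrow> procounting_measure S = M"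
  unfolding procounting_measure_def using has_procounting_measure_unique by blast

theorem procounting_measure_exists_iff:
  assumes "S \<noteq> {}"
  shows "procounting_measure_exists S \<longleftrightarrow>
    (\<forall>U. compact U \<and> open U \<longrightarrow> (\<exists>l. ((\<lambda>n. measure (approx_measure S n) U) \<longlongrightarrow> l) dvd_filter))"
    (is "_ \<longleftrightarrow> ?conv")
proof
  assume ?conv
  then obtain v where v: "\<And>U. compact U \<Longrightarrow> open U \<Longrightarrow>
      ((\<lambda>n. measure (approx_measure S n) U) \<longlongrightarrow> v U) dvd_filter"
    by metis
  have pos: "\<forall>\<^sub>F n in dvd_filter. 0 < n" by (auto simp: eventually_dvd_filter)
  have nonneg: "0 \<le> v U" if "open U" "compact U" for U
    using v[OF that(2,1)] by (rule tendsto_lowerbound) auto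
  have add: "v (U \<union> V) = v U + v V"
    if UV: "open U" "compact U" "open V" "compact V" "U \<inter> V = {}" for U V
  proof (rule tendsto_unique[OF dvd_filter_neq_bot])
    show "((\<lambda>n. measure (approx_measure S n) (U \<union> V)) \<longlongrightarrow> v (U \<union> V)) dvd_filter"
      using UV by (intro v) auto
    have "\<forall>\<^sub>F n in dvd_filter. measure (approx_measure S n) U + measure (approx_measure S n) V
        = measure (approx_measure S n) (U \<union> V)"
      using pos
    proof eventually_elim
      case (elim n)
      interpret prob_space "approx_measure S n" using assms elim by (rule prob_space_approx_measure)
      show ?case using UV by (intro finite_measure_Union[symmetric]) auto
    qed
    then show "((\<lambda>n. measure (approx_measure S n) (U \<union> V)) \<longlongrightarrow> v U + v V) dvd_filter"
      using tendsto_add[OF v[OF UV(2,1)] v[OF UV(4,3)]] by (rule Lim_transform_eventually[rotated])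
  qed
  obtain M where M: "sets M = sets borel" "\<And>U. open U \<Longrightarrow> compact U \<Longrightarrow> emeasure M U = ennreal (v U)"
    using zhat_measure_extension[of v] nonneg add by metis
  have sp: "space M = UNIV" using sets_eq_imp_space_eq[OF M(1)] by simp
  have "\<forall>\<^sub>F n in dvd_filter. 1 = measure (approx_measure S n) UNIV"
    using pos
  proof eventually_elim
    case (elim n)
    interpret prob_space "approx_measure S n" using assms elim by (rule prob_space_approx_measure)
    have "space (approx_measure S n) = UNIV"
      using sets_eq_imp_space_eq[OF sets_approx_measure] by simp
    then show ?case using prob_space by simp
  qed
  then have "((\<lambda>n. measure (approx_measure S n) UNIV) \<longlongrightarrow> 1) dvd_filter"
    by (rule Lim_transform_eventually[OF tendsto_const])
  then have "v UNIV = 1"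
    using v[OF compact_UNIV_zhat open_UNIV] tendsto_unique[OF dvd_filter_neq_bot] by blast
  then have "prob_space M"
    using M(2)[of UNIV] compact_UNIV_zhat by (intro prob_spaceI) (simp add: sp)
  moreover have "measure M U = v U" if "open U" "compact U" for U
    using M(2)[OF that] nonneg[OF that] by (simp add: measure_def)
  ultimately show "procounting_measure_exists S"
    unfolding procounting_measure_exists_def has_procounting_measure_def using assms M(1) v by auto
qed (auto simp: procounting_measure_exists_def has_procounting_measure_def)

end

theory Submission
  imports Defs "HOL-Number_Theory.Number_Theory" "HOL-Computational_Algebra.Squarefree"
begin

text \<open>
  By Dirichlet's theorem, which is proved here by Mertens-type sums over characters, the closure of
  the primes is the union of the primes and the units. The set where all \<open>f\<^sub>j\<close> take unit values is
  given by one condition \<open>a mod p \<in> R p\<close> for each prime \<open>p\<close>, so the size of its image modulo \<open>n\<close> is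
  \<open>n\<close> times the product of \<open>|R p| / p\<close> over the primes dividing \<open>n\<close>. A residue class
  modulo \<open>n\<close> in the image of the larger set but not of the smaller one contains some \<open>a\<close> with
  \<open>f\<^sub>j(a) = q\<close> for a prime \<open>q\<close> dividing \<open>n\<close>. If \<open>f\<^sub>j\<close> is constant modulo only finitely many
  primes, then counting roots modulo every prime shows that the proportion of the solutions of
  \<open>f\<^sub>j(a) = q\<close> is \<open>O(2 ^ -\<omega>)\<close>, where \<open>\<omega>\<close> is the number of primes dividing \<open>n\<close>, and there
  are \<open>\<omega>\<close> choices for \<open>q\<close>. If \<open>f\<^sub>j\<close> is constant modulo infinitely many primes, it attains at
  most one prime \<open>q\<close>, and counting the roots of \<open>f\<^sub>j - q\<close> modulo powers of \<open>q\<close> suffices.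
  The procounting measure of a set given by local conditions exists because the fibres of its image
  modulo \<open>n\<close> over its image modulo \<open>m\<close> are translates of each other.
\<close>

section \<open>Chebyshev and Mertens estimates\<close>

text \<open>The set of points with unit values typically has density zero, so a fibre has to be
  small relative to the image of that set modulo \<open>n\<close>, not merely relative to
  \<open>n\<close>; hence everything is counted by ratios of local factors. The number of primes
  \<open>q\<close> dividing \<open>n\<close> is unbounded, so the bound for the fibre over
  \<open>q\<close> must be uniform in \<open>q\<close>. At a large prime where
  \<open>f\<^sub>j\<close> is not constant, the fibre has at most degree many residues while almost
  all residues give units, so the local ratio drops below 1/2. Because \<open>zhat\<close> has zero
  divisors, even a nonconstant \<open>f\<^sub>j\<close> can be constant modulo infinitely many
  primes; there the ratio gains nothing and may exceed 1. Then only one value \<open>q\<close>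
  matters, the unit conditions that the point still satisfies at other primes are kept in the set
  being counted, and the saving comes from powers of \<open>q\<close>: modulo \<open>q\<close> the
  polynomial \<open>f\<^sub>j - q\<close> does not vanish identically, because
  \<open>f\<^sub>j\<close> takes a unit value. The pair of the primes and the units is the case of
  the identity polynomial, as a set and its closure have the same image modulo every
  \<open>n\<close>.\<close>

lemma sum_divisors_swap:
  fixes g :: "nat \<Rightarrow> nat \<Rightarrow> 'a :: comm_monoid_add"
  shows "(\<Sum>m=1..x. \<Sum>d | d dvd m. g d (m div d)) = (\<Sum>d=1..x. \<Sum>e=1..x div d. g d e)"
proof -
  have "(\<Sum>m=1..x. \<Sum>d | d dvd m. g d (m div d))
      = (\<Sum>(m, d) \<in> (SIGMA m:{1..x}. {d. d dvd m}). g d (m div d))"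
    by (rule sum.Sigma) auto
  also have "\<dots> = (\<Sum>(d, e) \<in> (SIGMA d:{1..x}. {1..x div d}). g d e)"
    by (rule sum.reindex_bij_witness[of _ "\<lambda>(d, e). (d * e, d)" "\<lambda>(m, d). (d, m div d)"])
      (auto simp: less_eq_div_iff_mult_less_eq div_le_mono mult.commute Suc_le_eq div_greater_zero_iff
        intro: dvd_pos_nat dvd_imp_le le_trans[OF dvd_imp_le])
  also have "\<dots> = (\<Sum>d=1..x. \<Sum>e=1..x div d. g d e)"
    by (rule sum.Sigma[symmetric]) auto
  finally show ?thesis .
qed

text \<open>Legendre's formula: each \<open>ln m\<close> is the divisor sum of
  \<open>mangoldt\<close>, and \<open>x div d\<close> counts the multiples of \<open>d\<close> up to
  \<open>x\<close>.\<close>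

lemma ln_fact_eq_sum_mangoldt:
  "ln (fact x) = (\<Sum>d=1..x. mangoldt d * real (x div d))"
proof -
  have "ln (fact x) = (\<Sum>m=1..x. ln (real m))"
    by (induction x) (simp_all add: ln_mult)
  also have "\<dots> = (\<Sum>m=1..x. \<Sum>d | d dvd m. mangoldt d)"
    by (intro sum.cong refl) (simp add: mangoldt_sum)
  also have "\<dots> = (\<Sum>d=1..x. \<Sum>e=1..x div d. mangoldt d)"
    by (rule sum_divisors_swap)
  finally show ?thesis by (simp add: mult.commute)
qed

text \<open>Chebyshev's argument with the central binomial coefficient, which is at most
  \<open>2 ^ (2 * n)\<close>. In its logarithm \<open>mangoldt d\<close> has the weight
  \<open>2 * n div d - 2 * (n div d)\<close>, which is nonnegative and equals 1 for
  \<open>n < d \<le> 2 * n\<close>.\<close>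

lemma sum_mangoldt_double:
  "(\<Sum>d=1..2*n. mangoldt d) \<le> (\<Sum>d=1..n. mangoldt d) + 2 * n * ln (2::real)"
proof -
  have "(2 * n) choose n \<le> 2 ^ (2 * n)"
    by (rule binomial_le_pow2)
  then have le: "ln (real ((2 * n) choose n)) \<le> 2 * n * ln 2"
    by (subst ln_realpow[symmetric], simp)
  have eq: "(\<Sum>d=1..n. mangoldt d * real (n div d)) = (\<Sum>d=1..2*n. mangoldt d * real (n div d))"
    by (rule sum.mono_neutral_left) (auto simp: not_le)
  have "real ((2 * n) choose n) = fact (2 * n) / (fact n * fact n)"
    using binomial_fact[of n "2 * n"] by simp
  then have "ln (real ((2 * n) choose n)) = ln (fact (2 * n)) - 2 * ln (fact n)"
    by (simp add: ln_div ln_mult)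
  also have "\<dots> = (\<Sum>d=1..2*n. mangoldt d * (real (2 * n div d) - 2 * real (n div d)))"
    unfolding ln_fact_eq_sum_mangoldt eq
    by (simp add: sum_subtractf sum_distrib_left algebra_simps)
  also have "\<dots> \<ge> (\<Sum>d=1..2*n. if d \<in> {n<..2*n} then mangoldt d else 0)"
  proof (rule sum_mono)
    fix d assume d: "d \<in> {1..2*n}"
    have "2 * (n div d) \<le> 2 * n div d"
      using d by (subst less_eq_div_iff_mult_less_eq) (auto simp: mult.assoc)
    then have "2 * real (n div d) \<le> real (2 * n div d)"
      by (metis of_nat_le_iff of_nat_mult of_nat_numeral)
    moreover have "2 * n div d = 1" "n div d = 0" if "d \<in> {n<..2*n}"
      using that by (auto intro!: div_nat_eqI)
    ultimately show "(if d \<in> {n<..2*n} then mangoldt d else 0)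
        \<le> mangoldt d * (real (2 * n div d) - 2 * real (n div d))"
      by (auto simp: mangoldt_nonneg)
  qed
  also have "(\<Sum>d=1..2*n. if d \<in> {n<..2*n} then mangoldt d else 0 :: real) = (\<Sum>d\<in>{n<..2*n}. mangoldt d)"
    by (subst sum.inter_restrict[symmetric]) (auto intro!: sum.cong)
  finally have "(\<Sum>d\<in>{n<..2*n}. mangoldt d) \<le> 2 * n * ln (2::real)"
    using le by linarith
  moreover have "{1..2*n} = {1..n} \<union> {n<..2*n}" by auto
  moreover have "(\<Sum>d\<in>{1..n} \<union> {n<..2*n}. mangoldt d) = (\<Sum>d=1..n. mangoldt d) + (\<Sum>d\<in>{n<..2*n}. mangoldt d :: real)"
    by (rule sum.union_disjoint) auto
  ultimately show ?thesis by simp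
qed

lemma sum_mangoldt_le: "(\<Sum>d=1..n. mangoldt d) \<le> 4 * real n"
proof (induction n rule: less_induct)
  case (less n)
  show ?case
  proof (cases "n \<le> 1")
    case True
    then show ?thesis by (cases n) auto
  next
    case False
    define m where "m = n div 2"
    have IH: "(\<Sum>d=1..m. mangoldt d) \<le> 4 * real m"
      by (rule less.IH) (use False in \<open>simp add: m_def\<close>)
    have "ln 2 \<le> (1::real)" using ln_le_minus_one[of 2] by simp
    then have "2 * real m * ln 2 \<le> 2 * real m * 1" by (intro mult_left_mono) auto
    \<comment> \<open>The constant 4 closes the induction: 4m + 2m = 6m for \<open>2 * m\<close>,
      and for \<open>2 * m + 1\<close> the one new term is at most \<open>ln n \<le> 2 * m\<close>,
      giving 8m.\<close>
    then have 1: "(\<Sum>d=1..2*m. mangoldt d) \<le> 6 * real m"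
      using sum_mangoldt_double[of m] IH by simp
    show ?thesis
    proof (cases "n = 2 * m")
      case True
      then show ?thesis using 1 by simp
    next
      case F: False
      then have n: "n = Suc (2 * m)" unfolding m_def by presburger
      have "ln (real n) \<le> 2 * m"
        using ln_le_minus_one[of "real n"] n by simp
      then have "mangoldt n \<le> (2 * m :: real)"
        using mangoldt_le[of n] n by linarith
      then show ?thesis using 1 by (simp add: n)
    qed
  qed
qed

lemma ln_fact_ge: "real x * ln (real x) - real x \<le> ln (fact x)"
proof (induction x)
  case (Suc x)
  show ?case
  proof (cases "x = 0")
    case False
    have "ln (real (Suc x) / real x) \<le> real (Suc x) / real x - 1"
      using False by (intro ln_le_minus_one) auto
    also have "\<dots> = 1 / real x" using False by (simp add: field_simps)
    finally have "real x * (ln (real (Suc x)) - ln (real x)) \<le> 1"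
      using False by (simp add: ln_div field_simps)
    moreover have "ln (fact (Suc x) :: real) = ln (real (Suc x)) + ln (fact x)"
      by (subst fact_Suc) (simp add: ln_mult)
    ultimately show ?thesis using Suc.IH by (simp add: algebra_simps)
  qed auto
qed auto

lemma ln_fact_le: "ln (fact x) \<le> real x * ln (real x)"
proof (cases "x = 0")
  case False
  have "(fact x :: real) \<le> real x ^ x"
    using fact_le_power[of x, where ?'a = real] by simp
  then have "ln (fact x :: real) \<le> ln (real x ^ x)"
    using False by (subst ln_le_cancel_iff) auto
  then show ?thesis using False by (simp add: ln_realpow)
qed auto

text \<open>Lower half of Mertens' first theorem: in the formula for \<open>ln (fact x)\<close> the
  floor \<open>x div d\<close> is at most \<open>x / d\<close>, and the 1 is the error of the weak
  Stirling bound.\<close>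

lemma sum_mangoldt_div_ge:
  assumes "x > 0"
  shows "ln (real x) - 1 \<le> (\<Sum>d=1..x. mangoldt d / real d)"
proof -
  have "real x * ln (real x) - real x \<le> (\<Sum>d=1..x. mangoldt d * real (x div d))"
    using ln_fact_ge[of x] by (simp add: ln_fact_eq_sum_mangoldt)
  also have "\<dots> \<le> (\<Sum>d=1..x. mangoldt d * (real x / real d))"
    by (intro sum_mono mult_left_mono mangoldt_nonneg) (rule of_nat_div_le_of_nat)
  also have "\<dots> = real x * (\<Sum>d=1..x. mangoldt d / real d)"
    by (simp add: sum_distrib_left algebra_simps)
  finally have "real x * (ln (real x) - 1) \<le> real x * (\<Sum>d=1..x. mangoldt d / real d)"
    by (simp add: algebra_simps)
  then show ?thesis using assms by simp
qed

text \<open>Upper half: each floor loses at most 1, so the total loss is a Chebyshev sum, whose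
  bound \<open>4 * x\<close> becomes the constant 4 after division by \<open>x\<close>.\<close>

lemma sum_mangoldt_div_le:
  assumes "x > 0"
  shows "(\<Sum>d=1..x. mangoldt d / real d) \<le> ln (real x) + 4"
proof -
  have "real x * (\<Sum>d=1..x. mangoldt d / real d) = (\<Sum>d=1..x. mangoldt d * (real x / real d))"
    by (simp add: sum_distrib_left algebra_simps)
  also have "\<dots> \<le> (\<Sum>d=1..x. mangoldt d * (real (x div d) + 1))"
  proof (intro sum_mono mult_left_mono mangoldt_nonneg)
    fix d
    show "real x / real d \<le> real (x div d) + 1"
      using floor_divide_of_nat_eq[of x d, where ?'a = real] by linarith
  qed
  also have "\<dots> = ln (fact x) + (\<Sum>d=1..x. mangoldt d)"
    by (simp add: ln_fact_eq_sum_mangoldt distrib_left sum.distrib)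
  also have "\<dots> \<le> real x * ln (real x) + 4 * real x"
    by (intro add_mono ln_fact_le sum_mangoldt_le)
  finally have "real x * (\<Sum>d=1..x. mangoldt d / real d) \<le> real x * (ln (real x) + 4)"
    by (simp add: algebra_simps)
  then show ?thesis using assms by simp
qed

text \<open>A nonprime with nonzero \<open>mangoldt\<close> is \<open>p ^ k\<close> with
  \<open>k \<ge> 2\<close>. The geometric series over \<open>k\<close> is at most
  \<open>2 / p ^ 2\<close>, and \<open>ln p \<le> 2 * p powr (1/2)\<close> leaves terms of the
  convergent series of \<open>4 * p powr (-3/2)\<close>.\<close>

lemma sum_mangoldt_nonprime_bounded:
  "\<exists>C :: real. \<forall>x. (\<Sum>m | m \<in> {1..x} \<and> \<not> prime m. mangoldt m / real m) \<le> C"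
proof -
  have ln_le: "ln (real j) \<le> 2 * real j powr (1/2)" if "j > 0" for j
  proof -
    have "ln (real j powr (1/2)) \<le> real j powr (1/2) - 1"
      using that by (intro ln_le_minus_one) auto
    then show ?thesis using that by (simp add: ln_powr)
  qed
  define C where "C = (\<Sum>j. 4 * real j powr (-3/2))"
  have summ: "summable (\<lambda>j. 4 * real j powr (-3/2))"
    by (intro summable_mult) (simp add: summable_real_powr_iff)
  show ?thesis
  proof (intro exI[of _ C] allI)
    fix x :: nat
    define P where "P = {p\<in>{1..x}. prime p}"
    have P: "p > 1" if "p \<in> P" for p
      using that prime_gt_1_nat by (auto simp: P_def)
    have geo: "(\<Sum>k=2..x. q ^ k) \<le> 2 * q ^ 2" if "0 \<le> q" "q \<le> 1/2" for q :: real
    proof -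
      \<comment> \<open>The extra term makes the induction close: it loses at least half of itself
        at each step, which pays for the new summand.\<close>
      have *: "(\<Sum>k=2..x. q ^ k) + 2 * q ^ Suc x \<le> 2 * q ^ 2" if "1 \<le> x" for x
        using that
      proof (induction x rule: dec_induct)
        case (step x)
        have "2 * q ^ Suc (Suc x) \<le> q ^ Suc x"
          using \<open>q \<le> 1/2\<close> mult_right_mono[of q "1/2" "q ^ Suc x"] \<open>0 \<le> q\<close> by simp
        then show ?case using step by (simp add: sum.cl_ivl_Suc)
      qed (simp add: numeral_2_eq_2)
      show ?thesis
      proof (cases "x = 0")
        case False
        then show ?thesis using *[of x] \<open>0 \<le> q\<close> by (smt (verit) One_nat_def Suc_leI neq0_conv zero_le_power)
      qed auto
    qed
    have "(\<Sum>m | m \<in> {1..x} \<and> \<not> prime m. mangoldt m / real m)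
        = (\<Sum>m | m \<in> {1..x} \<and> \<not> prime m \<and> primepow m. mangoldt m / real m)"
      by (rule sum.mono_neutral_right) (auto simp: mangoldt_def)
    also have "\<dots> \<le> (\<Sum>m\<in>(\<lambda>(p, k). p ^ k) ` (P \<times> {2..x}). mangoldt m / real m)"
    proof (rule sum_mono2)
      show "{m. m \<in> {1..x} \<and> \<not> prime m \<and> primepow m} \<subseteq> (\<lambda>(p, k). p ^ k) ` (P \<times> {2..x})"
      proof clarify
        fix m assume m: "m \<in> {1..x}" "\<not> prime m" "primepow m"
        then obtain p k where pk: "prime p" "0 < k" "m = p ^ k" by (auto simp: primepow_def)
        have "k \<noteq> 1" using m(2) pk by auto
        moreover have "k < p ^ k" using prime_gt_1_nat[OF pk(1)] by (simp add: power_gt_expt)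
        moreover have "p \<le> p ^ k" using pk prime_gt_1_nat[OF pk(1)] by (simp add: self_le_power)
        ultimately show "m \<in> (\<lambda>(p, k). p ^ k) ` (P \<times> {2..x})"
          using pk m(1) prime_gt_1_nat[OF pk(1)] by (intro image_eqI[of _ _ "(p, k)"]) (auto simp: P_def)
      qed
    qed (auto simp: P_def mangoldt_nonneg)
    also have "\<dots> \<le> (\<Sum>z\<in>P \<times> {2..x}. ((\<lambda>m. mangoldt m / real m) \<circ> (\<lambda>(p, k). p ^ k)) z)"
      by (rule sum_image_le) (auto simp: P_def mangoldt_nonneg)
    also have "\<dots> = (\<Sum>p\<in>P. \<Sum>k=2..x. mangoldt (p ^ k) / real (p ^ k))"
      by (subst sum.cartesian_product) (simp add: case_prod_unfold o_def)
    also have "\<dots> = (\<Sum>p\<in>P. ln (real p) * (\<Sum>k=2..x. (1 / real p) ^ k))"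
      by (intro sum.cong refl) (auto simp: sum_distrib_left P_def power_divide)
    also have "\<dots> \<le> (\<Sum>p\<in>P. (2 * real p powr (1/2)) * (2 * (1 / real p) ^ 2))"
      by (intro sum_mono mult_mono ln_le geo) (use P in \<open>fastforce intro!: sum_nonneg\<close>)+
    also have "\<dots> = (\<Sum>p\<in>P. 4 * real p powr (-3/2))"
    proof (intro sum.cong refl)
      fix p assume "p \<in> P"
      then have p: "real p > 0" using P by fastforce
      have "real p powr (-3/2) = real p powr (1/2 - 2)" by simp
      also have "\<dots> = real p powr (1/2) / real p ^ 2"
        using p by (subst powr_diff) (simp add: powr_numeral)
      finally show "(2 * real p powr (1/2)) * (2 * (1 / real p) ^ 2) = 4 * real p powr (-3/2)"
        by (simp add: power_divide)
    qed
    also have "\<dots> \<le> C"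
      unfolding C_def by (rule sum_le_suminf[OF summ]) (auto simp: P_def)
    finally show "(\<Sum>m | m \<in> {1..x} \<and> \<not> prime m. mangoldt m / real m) \<le> C" .
  qed
qed

section \<open>Dirichlet characters\<close>

definition dchars :: "nat \<Rightarrow> (nat \<Rightarrow> complex) set" where
  "dchars n = {\<xi>. \<xi> 1 = 1 \<and> (\<forall>a b. \<xi> (a * b) = \<xi> a * \<xi> b) \<and> (\<forall>a. \<xi> (a mod n) = \<xi> a) \<and>
    (\<forall>a. \<not> coprime a n \<longrightarrow> \<xi> a = 0)}"

definition principal_dchar :: "nat \<Rightarrow> nat \<Rightarrow> complex" where
  "principal_dchar n a = of_bool (coprime a n)"

lemma dchars_1: "\<xi> \<in> dchars n \<Longrightarrow> \<xi> 1 = 1" "\<xi> \<in> dchars n \<Longrightarrow> \<xi> (Suc 0) = 1"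
  and dchars_mult: "\<xi> \<in> dchars n \<Longrightarrow> \<xi> (a * b) = \<xi> a * \<xi> b"
  and dchars_mod: "\<xi> \<in> dchars n \<Longrightarrow> \<xi> (a mod n) = \<xi> a"
  and dchars_not_coprime: "\<xi> \<in> dchars n \<Longrightarrow> \<not> coprime a n \<Longrightarrow> \<xi> a = 0"
  by (simp_all add: dchars_def)

lemma dchars_power: "\<xi> \<in> dchars n \<Longrightarrow> \<xi> (a ^ k) = \<xi> a ^ k"
  by (induction k) (simp_all add: dchars_1 dchars_mult)

lemma dchars_cong:
  assumes "\<xi> \<in> dchars n" "[a = b] (mod n)"
  shows "\<xi> a = \<xi> b"
  using assms dchars_mod[of \<xi> n a] dchars_mod[of \<xi> n b] by (simp add: cong_def)

lemma dchars_power_totient: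
  assumes "\<xi> \<in> dchars n" "coprime a n"
  shows "\<xi> a ^ totient n = 1"
  using dchars_cong[OF assms(1) euler_theorem[OF assms(2)]] assms(1)
  by (simp add: dchars_power dchars_1)

lemma norm_dchars_coprime:
  assumes "n > 0" "\<xi> \<in> dchars n" "coprime a n"
  shows "norm (\<xi> a) = 1"
proof -
  have "norm (\<xi> a) ^ totient n = 1"
    using dchars_power_totient[OF assms(2,3)] by (metis norm_one norm_power)
  then show ?thesis using assms(1) power_eq_imp_eq_base[of "norm (\<xi> a)" "totient n" 1] by simp
qed

lemma norm_dchars_le:
  assumes "n > 0" "\<xi> \<in> dchars n"
  shows "norm (\<xi> a) \<le> 1"
  using norm_dchars_coprime[OF assms, of a] dchars_not_coprime[OF assms(2), of a]
  by (cases "coprime a n") auto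

lemma principal_dchar_in_dchars: "n > 0 \<Longrightarrow> principal_dchar n \<in> dchars n"
  by (auto simp: dchars_def principal_dchar_def)

text \<open>A character is determined by its values on \<open>{..<n}\<close>, and these are 0 or
  roots of unity of order dividing \<open>totient n\<close>.\<close>

lemma finite_dchars:
  assumes "n > 0"
  shows "finite (dchars n)"
proof -
  let ?R = "insert 0 {z :: complex. z ^ totient n = 1}"
  have "finite ?R"
    using assms finite_roots_unity[of "totient n", where ?'a = complex]
    by (simp add: Suc_le_eq)
  then have "finite (PiE {..<n} (\<lambda>_. ?R))"
    by (intro finite_PiE) auto
  moreover have "dchars n \<subseteq> (\<lambda>g a. g (a mod n)) ` PiE {..<n} (\<lambda>_. ?R)"
  proof
    fix \<xi> assume \<xi>: "\<xi> \<in> dchars n"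
    have "restrict \<xi> {..<n} \<in> PiE {..<n} (\<lambda>_. ?R)"
      using dchars_power_totient[OF \<xi>] dchars_not_coprime[OF \<xi>] by auto
    moreover have "\<xi> = (\<lambda>a. restrict \<xi> {..<n} (a mod n))"
      using assms dchars_mod[OF \<xi>] by auto
    ultimately show "\<xi> \<in> (\<lambda>g a. g (a mod n)) ` PiE {..<n} (\<lambda>_. ?R)" by blast
  qed
  ultimately show ?thesis by (meson finite_imageI finite_subset)
qed

lemma dchars_times:
  "\<xi> \<in> dchars n \<Longrightarrow> \<psi> \<in> dchars n \<Longrightarrow> (\<lambda>a. \<xi> a * \<psi> a) \<in> dchars n"
  by (simp add: dchars_def)

lemma dchars_cnj: "\<xi> \<in> dchars n \<Longrightarrow> (\<lambda>a. cnj (\<xi> a)) \<in> dchars n"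
  by (auto simp: dchars_def)

text \<open>
  Averaging over the powers of \<open>g\<close>, twisted by an \<open>r\<close>-th root of unity, projects onto an
  eigenspace of the translation by \<open>g\<close>, and the sum of these projections is the identity.
\<close>

definition unit_root :: "nat \<Rightarrow> complex" where
  "unit_root r = cis (2 * pi / real r)"

definition eigen_proj :: "nat \<Rightarrow> nat \<Rightarrow> nat \<Rightarrow> (nat \<Rightarrow> complex) \<Rightarrow> nat \<Rightarrow> complex" where
  "eigen_proj r k g \<phi> x = (\<Sum>j<r. unit_root r ^ (k * j) * \<phi> (g ^ j * x))"

lemma unit_root_power: "unit_root r ^ k = cis (2 * pi * real k / real r)"
  unfolding unit_root_def Complex.DeMoivre by (rule arg_cong[of _ _ cis]) simp

lemma unit_root_power_self: "r > 0 \<Longrightarrow> unit_root r ^ r = 1"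
  by (simp add: unit_root_power)

lemma unit_root_power_neq_1:
  assumes "0 < k" "k < r"
  shows "unit_root r ^ k \<noteq> 1"
proof
  assume "unit_root r ^ k = 1"
  then have "cis (2 * pi * real k / real r) = cis (2 * pi * real 0 / real r)"
    by (simp add: unit_root_power)
  moreover have inj: "inj_on (\<lambda>k. cis (2 * pi * real k / real r)) {..<r}"
    using Complex.bij_betw_roots_unity[of r] assms by (simp add: bij_betw_def)
  ultimately have "k = 0" using assms by (intro inj_onD[OF inj]) auto
  then show False using assms by simp
qed

lemma sum_unit_root:
  assumes "j < r"
  shows "(\<Sum>k<r. unit_root r ^ (k * j)) = (if j = 0 then of_nat r else 0)"
proof (cases "j = 0")
  case False
  have "(\<Sum>k<r. unit_root r ^ (k * j)) = (\<Sum>k<r. (unit_root r ^ j) ^ k)"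
    by (simp add: power_mult[symmetric] mult.commute)
  also have "\<dots> = ((unit_root r ^ j) ^ r - 1) / (unit_root r ^ j - 1)"
    using False assms by (intro geometric_sum unit_root_power_neq_1) auto
  also have "(unit_root r ^ j) ^ r = (unit_root r ^ r) ^ j"
    by (simp add: power_mult[symmetric] mult.commute)
  finally show ?thesis using False assms by (simp add: unit_root_power_self)
qed auto

lemma sum_eigen_proj:
  assumes "r > 0"
  shows "(\<Sum>k<r. eigen_proj r k g \<phi> x) = of_nat r * \<phi> x"
proof -
  have "(\<Sum>k<r. eigen_proj r k g \<phi> x) = (\<Sum>j<r. (\<Sum>k<r. unit_root r ^ (k * j)) * \<phi> (g ^ j * x))"
    unfolding eigen_proj_def by (subst sum.swap) (simp add: sum_distrib_right)
  also have "\<dots> = (\<Sum>j<r. if j = 0 then of_nat r * \<phi> x else 0)"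
    by (intro sum.cong refl) (simp add: sum_unit_root)
  finally show ?thesis using assms by simp
qed

lemma eigen_proj_neq_0:
  assumes "r > 0" "\<phi> x \<noteq> 0"
  obtains k where "k < r" "eigen_proj r k g \<phi> x \<noteq> 0"
proof -
  have "(\<Sum>k<r. eigen_proj r k g \<phi> x) \<noteq> 0"
    using assms by (simp add: sum_eigen_proj)
  then show ?thesis using that by (metis lessThan_iff sum.neutral)
qed

text \<open>Translation by \<open>g\<close> shifts the index \<open>j\<close>; the sum wraps around
  since the root of unity and the translation both have period \<open>r\<close>.\<close>

lemma eigen_proj_translate:
  assumes "r > 0" "\<And>x. \<phi> (g ^ r * x) = \<phi> x"
  shows "unit_root r ^ k * eigen_proj r k g \<phi> (g * x) = eigen_proj r k g \<phi> x"
proof -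
  define u where "u j = unit_root r ^ (k * j) * \<phi> (g ^ j * x)" for j
  have "unit_root r ^ k * eigen_proj r k g \<phi> (g * x) = (\<Sum>j<r. u (Suc j))"
    by (simp add: eigen_proj_def u_def sum_distrib_left power_add mult_ac)
  also have "\<dots> = (\<Sum>j<Suc r. u j) - u 0"
    by (subst sum.lessThan_Suc_shift) simp
  also have "\<dots> = (\<Sum>j<r. u j) + (u r - u 0)" by simp
  also have "u r = u 0"
  proof -
    have "unit_root r ^ (k * r) = 1"
      using assms(1) by (metis mult.commute power_mult unit_root_power_self power_one)
    then show ?thesis using assms(2) by (simp add: u_def)
  qed
  finally show ?thesis by (simp add: u_def eigen_proj_def)
qed

text \<open>The space on which translations by units act: functions on the unit group modulo
  \<open>n\<close>, lifted to \<open>nat\<close> and extended by 0. Multiplicativity is obtained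
  only later.\<close>

definition unit_class_fun :: "nat \<Rightarrow> (nat \<Rightarrow> complex) \<Rightarrow> bool" where
  "unit_class_fun n \<phi> \<longleftrightarrow> (\<forall>a. \<phi> (a mod n) = \<phi> a) \<and> (\<forall>a. \<not> coprime a n \<longrightarrow> \<phi> a = 0)"

lemma unit_class_fun_cong: "unit_class_fun n \<phi> \<Longrightarrow> [a = b] (mod n) \<Longrightarrow> \<phi> a = \<phi> b"
  unfolding unit_class_fun_def cong_def by metis

lemma unit_class_fun_power_totient:
  assumes "unit_class_fun n \<phi>" "coprime g n"
  shows "\<phi> (g ^ totient n * x) = \<phi> x"
  using unit_class_fun_cong[OF assms(1), of "g ^ totient n * x" "1 * x"]
    cong_scalar_right[OF euler_theorem[OF assms(2)]] by simp

lemma unit_class_fun_eigen_proj: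
  assumes "unit_class_fun n \<phi>"
  shows "unit_class_fun n (eigen_proj r k g \<phi>)"
proof -
  have "\<phi> (g ^ j * (a mod n)) = \<phi> (g ^ j * a)" for j a
    by (rule unit_class_fun_cong[OF assms]) (simp add: cong_def mod_mult_right_eq)
  moreover have "\<phi> (g ^ j * a) = 0" if "\<not> coprime a n" for j a
    using assms that by (simp add: unit_class_fun_def)
  ultimately show ?thesis by (simp add: unit_class_fun_def eigen_proj_def)
qed

text \<open>Translations by units commute and have finite order, so they can be diagonalized one
  after another; this produces characters without the structure theorem for finite abelian groups.
  The eigenvalue \<open>w\<close> of \<open>c\<close> is made different from 1 at the start and
  survives every later projection.\<close>

lemma common_eigenfunction:
  assumes n: "n > 0" and c: "coprime c n" "\<not> [c = 1] (mod n)"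
    and F: "finite F" "\<And>g. g \<in> F \<Longrightarrow> coprime g n"
  shows "\<exists>\<phi> w. unit_class_fun n \<phi> \<and> \<phi> \<noteq> (\<lambda>_. 0) \<and> w \<noteq> 1 \<and> (\<forall>x. \<phi> (c * x) = w * \<phi> x) \<and>
      (\<forall>g\<in>F. \<exists>v. \<forall>x. \<phi> (g * x) = v * \<phi> x)"
proof -
  define r where "r = totient n"
  have r: "r > 0" using n by (simp add: r_def)
  note cls_power = unit_class_fun_power_totient[of n, folded r_def]
  show ?thesis
    using F
  proof (induction F)
    case empty
    define \<delta> :: "nat \<Rightarrow> complex" where "\<delta> x = of_bool ([x = 1] (mod n))" for x
    have \<delta>: "unit_class_fun n \<delta>"
    proof -
      have "coprime a n" if "[a = 1] (mod n)" for a
        using cong_imp_coprime[OF cong_sym[OF that]] by simp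
      moreover have "[a mod n = 1] (mod n) \<longleftrightarrow> [a = 1] (mod n)" for a
        by (simp add: cong_def)
      ultimately show ?thesis
        unfolding unit_class_fun_def \<delta>_def by (metis of_bool_eq(1))
    qed
    \<comment> \<open>The average of this function over the powers of \<open>c\<close> telescopes to
      0 at the point 1, so a projection that is nonzero there has \<open>k \<noteq> 0\<close>, that
      is, an eigenvalue other than 1.\<close>
    define \<phi> where "\<phi> x = \<delta> x - \<delta> (c * x)" for x
    have \<phi>: "unit_class_fun n \<phi>"
      using \<delta> unfolding unit_class_fun_def \<phi>_def by (metis unit_class_fun_cong[OF \<delta>] cong_def mod_mult_right_eq coprime_mult_left_iff diff_zero)
    have "\<phi> 1 \<noteq> 0" using c(2) by (simp add: \<phi>_def \<delta>_def)
    then obtain k where k: "k < r" "eigen_proj r k c \<phi> 1 \<noteq> 0"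
      by (rule eigen_proj_neq_0[OF r])
    have "eigen_proj r 0 c \<phi> 1 = (\<Sum>j<r. \<delta> (c ^ j * 1) - \<delta> (c ^ Suc j * 1))"
      by (simp add: eigen_proj_def \<phi>_def mult_ac)
    also have "\<dots> = \<delta> (c ^ 0 * 1) - \<delta> (c ^ r * 1)"
      by (rule sum_lessThan_telescope')
    also have "\<dots> = 0"
      using cls_power[OF \<delta> c(1), of 1] by simp
    finally have "k \<noteq> 0" using k(2) by metis
    then have neq: "unit_root r ^ k \<noteq> 1" using k(1) by (intro unit_root_power_neq_1) auto
    have eq: "unit_root r ^ k * eigen_proj r k c \<phi> (c * x) = eigen_proj r k c \<phi> x" for x
      using cls_power[OF \<phi> c(1)] by (intro eigen_proj_translate r) auto
    have "unit_root r \<noteq> 0" by (simp add: unit_root_def)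
    then have "eigen_proj r k c \<phi> (c * x) = inverse (unit_root r ^ k) * eigen_proj r k c \<phi> x" for x
      using eq[of x, symmetric] by simp
    then show ?case
      using unit_class_fun_eigen_proj[OF \<phi>] k(2) neq
      by (intro exI[of _ "eigen_proj r k c \<phi>"] exI[of _ "inverse (unit_root r ^ k)"]) (auto simp: fun_eq_iff)
  next
    case (insert g F)
    then obtain \<phi> w where \<phi>: "unit_class_fun n \<phi>" "\<phi> \<noteq> (\<lambda>_. 0)" "w \<noteq> 1" "\<And>x. \<phi> (c * x) = w * \<phi> x"
      "\<And>g. g \<in> F \<Longrightarrow> \<exists>v. \<forall>x. \<phi> (g * x) = v * \<phi> x" by auto
    obtain x where "\<phi> x \<noteq> 0" using \<phi>(2) by (auto simp: fun_eq_iff)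
    then obtain k where k: "k < r" "eigen_proj r k g \<phi> x \<noteq> 0"
      by (rule eigen_proj_neq_0[OF r])
    \<comment> \<open>The projection commutes with the translation by \<open>h\<close>, so it keeps
      every eigenvalue obtained so far.\<close>
    have keep: "eigen_proj r k g \<phi> (h * y) = v * eigen_proj r k g \<phi> y"
      if "\<And>x. \<phi> (h * x) = v * \<phi> x" for h v y
      using that[of "g ^ _ * y"] by (simp add: eigen_proj_def sum_distrib_left mult_ac)
    have eq: "unit_root r ^ k * eigen_proj r k g \<phi> (g * x) = eigen_proj r k g \<phi> x" for x
      using cls_power[OF \<phi>(1)] insert.prems by (intro eigen_proj_translate r) auto
    have "unit_root r \<noteq> 0" by (simp add: unit_root_def)
    then have "eigen_proj r k g \<phi> (g * x) = inverse (unit_root r ^ k) * eigen_proj r k g \<phi> x" for x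
      using eq[of x, symmetric] by simp
    moreover have "\<exists>v. \<forall>x. eigen_proj r k g \<phi> (h * x) = v * eigen_proj r k g \<phi> x" if "h \<in> F" for h
      using \<phi>(5)[OF that] keep by blast
    ultimately have "\<forall>h\<in>insert g F. \<exists>v. \<forall>x. eigen_proj r k g \<phi> (h * x) = v * eigen_proj r k g \<phi> x"
      by blast
    then show ?case
      using unit_class_fun_eigen_proj[OF \<phi>(1)] insert.prems k(2) \<phi>(3) keep[OF \<phi>(4)]
      by (intro exI[of _ "eigen_proj r k g \<phi>"] exI[of _ w]) (auto simp: fun_eq_iff)
  qed
qed

text \<open>An eigenfunction of all unit translations is a character up to its value at 1: its
  eigenvalue for \<open>a\<close> is \<open>\<phi> a / \<phi> 1\<close>.\<close>

lemma dchars_separating: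
  assumes n: "n > 0" and c: "coprime c n" "\<not> [c = 1] (mod n)"
  shows "\<exists>\<xi>\<in>dchars n. \<xi> c \<noteq> 1"
proof -
  obtain \<phi> w where \<phi>: "unit_class_fun n \<phi>" "\<phi> \<noteq> (\<lambda>_. 0)" "w \<noteq> 1"
      "\<forall>x. \<phi> (c * x) = w * \<phi> x" "\<forall>g\<in>totatives n. \<exists>v. \<forall>x. \<phi> (g * x) = v * \<phi> x"
    using common_eigenfunction[OF n c finite_totatives[of n]] by (auto simp: totatives_def)
  have eig: "\<exists>v. \<forall>x. \<phi> (g * x) = v * \<phi> x" if "coprime g n" for g
  \<comment> \<open>Modulo 1 the representative \<open>g mod n\<close> is 0, which is not among the
    totatives, so this case is separate.\<close>
  proof (cases "n = 1")
    case True
    then have "\<phi> (g * x) = \<phi> x" for x by (intro unit_class_fun_cong[OF \<phi>(1)]) (simp add: cong_def)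
    then show ?thesis by (intro exI[of _ 1]) simp
  next
    case False
    have cop: "coprime (g mod n) n" using that n by simp
    then have "g mod n \<noteq> 0" using False by (intro notI) simp
    then have tot: "g mod n \<in> totatives n"
      using cop n by (simp add: totatives_def less_imp_le)
    obtain v where v: "\<forall>x. \<phi> (g mod n * x) = v * \<phi> x"
      using bspec[OF \<phi>(5) tot] by (elim exE)
    have "\<phi> (g * x) = \<phi> (g mod n * x)" for x
      by (rule unit_class_fun_cong[OF \<phi>(1)]) (simp add: cong_def mod_mult_left_eq)
    then show ?thesis using v by auto
  qed
  have one: "\<phi> 1 \<noteq> 0"
  proof
    assume "\<phi> 1 = 0"
    have "\<phi> x = 0" for x
    proof (cases "coprime x n")
      case True
      then obtain v where "\<And>y. \<phi> (x * y) = v * \<phi> y" using eig by blast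
      from this[of 1] show ?thesis using \<open>\<phi> 1 = 0\<close> by simp
    qed (use \<phi>(1) in \<open>simp add: unit_class_fun_def\<close>)
    then show False using \<phi>(2) by auto
  qed
  define \<xi> where "\<xi> a = \<phi> a / \<phi> 1" for a
  have "\<xi> (a * b) = \<xi> a * \<xi> b" for a b
  proof (cases "coprime a n")
    case True
    then obtain v where v: "\<And>y. \<phi> (a * y) = v * \<phi> y" using eig by blast
    from v[of 1] v[of b] show ?thesis using one by (simp add: \<xi>_def)
  next
    case False
    then show ?thesis using \<phi>(1) by (simp add: \<xi>_def unit_class_fun_def)
  qed
  moreover have "\<xi> 1 = 1" "\<xi> (a mod n) = \<xi> a" "\<not> coprime a n \<Longrightarrow> \<xi> a = 0" for a
    using \<phi>(1) one by (simp_all add: unit_class_fun_def \<xi>_def)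
  ultimately have "\<xi> \<in> dchars n"
    unfolding dchars_def by blast
  moreover have "\<xi> c \<noteq> 1"
    using spec[OF \<phi>(4), of 1] one \<phi>(3) by (simp add: \<xi>_def)
  ultimately show ?thesis by blast
qed

section \<open>Orthogonality and partial sums of characters\<close>

lemma sum_dchars:
  assumes n: "n > 0" and c: "coprime c n"
  shows "(\<Sum>\<xi>\<in>dchars n. \<xi> c) = (if [c = 1] (mod n) then of_nat (card (dchars n)) else 0)"
proof (cases "[c = 1] (mod n)")
  case True
  have "(\<Sum>\<xi>\<in>dchars n. \<xi> c) = (\<Sum>\<xi>\<in>dchars n. 1)"
  proof (intro sum.cong refl)
    show "\<xi> c = 1" if "\<xi> \<in> dchars n" for \<xi>
      using dchars_cong[OF that True] dchars_1(1)[OF that] by simp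
  qed
  then show ?thesis using True by simp
next
  case False
  obtain \<psi> where \<psi>: "\<psi> \<in> dchars n" "\<psi> c \<noteq> 1"
    using dchars_separating[OF n c False] by blast
  \<comment> \<open>Multiplication by a character that separates \<open>c\<close> from 1 permutes
    the characters, so the sum equals \<open>\<psi> c\<close> times itself.\<close>
  let ?h = "\<lambda>\<xi> a. \<psi> a * \<xi> a"
  have inj: "inj_on ?h (dchars n)"
  proof (rule inj_onI, rule ext)
    fix \<xi> \<xi>' a assume *: "\<xi> \<in> dchars n" "\<xi>' \<in> dchars n" "?h \<xi> = ?h \<xi>'"
    show "\<xi> a = \<xi>' a"
    proof (cases "coprime a n")
      case True
      then have "\<psi> a \<noteq> 0" using norm_dchars_coprime[OF n \<psi>(1)] by fastforce
      then show ?thesis using fun_cong[OF *(3), of a] by simp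
    qed (use * dchars_not_coprime[of \<xi> n a] dchars_not_coprime[of \<xi>' n a] in auto)
  qed
  have "?h ` dchars n = dchars n"
    using inj dchars_times[OF \<psi>(1)] by (intro endo_inj_surj finite_dchars n) auto
  then have "(\<Sum>\<xi>\<in>dchars n. \<xi> c) = (\<Sum>\<xi>\<in>?h ` dchars n. \<xi> c)" by simp
  also have "\<dots> = (\<Sum>\<xi>\<in>dchars n. \<psi> c * \<xi> c)" by (subst sum.reindex[OF inj]) simp
  also have "\<dots> = \<psi> c * (\<Sum>\<xi>\<in>dchars n. \<xi> c)" by (simp add: sum_distrib_left)
  finally show ?thesis using \<psi>(2) False by simp
qed

text \<open>Dual to orthogonality: here a unit \<open>c\<close> with
  \<open>\<xi> c \<noteq> 1\<close> permutes the residues.\<close>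

lemma sum_dchar_period:
  assumes n: "n > 0" and \<xi>: "\<xi> \<in> dchars n" "\<xi> \<noteq> principal_dchar n"
  shows "(\<Sum>a<n. \<xi> a) = 0"
proof -
  obtain c where c: "coprime c n" "\<xi> c \<noteq> 1"
    using \<xi> dchars_not_coprime[OF \<xi>(1)] by (auto simp: principal_dchar_def fun_eq_iff of_bool_def split: if_splits)
  let ?h = "\<lambda>a. c * a mod n"
  have inj: "inj_on ?h {..<n}"
  proof (rule inj_onI)
    fix a b assume ab: "a \<in> {..<n}" "b \<in> {..<n}" "?h a = ?h b"
    then have "[a = b] (mod n)"
      using c(1) by (metis cong_def cong_mult_lcancel_nat)
    then show "a = b" using ab by (simp add: cong_def)
  qed
  have "?h ` {..<n} = {..<n}"
    using n inj by (intro endo_inj_surj) auto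
  then have "(\<Sum>a<n. \<xi> a) = (\<Sum>a\<in>?h ` {..<n}. \<xi> a)" by simp
  also have "\<dots> = (\<Sum>a<n. \<xi> c * \<xi> a)"
    by (subst sum.reindex[OF inj]) (simp add: dchars_mod[OF \<xi>(1)] dchars_mult[OF \<xi>(1)])
  also have "\<dots> = \<xi> c * (\<Sum>a<n. \<xi> a)" by (simp add: sum_distrib_left)
  finally show ?thesis using c(2) by simp
qed

lemma norm_sum_dchar_le:
  assumes n: "n > 0" and \<xi>: "\<xi> \<in> dchars n" "\<xi> \<noteq> principal_dchar n"
  shows "norm (\<Sum>a=1..N. \<xi> a) \<le> real n"
proof -
  have *: "norm (\<Sum>a<N. \<xi> a) \<le> real n" for N
  proof (induction N rule: less_induct)
    case (less N)
    show ?case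
    proof (cases "N < n")
      case True
      have "norm (\<Sum>a<N. \<xi> a) \<le> (\<Sum>a<N. 1)"
        by (intro sum_norm_le norm_dchars_le[OF n \<xi>(1)])
      then show ?thesis using True by simp
    next
      case False
      then have "(\<Sum>a<N. \<xi> a) = (\<Sum>a<n. \<xi> a) + (\<Sum>a=n..<N. \<xi> a)"
        by (simp add: sum.atLeastLessThan_concat atLeast0LessThan[symmetric])
      also have "(\<Sum>a=n..<N. \<xi> a) = (\<Sum>a<N - n. \<xi> (a + n))"
        using False sum.shift_bounds_nat_ivl[of \<xi> 0 n "N - n"]
        by (simp add: atLeast0LessThan)
      also have "\<dots> = (\<Sum>a<N - n. \<xi> a)"
        by (intro sum.cong refl dchars_cong[OF \<xi>(1)]) (simp add: cong_def)
      finally show ?thesis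
        using less.IH[of "N - n"] False n by (simp add: sum_dchar_period[OF n \<xi>])
    qed
  qed
  \<comment> \<open>Modulo 1 the value at 0 would be 1, but there every character is principal. For
    other \<open>n\<close> the value at 0 is 0, and the sum may start at 1.\<close>
  have "n \<noteq> 1"
  proof
    assume "n = 1"
    then have "\<xi> a = 1" for a
      using dchars_cong[OF \<xi>(1), of a 1] dchars_1[OF \<xi>(1)] by (simp add: cong_def)
    then show False using \<xi>(2) \<open>n = 1\<close> by (auto simp: principal_dchar_def)
  qed
  then have "\<xi> 0 = 0" using dchars_not_coprime[OF \<xi>(1), of 0] by simp
  moreover have "{..<Suc N} = insert 0 {1..N}" by auto
  ultimately have "(\<Sum>a<Suc N. \<xi> a) = (\<Sum>a=1..N. \<xi> a)" by simp
  then show ?thesis using *[of "Suc N"] by simp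
qed

section \<open>Character sums of the Mangoldt function\<close>

definition moebius :: "nat \<Rightarrow> real" where
  "moebius n = (if squarefree n then (-1) ^ card (prime_factors n) else 0)"

lemma abs_moebius_le: "\<bar>moebius n\<bar> \<le> 1"
  by (simp add: moebius_def)

lemma moebius_prime_mult:
  assumes "prime p" "\<not> p dvd n" "n > 0"
  shows "moebius (p * n) = - moebius n"
proof -
  have "coprime p n" using assms by (simp add: prime_imp_coprime)
  then have "squarefree (p * n) \<longleftrightarrow> squarefree n"
    using assms squarefree_mult_coprime[of p n] squarefree_prime[OF assms(1)]
      squarefree_multD(2)[of p n] by auto
  moreover have "prime_factors (p * n) = insert p (prime_factors n)"
    using assms by (subst prime_factors_product) (auto simp: prime_prime_factors)
  moreover have "p \<notin> prime_factors n" using assms(2) by auto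
  ultimately show ?thesis by (simp add: moebius_def)
qed

text \<open>\<open>flip\<close> adds or removes one fixed prime of \<open>m\<close>; it is an
  involution on the squarefree divisors that changes the sign of \<open>moebius\<close>.\<close>

lemma sum_moebius_divisors:
  assumes "m > 0"
  shows "(\<Sum>d | d dvd m. moebius d) = of_bool (m = 1)"
proof (cases "m = 1")
  case False
  then obtain p where p: "prime p" "p dvd m"
    using prime_factor_nat by blast
  define flip where "flip d = (if p dvd d then d div p else p * d)" for d
  define D where "D = {d. d dvd m \<and> squarefree d}"
  have pos: "d > 0" if "d \<in> D" for d
    using that assms unfolding D_def by (metis dvd_pos_nat mem_Collect_eq)
  have p0: "p > 0" using p(1) by (simp add: prime_gt_0_nat)
  have *: "flip d \<in> D \<and> flip (flip d) = d \<and> moebius (flip d) = - moebius d" if d: "d \<in> D" for d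
  proof (cases "p dvd d")
    case True
    then obtain e where e: "d = p * e" by blast
    have "\<not> p dvd e"
    proof
      assume "p dvd e"
      then have "p ^ 2 dvd d" by (simp add: e power2_eq_square)
      then have "p dvd 1" using d unfolding D_def squarefree_def by blast
      then show False using p(1) by simp
    qed
    moreover have "e \<in> D"
      using d squarefree_multD(2)[of p e] by (auto simp: D_def e intro: dvd_mult_right)
    ultimately show ?thesis
      using moebius_prime_mult[OF p(1), of e] pos[of e] p0 by (simp add: flip_def e)
  next
    case False
    then have cop: "coprime p d" using p(1) by (simp add: prime_imp_coprime)
    then have "p * d dvd m" using d p(2) by (auto simp: D_def intro: divides_mult)
    moreover have "squarefree (p * d)"
      using cop d squarefree_prime[OF p(1)] by (auto simp: D_def intro: squarefree_mult_coprime)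
    ultimately show ?thesis
      using False moebius_prime_mult[OF p(1) False pos[OF d]] p0 by (simp add: flip_def D_def)
  qed
  have "(\<Sum>d\<in>D. moebius d) = (\<Sum>d\<in>D. - moebius d)"
    using * by (intro sum.reindex_bij_witness[of _ flip flip]) force+
  then have "(\<Sum>d\<in>D. moebius d) = 0"
    unfolding sum_negf by (rule equal_neg_zero[THEN iffD1])
  moreover have "(\<Sum>d | d dvd m. moebius d) = (\<Sum>d\<in>D. moebius d)"
    using assms by (intro sum.mono_neutral_right) (auto simp: D_def moebius_def)
  ultimately show ?thesis using False by (simp del: One_nat_def)
qed (simp add: moebius_def)

lemma sum_divisors_divisors_swap:
  fixes g :: "nat \<Rightarrow> nat \<Rightarrow> 'a :: comm_monoid_add"
  assumes "m > 0"
  shows "(\<Sum>d | d dvd m. \<Sum>e | e dvd m div d. g d e) = (\<Sum>e | e dvd m. \<Sum>d | d dvd m div e. g d e)"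
proof -
  let ?D = "{d. d dvd m}"
  have set: "{e. e dvd m div d} = {e. e \<in> ?D \<and> d * e dvd m}" if "d dvd m" for d
  proof -
    have "d \<noteq> 0" using that assms by auto
    then have "e dvd m div d \<longleftrightarrow> d * e dvd m" for e
      using that by (simp add: dvd_div_iff_mult mult.commute)
    then show ?thesis by (auto dest: dvd_mult_right)
  qed
  have "(\<Sum>d\<in>?D. \<Sum>e | e dvd m div d. g d e) = (\<Sum>d\<in>?D. \<Sum>e | e \<in> ?D \<and> d * e dvd m. g d e)"
    by (intro sum.cong refl) (simp_all only: set mem_Collect_eq)
  also have "\<dots> = (\<Sum>e\<in>?D. \<Sum>d | d \<in> ?D \<and> d * e dvd m. g d e)"
    using assms by (intro sum.swap_restrict) auto
  also have "\<dots> = (\<Sum>e\<in>?D. \<Sum>d | d dvd m div e. g d e)"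
    by (intro sum.cong refl) (simp_all only: set mem_Collect_eq mult.commute)
  finally show ?thesis .
qed

text \<open>Moebius inversion of the divisor sum of \<open>mangoldt\<close> gives the sum with
  \<open>ln (m div d)\<close>; the part with \<open>ln m\<close> cancels, since
  \<open>moebius\<close> sums to 0 unless \<open>m = 1\<close>, where the logarithm is 0.\<close>

lemma sum_moebius_ln:
  assumes "m > 0"
  shows "(\<Sum>d | d dvd m. moebius d * ln (real d)) = - mangoldt m"
proof -
  have "(\<Sum>d | d dvd m. moebius d * ln (real (m div d)))
      = (\<Sum>d | d dvd m. \<Sum>e | e dvd m div d. moebius d * mangoldt e)"
  proof (intro sum.cong refl)
    fix d assume "d \<in> {d. d dvd m}"
    then have "m div d \<noteq> 0" using assms by (simp add: dvd_div_eq_0_iff)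
    then show "moebius d * ln (real (m div d)) = (\<Sum>e | e dvd m div d. moebius d * mangoldt e)"
      using mangoldt_sum[of "m div d", where ?'a = real] by (simp add: sum_distrib_left[symmetric])
  qed
  also have "\<dots> = (\<Sum>e | e dvd m. \<Sum>d | d dvd m div e. moebius d * mangoldt e)"
    by (rule sum_divisors_divisors_swap[OF assms])
  also have "\<dots> = (\<Sum>e | e dvd m. if e = m then mangoldt e else 0)"
  proof (intro sum.cong refl)
    fix e assume e: "e \<in> {e. e dvd m}"
    then obtain k where k: "m = e * k" by blast
    have "m div e > 0" "m div e = 1 \<longleftrightarrow> e = m" using assms unfolding k by auto
    moreover note e
    ultimately show "(\<Sum>d | d dvd m div e. moebius d * mangoldt e) = (if e = m then mangoldt e else 0)"
      by (simp add: sum_distrib_right[symmetric] sum_moebius_divisors)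
  qed
  also have "\<dots> = mangoldt m" using assms by simp
  finally have 1: "(\<Sum>d | d dvd m. moebius d * ln (real (m div d))) = mangoldt m" .
  have "(\<Sum>d | d dvd m. moebius d * ln (real d)) + (\<Sum>d | d dvd m. moebius d * ln (real (m div d)))
      = (\<Sum>d | d dvd m. moebius d * ln (real m))"
    unfolding sum.distrib[symmetric]
  proof (intro sum.cong refl)
    fix d assume "d \<in> {d. d dvd m}"
    then obtain e where "m = d * e" by blast
    then show "moebius d * ln (real d) + moebius d * ln (real (m div d)) = moebius d * ln (real m)"
      using assms by (simp add: ln_mult distrib_left)
  qed
  also have "\<dots> = 0"
    using assms by (simp add: sum_distrib_right[symmetric] sum_moebius_divisors)
  finally show ?thesis using 1 by linarith
qed

section \<open>Summation by parts and the value of the L-series at 1\<close>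

lemma norm_sum_Abel_le:
  fixes c :: "nat \<Rightarrow> complex" and b :: "nat \<Rightarrow> real"
  assumes C: "\<And>N. norm (\<Sum>a=1..N. c a) \<le> C"
    and dec: "\<And>a. M < a \<Longrightarrow> b (Suc a) \<le> b a" and nonneg: "\<And>a. M < a \<Longrightarrow> 0 \<le> b a"
  shows "norm (\<Sum>a\<in>{M<..N}. of_real (b a) * c a) \<le> 2 * C * b (Suc M)"
proof (cases "M < N")
  case True
  define T where "T k = (\<Sum>a=1..k. c a)" for k
  have T: "norm (of_real x * T k) \<le> x * C" if "x \<ge> 0" for x k
    using that C[of k] by (simp add: norm_mult T_def mult_left_mono)
  \<comment> \<open>With the boundary terms moved to the left, each step adds
    \<open>(b N - b (Suc N)) * T N\<close>, and these differences telescope. Together with the two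
    boundary terms they amount to \<open>2 * C * b (Suc M)\<close>.\<close>
  have "norm ((\<Sum>a\<in>{M<..N}. of_real (b a) * c a) - of_real (b N) * T N + of_real (b (Suc M)) * T M)
      \<le> (b (Suc M) - b N) * C"
    using Suc_leI[OF True]
  proof (induction N rule: dec_induct)
    case base
    have "{M<..Suc M} = {Suc M}" by auto
    then show ?case by (simp add: T_def algebra_simps)
  next
    case (step N)
    have "{M<..Suc N} = insert (Suc N) {M<..N}" using step.hyps by auto
    then have "(\<Sum>a\<in>{M<..Suc N}. of_real (b a) * c a) - of_real (b (Suc N)) * T (Suc N) + of_real (b (Suc M)) * T M
        = ((\<Sum>a\<in>{M<..N}. of_real (b a) * c a) - of_real (b N) * T N + of_real (b (Suc M)) * T M)
          + of_real (b N - b (Suc N)) * T N"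
      by (simp add: T_def algebra_simps)
    also have "norm \<dots> \<le> (b (Suc M) - b N) * C + (b N - b (Suc N)) * C"
      using step dec[of N] by (intro norm_triangle_mono T) auto
    finally show ?case by (simp add: algebra_simps)
  qed
  moreover have "norm (of_real (b N) * T N) \<le> b N * C" "norm (of_real (b (Suc M)) * T M) \<le> b (Suc M) * C"
    using nonneg True by (auto intro!: T)
  moreover have "norm x \<le> norm (x - y + z) + norm y + norm z" for x y z :: complex
    using norm_triangle_ineq[of "x - y + z" "y - z"] norm_triangle_ineq4[of y z] by simp
  ultimately have "norm (\<Sum>a\<in>{M<..N}. of_real (b a) * c a)
      \<le> (b (Suc M) - b N) * C + b N * C + b (Suc M) * C"
    by (smt (verit))
  then show ?thesis by (simp add: algebra_simps)
next
  case False
  have "0 \<le> C" using C[of 0] by simp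
  then show ?thesis using False nonneg by simp
qed

definition mangoldt_sum :: "(nat \<Rightarrow> complex) \<Rightarrow> nat \<Rightarrow> complex" where
  "mangoldt_sum \<xi> x = (\<Sum>m=1..x. \<xi> m * of_real (mangoldt m / real m))"

locale nonprincipal_dchar =
  fixes n :: nat and \<xi> :: "nat \<Rightarrow> complex"
  assumes n_pos: "n > 0" and dchar: "\<xi> \<in> dchars n" and nonprincipal: "\<xi> \<noteq> principal_dchar n"
begin

definition Lsum :: "nat \<Rightarrow> complex" where
  "Lsum N = (\<Sum>m=1..N. \<xi> m / of_nat m)"

definition L1 :: complex where
  "L1 = lim Lsum"

lemma norm_Lsum_diff:
  assumes "M \<le> N"
  shows "norm (Lsum N - Lsum M) \<le> 2 * real n / real (Suc M)"
proof -
  have "{1..N} = {1..M} \<union> {M<..N}" using assms by auto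
  then have "Lsum N = Lsum M + (\<Sum>m\<in>{M<..N}. \<xi> m / of_nat m)"
    unfolding Lsum_def by (simp only:) (rule sum.union_disjoint, auto)
  then have "Lsum N - Lsum M = (\<Sum>m\<in>{M<..N}. of_real (1 / real m) * \<xi> m)"
    by simp
  also have "norm \<dots> \<le> 2 * real n * (1 / real (Suc M))"
    by (intro norm_sum_Abel_le norm_sum_dchar_le[OF n_pos dchar nonprincipal]) (auto simp: frac_le)
  finally show ?thesis by simp
qed

lemma Lsum_tendsto: "Lsum \<longlonglongrightarrow> L1"
proof -
  have "Cauchy Lsum"
  proof (rule CauchyI)
    fix e :: real assume e: "e > 0"
    obtain M where M: "2 * real n / e < real M" using reals_Archimedean2 by blast
    have M0: "0 < real (Suc M)" by simp
    have "2 * real n / real (Suc M) < e"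
      using M e by (simp add: field_simps)
    show "\<exists>M. \<forall>m\<ge>M. \<forall>k\<ge>M. norm (Lsum m - Lsum k) < e"
    proof (intro exI allI impI)
      fix m k assume mk: "M \<le> m" "M \<le> k"
      have *: "norm (Lsum j - Lsum i) < e" if "M \<le> i" "i \<le> j" for i j
      proof -
        have "2 * real n / real (Suc i) \<le> 2 * real n / real (Suc M)"
          using that by (intro divide_left_mono) auto
        then show ?thesis
          using norm_Lsum_diff[OF that(2)] \<open>2 * real n / real (Suc M) < e\<close> by linarith
      qed
      show "norm (Lsum m - Lsum k) < e"
        using *[of k m] *[of m k] mk by (cases "k \<le> m") (auto simp: norm_minus_commute)
    qed
  qed
  then show ?thesis
    unfolding L1_def using Cauchy_convergent convergent_LIMSEQ_iff by blast
qed

lemma norm_L1_diff: "norm (L1 - Lsum M) \<le> 2 * real n / real (Suc M)"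
proof (rule Lim_bounded)
  show "(\<lambda>N. norm (Lsum N - Lsum M)) \<longlonglongrightarrow> norm (L1 - Lsum M)"
    by (intro tendsto_intros Lsum_tendsto)
  show "\<forall>N\<ge>M. norm (Lsum N - Lsum M) \<le> 2 * real n / real (Suc M)"
    using norm_Lsum_diff by blast
qed

lemma norm_L1_diff_div:
  assumes "0 < d" "0 < x"
  shows "norm (Lsum (x div d) - L1) \<le> 2 * real n * (real d / real x)"
proof -
  have "real x / real d \<le> real (Suc (x div d))"
    using floor_divide_of_nat_eq[of x d, where ?'a = real] by linarith
  then have "2 * real n / real (Suc (x div d)) \<le> 2 * real n / (real x / real d)"
    using assms by (intro divide_left_mono) auto
  then show ?thesis
    using norm_L1_diff[of "x div d"] by (simp add: norm_minus_commute)
qed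

lemma sum_dchar_ln_bounded:
  "\<exists>D. \<forall>x. norm (\<Sum>m=1..x. \<xi> m * of_real (ln (real m) / real m)) \<le> D"
proof -
  define g where "g = (\<lambda>m. \<xi> m * of_real (ln (real m) / real m))"
  \<comment> \<open>The quotient \<open>ln a / a\<close> decreases only once
    \<open>ln a \<ge> 1\<close>, that is, from 3 on; the two terms before are split off.\<close>
  have dec: "ln (real (Suc a)) / real (Suc a) \<le> ln (real a) / real a" if "2 < a" for a
  proof -
    have "ln (real (Suc a) / real a) \<le> real (Suc a) / real a - 1"
      using that by (intro ln_le_minus_one) auto
    also have "\<dots> = 1 / real a" using that by (simp add: field_simps)
    finally have "real a * (ln (real (Suc a)) - ln (real a)) \<le> 1"
      using that by (simp add: ln_div field_simps)
    moreover have "1 \<le> ln (real a)"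
      using that exp_le by (subst ln_ge_iff) auto
    ultimately have "real a * ln (real (Suc a)) \<le> ln (real a) * real (Suc a)"
      by (simp add: algebra_simps)
    then show ?thesis using that by (simp add: divide_simps mult.commute)
  qed
  have "norm (\<Sum>a\<in>{2<..x}. g a) \<le> 2 * real n * (ln (real (Suc 2)) / real (Suc 2))" for x
  proof -
    have "norm (\<Sum>a\<in>{2<..x}. of_real (ln (real a) / real a) * \<xi> a) \<le> 2 * real n * (ln (real (Suc 2)) / real (Suc 2))"
      using dec by (intro norm_sum_Abel_le[where b = "\<lambda>a. ln (real a) / real a"] norm_sum_dchar_le[OF n_pos dchar nonprincipal]) auto
    then show ?thesis by (simp add: g_def mult.commute)
  qed
  note tail = this
  show ?thesis
  proof (intro exI[of _ "norm (g 1) + norm (g 2) + 2 * real n * (ln (real (Suc 2)) / real (Suc 2))"] allI)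
    fix x :: nat
    have "norm (\<Sum>m=1..x. g m) \<le> norm (g 1) + norm (g 2) + norm (\<Sum>a\<in>{2<..x}. g a)"
    proof -
      consider "x = 0" | "x = 1" | "x \<ge> 2" by linarith
      then show ?thesis
      proof cases
        case 3
        then have "{1..x} = {1, 2} \<union> {2<..x}" by auto
        then have "(\<Sum>m=1..x. g m) = g 1 + g 2 + (\<Sum>a\<in>{2<..x}. g a)"
          by (simp only:) (subst sum.union_disjoint, auto)
        then show ?thesis
          by (simp only:) (intro order_trans[OF norm_triangle_ineq] add_mono norm_triangle_ineq order_refl)
      qed auto
    qed
    then show "norm (\<Sum>m=1..x. \<xi> m * of_real (ln (real m) / real m))
        \<le> norm (g 1) + norm (g 2) + 2 * real n * (ln (real (Suc 2)) / real (Suc 2))"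
      using tail[of x] by (simp add: g_def)
  qed
qed

lemma dchar_divisor: "d dvd m \<Longrightarrow> \<xi> m / of_nat m = (\<xi> d / of_nat d) * (\<xi> (m div d) / of_nat (m div d))"
  by (auto elim!: dvdE simp: dchars_mult[OF dchar])

lemma sum_dchar_divisors:
  "(\<Sum>m=1..x. \<xi> m / of_nat m * of_real (\<Sum>d | d dvd m. h d)) = (\<Sum>d=1..x. \<xi> d / of_nat d * of_real (h d) * Lsum (x div d))"
proof -
  have "(\<Sum>m=1..x. \<xi> m / of_nat m * of_real (\<Sum>d | d dvd m. h d))
      = (\<Sum>m=1..x. \<Sum>d | d dvd m. \<xi> d / of_nat d * of_real (h d) * (\<xi> (m div d) / of_nat (m div d)))"
    by (intro sum.cong refl) (simp add: sum_distrib_left dchar_divisor mult_ac cong: conj_cong)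
  also have "\<dots> = (\<Sum>d=1..x. \<Sum>e=1..x div d. \<xi> d / of_nat d * of_real (h d) * (\<xi> e / of_nat e))"
    by (rule sum_divisors_swap)
  also have "\<dots> = (\<Sum>d=1..x. \<xi> d / of_nat d * of_real (h d) * Lsum (x div d))"
    by (simp add: Lsum_def sum_distrib_left)
  finally show ?thesis .
qed

text \<open>As the divisor sum of \<open>mangoldt\<close> is \<open>ln\<close>, the bounded sum of
  \<open>\<xi> m * ln m / m\<close> is the \<open>mangoldt\<close> sum with weights
  \<open>Lsum (x div d)\<close>. Replacing these weights by \<open>L1\<close> costs
  \<open>2 * n * d / x\<close> each, in total \<open>8 * n\<close> by Chebyshev's bound.\<close>

lemma mangoldt_sum_dchar_bounded:
  assumes "L1 \<noteq> 0"
  shows "\<exists>C. \<forall>x. norm (mangoldt_sum \<xi> x) \<le> C"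
proof -
  obtain D where D: "\<And>x. norm (\<Sum>m=1..x. \<xi> m * of_real (ln (real m) / real m)) \<le> D"
    using sum_dchar_ln_bounded by auto
  show ?thesis
  proof (intro exI[of _ "(D + 8 * real n) / norm L1"] allI)
    fix x
    have "norm (L1 * mangoldt_sum \<xi> x) \<le> D + 8 * real n"
    proof (cases "x = 0")
      case True
      then show ?thesis using D[of 0] by (simp add: mangoldt_sum_def)
    next
      case False
      have "(\<Sum>m=1..x. \<xi> m * of_real (ln (real m) / real m))
          = (\<Sum>m=1..x. \<xi> m / of_nat m * of_real (\<Sum>d | d dvd m. mangoldt d))"
        by (intro sum.cong refl) (simp add: mangoldt_sum)
      also have "\<dots> = (\<Sum>d=1..x. \<xi> d / of_nat d * of_real (mangoldt d) * Lsum (x div d))"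
        by (rule sum_dchar_divisors)
      also have "\<dots> = L1 * mangoldt_sum \<xi> x
          + (\<Sum>d=1..x. \<xi> d / of_nat d * of_real (mangoldt d) * (Lsum (x div d) - L1))"
        unfolding mangoldt_sum_def sum_distrib_left sum.distrib[symmetric]
        by (intro sum.cong refl) (simp add: algebra_simps diff_divide_distrib)
      finally have eq: "L1 * mangoldt_sum \<xi> x = (\<Sum>m=1..x. \<xi> m * of_real (ln (real m) / real m))
          - (\<Sum>d=1..x. \<xi> d / of_nat d * of_real (mangoldt d) * (Lsum (x div d) - L1))"
        by simp
      have "norm (\<Sum>d=1..x. \<xi> d / of_nat d * of_real (mangoldt d) * (Lsum (x div d) - L1))
          \<le> (\<Sum>d=1..x. 2 * real n / real x * mangoldt d)"
      proof (rule sum_norm_le)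
        fix d assume d: "d \<in> {1..x}"
        have "norm (\<xi> d / of_nat d * of_real (mangoldt d) * (Lsum (x div d) - L1))
            = norm (\<xi> d) * (mangoldt d / real d) * norm (Lsum (x div d) - L1)"
          by (simp add: norm_mult norm_divide)
        also have "\<dots> \<le> 1 * (mangoldt d / real d) * (2 * real n * (real d / real x))"
          using d by (intro mult_mono norm_L1_diff_div norm_dchars_le[OF n_pos dchar]) (auto simp: mangoldt_nonneg)
        also have "\<dots> = 2 * real n / real x * mangoldt d" using d by simp
        finally show "norm (\<xi> d / of_nat d * of_real (mangoldt d) * (Lsum (x div d) - L1)) \<le> 2 * real n / real x * mangoldt d" .
      qed
      also have "\<dots> = 2 * real n / real x * (\<Sum>d=1..x. mangoldt d)"
        by (simp add: sum_distrib_left)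
      also have "\<dots> \<le> 2 * real n / real x * (4 * real x)"
        by (intro mult_left_mono sum_mangoldt_le) auto
      also have "\<dots> = 8 * real n" using False by simp
      finally show ?thesis
        unfolding eq by (intro order_trans[OF norm_triangle_ineq4] add_mono D)
    qed
    then show "norm (mangoldt_sum \<xi> x) \<le> (D + 8 * real n) / norm L1"
      using assms by (simp add: norm_mult field_simps)
  qed
qed

text \<open>The weight \<open>moebius d * ln (x / d)\<close> has divisor sum
  \<open>mangoldt m\<close>, plus \<open>ln x\<close> at \<open>m = 1\<close>. If \<open>L1\<close>
  vanishes, \<open>Lsum (x div d)\<close> is itself of order \<open>d / x\<close>, and the resulting
  error, a multiple of \<open>(x * ln x - ln (fact x)) / x\<close>, is bounded by the Stirling
  estimate.\<close>

lemma mangoldt_sum_dchar_L1_0: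
  assumes "L1 = 0" "x > 0"
  shows "norm (mangoldt_sum \<xi> x + of_real (ln (real x))) \<le> 2 * real n"
proof -
  have "(\<Sum>d=1..x. \<xi> d / of_nat d * of_real (moebius d * ln (real x / real d)) * Lsum (x div d))
      = (\<Sum>m=1..x. \<xi> m / of_nat m * of_real (\<Sum>d | d dvd m. moebius d * ln (real x / real d)))"
    by (rule sum_dchar_divisors[symmetric])
  also have "\<dots> = (\<Sum>m=1..x. \<xi> m / of_nat m * of_real (ln (real x) * of_bool (m = 1) + mangoldt m))"
  proof (intro sum.cong refl)
    fix m assume m: "m \<in> {1..x}"
    have "(\<Sum>d | d dvd m. moebius d * ln (real x / real d))
        = (\<Sum>d | d dvd m. ln (real x) * moebius d - moebius d * ln (real d))"
      using m assms(2) by (intro sum.cong refl) (auto simp: ln_div algebra_simps dest: dvd_pos_nat)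
    also have "\<dots> = ln (real x) * of_bool (m = 1) + mangoldt m"
      using m by (simp add: sum_subtractf sum_distrib_left[symmetric] sum_moebius_divisors sum_moebius_ln)
    finally show "\<xi> m / of_nat m * of_real (\<Sum>d | d dvd m. moebius d * ln (real x / real d))
        = \<xi> m / of_nat m * of_real (ln (real x) * of_bool (m = 1) + mangoldt m)" by simp
  qed
  also have "\<dots> = (\<Sum>m=1..x. if m = 1 then of_real (ln (real x)) else 0) + mangoldt_sum \<xi> x"
    unfolding mangoldt_sum_def sum.distrib[symmetric]
    by (intro sum.cong refl) (auto simp: dchars_1[OF dchar] algebra_simps)
  also have "(\<Sum>m=1..x. if m = 1 then of_real (ln (real x)) else 0 :: complex) = of_real (ln (real x))"
    using assms(2) by simp
  finally have "norm (mangoldt_sum \<xi> x + of_real (ln (real x)))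
      = norm (\<Sum>d=1..x. \<xi> d / of_nat d * of_real (moebius d * ln (real x / real d)) * Lsum (x div d))"
    by (simp add: add.commute)
  also have "\<dots> \<le> (\<Sum>d=1..x. 2 * real n / real x * (ln (real x) - ln (real d)))"
  proof (rule sum_norm_le)
    fix d assume d: "d \<in> {1..x}"
    then have pos: "0 \<le> ln (real x / real d)" by simp
    have "norm (\<xi> d / of_nat d * of_real (moebius d * ln (real x / real d)) * Lsum (x div d))
        = norm (\<xi> d) * (\<bar>moebius d\<bar> * (ln (real x / real d) / real d)) * norm (Lsum (x div d) - L1)"
      using assms(1) pos by (simp add: norm_mult norm_divide abs_mult)
    also have "\<dots> \<le> 1 * (1 * (ln (real x / real d) / real d)) * (2 * real n * (real d / real x))"
      using d pos assms(2)
      by (intro mult_mono norm_L1_diff_div norm_dchars_le[OF n_pos dchar] abs_moebius_le) auto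
    also have "\<dots> = 2 * real n / real x * (ln (real x) - ln (real d))"
      using d assms(2) by (simp add: ln_div)
    finally show "norm (\<xi> d / of_nat d * of_real (moebius d * ln (real x / real d)) * Lsum (x div d))
        \<le> 2 * real n / real x * (ln (real x) - ln (real d))" .
  qed
  also have "\<dots> = 2 * real n / real x * (real x * ln (real x) - (\<Sum>d=1..x. ln (real d)))"
    unfolding sum_distrib_left[symmetric] sum_subtractf by simp
  also have "(\<Sum>d=1..x. ln (real d)) = ln (fact x)"
    by (induction x) (simp_all add: ln_mult)
  also have "2 * real n / real x * (real x * ln (real x) - ln (fact x)) \<le> 2 * real n / real x * real x"
    using ln_fact_ge[of x] by (intro mult_left_mono) auto
  also have "\<dots> = 2 * real n" using assms(2) by simp
  finally show ?thesis .
qed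

end

section \<open>Real characters\<close>

lemma sum_divisors_mult_coprime:
  fixes f :: "nat \<Rightarrow> 'a :: comm_semiring_1"
  assumes "coprime a b" "a > 0" "b > 0"
    and mult: "\<And>x y. x dvd a \<Longrightarrow> y dvd b \<Longrightarrow> f (x * y) = f x * f y"
  shows "(\<Sum>d | d dvd a * b. f d) = (\<Sum>d | d dvd a. f d) * (\<Sum>d | d dvd b. f d)"
proof -
  have inj: "inj_on (\<lambda>(x, y). x * y) ({d. d dvd a} \<times> {d. d dvd b})"
  proof (rule inj_onI, clarify)
    fix x y x' y' assume *: "x dvd a" "y dvd b" "x' dvd a" "y' dvd b" "x * y = x' * y'"
    have "coprime x y'" "coprime x' y"
      using * assms(1) by (meson coprime_divisors)+
    moreover have "x dvd x' * y'" "x' dvd x * y"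
      using *(5) by (metis dvd_triv_left)+
    ultimately have "x dvd x'" "x' dvd x"
      by (simp_all add: coprime_dvd_mult_left_iff)
    then have "x = x'" by (rule dvd_antisym)
    moreover have "x > 0" using * assms(2) by (metis dvd_pos_nat)
    ultimately show "x = x' \<and> y = y'" using * by simp
  qed
  have "{d. d dvd a * b} = (\<lambda>(x, y). x * y) ` ({d. d dvd a} \<times> {d. d dvd b})"
  proof (intro equalityI subsetI)
    fix d assume "d \<in> {d. d dvd a * b}"
    then have "d dvd a * b" by simp
    then obtain x y where "d = x * y" "x dvd a" "y dvd b" by (rule dvd_productE)
    then show "d \<in> (\<lambda>(x, y). x * y) ` ({d. d dvd a} \<times> {d. d dvd b})" by auto
  qed (auto intro: mult_dvd_mono)
  then have "(\<Sum>d | d dvd a * b. f d) = sum f ((\<lambda>(x, y). x * y) ` ({d. d dvd a} \<times> {d. d dvd b}))"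
    by (rule arg_cong)
  also have "\<dots> = (\<Sum>(x, y)\<in>{d. d dvd a} \<times> {d. d dvd b}. f (x * y))"
    by (subst sum.reindex[OF inj]) (simp add: o_def case_prod_unfold)
  also have "\<dots> = (\<Sum>(x, y)\<in>{d. d dvd a} \<times> {d. d dvd b}. f x * f y)"
    by (intro sum.cong refl) (auto simp: mult)
  also have "\<dots> = (\<Sum>d | d dvd a. f d) * (\<Sum>d | d dvd b. f d)"
    by (simp add: sum_product sum.cartesian_product)
  finally show ?thesis .
qed

lemma sum_divisors_prime_power:
  fixes f :: "nat \<Rightarrow> 'a :: comm_monoid_add"
  assumes "prime p"
  shows "(\<Sum>d | d dvd p ^ k. f d) = (\<Sum>i\<le>k. f (p ^ i))"
proof -
  have "{d. d dvd p ^ k} = (\<lambda>i. p ^ i) ` {..k}"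
    using assms by (auto simp: divides_primepow_nat le_imp_power_dvd)
  moreover have "inj_on (\<lambda>i. p ^ i) {..k}"
    using prime_gt_1_nat[OF assms] by (auto simp: inj_on_def power_inject_exp)
  ultimately show ?thesis by (simp add: sum.reindex)
qed

lemma prime_power_split:
  assumes "m > (1 :: nat)"
  shows "\<exists>p k m'. prime p \<and> k > 0 \<and> m = p ^ k * m' \<and> \<not> p dvd m' \<and> m' > 0 \<and> m' < m"
proof -
  obtain p where p: "prime p" "p dvd m"
    using assms prime_factor_nat[of m] by auto
  define k where "k = multiplicity p m"
  obtain m' where m': "m = p ^ k * m'" "\<not> p dvd m'"
  proof (rule multiplicity_decompose'[of m p])
    show "m \<noteq> 0" "\<not> is_unit p" using assms p(1) by auto
  qed (auto simp: k_def)
  have "k > 0"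
    using p assms by (simp add: k_def prime_multiplicity_gt_zero_iff)
  moreover have "m' > 0" using m' assms by (cases m') auto
  moreover have "1 < p ^ k"
    using \<open>k > 0\<close> prime_gt_1_nat[OF p(1)] by (intro one_less_power) auto
  then have "m' < m" using \<open>m' > 0\<close> by (simp add: m'(1))
  ultimately show ?thesis using p(1) m' by blast
qed

lemma sum_power_sign_nonneg:
  fixes c :: real
  assumes "c \<in> {-1, 0, 1}"
  shows "0 \<le> (\<Sum>i\<le>k. c ^ i)" "even k \<Longrightarrow> 1 \<le> (\<Sum>i\<le>k. c ^ i)"
proof -
  have *: "(\<Sum>i\<le>k. (-1) ^ i) = (of_bool (even k) :: real)"
    by (induction k) auto
  have "(\<Sum>i\<le>k. 0 ^ i) = (1 :: real)"
    by (induction k) auto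
  then show "0 \<le> (\<Sum>i\<le>k. c ^ i)" "even k \<Longrightarrow> 1 \<le> (\<Sum>i\<le>k. c ^ i)"
    using assms * by auto
qed

text \<open>The divisor sum is multiplicative; at \<open>p ^ k\<close> it is a sum of powers of -1,
  0 or 1, hence nonnegative, and at least 1 for even \<open>k\<close>.\<close>

lemma sum_real_dchar_divisors_nonneg:
  fixes f :: "nat \<Rightarrow> real"
  assumes f: "f (Suc 0) = 1" "\<And>a b. f (a * b) = f a * f b" "\<And>a. f a \<in> {-1, 0, 1}" and "m > 0"
  shows "0 \<le> (\<Sum>d | d dvd m. f d) \<and> ((\<exists>s. m = s ^ 2) \<longrightarrow> 1 \<le> (\<Sum>d | d dvd m. f d))"
  using \<open>m > 0\<close>
proof (induction m rule: less_induct)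
  case (less m)
  show ?case
  proof (cases "m = 1")
    case True
    then show ?thesis by (simp add: f(1))
  next
    case False
    then have "m > 1" using less.prems by linarith
    from prime_power_split[OF this]
    obtain p k m' where m: "prime p" "k > 0" "m = p ^ k * m'" "\<not> p dvd m'" "m' > 0" "m' < m"
      by blast
    have pow: "f (p ^ i) = f p ^ i" for i
      by (induction i) (simp_all add: f)
    have "coprime (p ^ k) m'"
      using m prime_imp_coprime[of p m'] by simp
    then have eq: "(\<Sum>d | d dvd m. f d) = (\<Sum>i\<le>k. f p ^ i) * (\<Sum>d | d dvd m'. f d)"
      unfolding m(3) using m
      by (subst sum_divisors_mult_coprime) (auto simp: f sum_divisors_prime_power pow prime_gt_0_nat)
    have IH: "0 \<le> (\<Sum>d | d dvd m'. f d)" "(\<exists>s. m' = s ^ 2) \<longrightarrow> 1 \<le> (\<Sum>d | d dvd m'. f d)"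
      using less.IH[OF m(6,5)] by blast+
    have "even k \<and> (\<exists>s. m' = s ^ 2)" if s: "m = s ^ 2" for s
    proof -
      have s0: "s > 0" using s less.prems by (cases s) auto
      have "multiplicity p m = k"
        using m by (intro multiplicity_eqI) (auto simp: prime_gt_0_nat)
      moreover have "multiplicity p (s ^ 2) = 2 * multiplicity p s"
        using m(1) s0 by (subst prime_elem_multiplicity_power_distrib) auto
      ultimately have k: "k = 2 * multiplicity p s" using s by simp
      obtain t where t: "s = p ^ multiplicity p s * t"
        using multiplicity_dvd[of p s] by blast
      have "p ^ k * m' = (p ^ multiplicity p s) ^ 2 * t ^ 2"
        using s m(3) t by (metis power_mult_distrib)
      also have "(p ^ multiplicity p s) ^ 2 = p ^ k"
        by (simp add: k power_mult[symmetric] mult.commute)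
      finally have "m' = t ^ 2" using m(1) by (simp add: prime_gt_0_nat)
      then show ?thesis using k by auto
    qed
    note square = this
    show ?thesis
      unfolding eq
    proof (intro conjI impI mult_nonneg_nonneg IH(1) sum_power_sign_nonneg(1) f(3))
      assume "\<exists>s. m = s ^ 2"
      then have "even k" "1 \<le> (\<Sum>d | d dvd m'. f d)" using square IH(2) by blast+
      then have "1 * 1 \<le> (\<Sum>i\<le>k. f p ^ i) * (\<Sum>d | d dvd m'. f d)"
        using sum_power_sign_nonneg(2)[OF f(3), of k p] by (intro mult_mono) simp_all
      then show "1 \<le> (\<Sum>i\<le>k. f p ^ i) * (\<Sum>d | d dvd m'. f d)" by simp
    qed
  qed
qed

section \<open>Monotonicity of the Lambert coefficients\<close>

lemma power_add_ge_twice: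
  fixes x :: real
  assumes "0 \<le> x" "x \<le> 1" "a + b + 1 = 2 * d"
  shows "2 * x ^ d \<le> x ^ a + x ^ b"
proof -
  have *: "2 * x ^ d \<le> x ^ a + x ^ b" if "a < b" "a + b + 1 = 2 * d" for a b
  proof -
    define s where "s = d - a"
    have s: "d = a + s" "b = a + (2 * s - 1)" "s \<ge> 1"
      using that by (simp_all add: s_def)
    have "x ^ (2 * s) \<le> x ^ (2 * s - 1)"
      using assms by (intro power_decreasing) auto
    moreover have "x ^ (2 * s) = x ^ s * x ^ s"
      by (simp only: mult_2 power_add)
    \<comment> \<open>This is the arithmetic-geometric mean inequality for exponents with mean
      \<open>d - 1/2\<close>; the square with exponent \<open>s\<close> and one step of monotonicity
      avoid half-integer powers.\<close>
    moreover have "0 \<le> (1 - x ^ s) * (1 - x ^ s)" by simp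
    ultimately have "2 * x ^ s \<le> 1 + x ^ (2 * s - 1)"
      by (simp only: left_diff_distrib right_diff_distrib mult_1_left mult_1_right)
    then have "x ^ a * (2 * x ^ s) \<le> x ^ a * (1 + x ^ (2 * s - 1))"
      using assms by (intro mult_left_mono) auto
    then show ?thesis by (simp add: s power_add algebra_simps)
  qed
  have "a < b \<or> b < a" using assms(3) by presburger
  then show ?thesis
    using *[of a b] *[of b a] assms(3) by (auto simp: add.commute)
qed

text \<open>Expand the product into \<open>d * Suc d\<close> powers and pair \<open>(i, j)\<close>
  with \<open>(d - Suc i, d - j)\<close>: the two exponents add up to
  \<open>2 * d - 1\<close>.\<close>

lemma power_sum_product_ge:
  fixes x :: real
  assumes "0 \<le> x" "x \<le> 1"
  shows "real d * real (Suc d) * x ^ d \<le> (\<Sum>i<d. x ^ i) * (\<Sum>i<Suc d. x ^ i)"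
proof -
  let ?S = "\<Sum>i<d. \<Sum>j<Suc d. x ^ (i + j)"
  have S: "(\<Sum>i<d. x ^ i) * (\<Sum>i<Suc d. x ^ i) = ?S"
    by (simp only: sum_product power_add)
  have "?S = (\<Sum>i<d. \<Sum>j<Suc d. x ^ (i + (d - j)))"
  proof (rule sum.cong[OF refl])
    fix i
    show "(\<Sum>j<Suc d. x ^ (i + j)) = (\<Sum>j<Suc d. x ^ (i + (d - j)))"
      using sum.nat_diff_reindex[of "\<lambda>j. x ^ (i + j)" "Suc d"] by (simp del: sum.lessThan_Suc)
  qed
  also have "\<dots> = (\<Sum>i<d. \<Sum>j<Suc d. x ^ ((d - Suc i) + (d - j)))"
    using sum.nat_diff_reindex[of "\<lambda>i. \<Sum>j<Suc d. x ^ (i + (d - j))" d] by (simp only:)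
  finally have "2 * ?S = (\<Sum>i<d. \<Sum>j<Suc d. x ^ (i + j) + x ^ ((d - Suc i) + (d - j)))"
    by (simp only: sum.distrib mult_2)
  also have "\<dots> \<ge> (\<Sum>i<d. \<Sum>j<Suc d. 2 * x ^ d)"
    by (intro sum_mono power_add_ge_twice assms) auto
  finally show ?thesis
    unfolding S by (simp del: sum.lessThan_Suc of_nat_Suc)
qed

text \<open>Near \<open>x = 1\<close> the Lambert kernel \<open>x ^ d / (1 - x ^ d)\<close> behaves
  like \<open>1 / (d * (1 - x))\<close>; this is the difference. The first part, summed against the
  character, gives a multiple of a partial sum of the L-series, and the difference is monotone in
  \<open>d\<close>, which makes summation by parts possible.\<close>

definition lambert_coeff :: "real \<Rightarrow> nat \<Rightarrow> real" where
  "lambert_coeff x d = 1 / (real d * (1 - x)) - x ^ d / (1 - x ^ d)"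

text \<open>In terms of the geometric sums \<open>s k\<close> the factor \<open>1 - x\<close>
  cancels, and the claim becomes \<open>d * Suc d * x ^ d \<le> s d * s (Suc d)\<close>.\<close>

lemma lambert_coeff_Suc_le:
  assumes "0 < x" "x < 1" "d > 0"
  shows "lambert_coeff x (Suc d) \<le> lambert_coeff x d"
proof -
  define s where "s k = (\<Sum>i<k. x ^ i)" for k
  have geo: "1 - x ^ k = (1 - x) * s k" for k
    by (simp add: s_def one_diff_power_eq)
  have s_pos: "s k > 0" if "k > 0" for k
    unfolding s_def using that assms by (intro sum_pos) auto
  have "real d * real (Suc d) * x ^ d \<le> s d * s (Suc d)"
    unfolding s_def using assms by (intro power_sum_product_ge) auto
  then have "x ^ d / (s d * s (Suc d)) \<le> 1 / (real d * real (Suc d))"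
    using s_pos[of d] s_pos[of "Suc d"] assms by (simp add: divide_simps mult_ac del: of_nat_Suc)
  moreover have coeff: "(1 - x) * lambert_coeff x k = 1 / real k - x ^ k / s k" for k
    using assms by (simp add: lambert_coeff_def geo[of k] right_diff_distrib[of "1 - x"])
  have "(1 - x) * (lambert_coeff x d - lambert_coeff x (Suc d))
      = 1 / real d - 1 / real (Suc d) - (x ^ d / s d - x ^ Suc d / s (Suc d))"
    by (simp only: right_diff_distrib[of "1 - x"] coeff)
  moreover have "1 / real d - 1 / real (Suc d) = 1 / (real d * real (Suc d))"
    using assms by (simp add: field_simps)
  moreover have "x ^ d / s d - x ^ Suc d / s (Suc d) = x ^ d / (s d * s (Suc d))"
  proof -
    have "s (Suc d) = 1 + x * s d"
      unfolding s_def by (subst sum.lessThan_Suc_shift) (simp add: sum_distrib_left)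
    then have "x ^ d * s (Suc d) - x ^ Suc d * s d = x ^ d"
      by (simp add: algebra_simps)
    then show ?thesis
      using s_pos[of d] s_pos[of "Suc d"] assms by (simp add: diff_frac_eq mult.commute)
  qed
  ultimately have "0 \<le> (1 - x) * (lambert_coeff x d - lambert_coeff x (Suc d))" by simp
  then show ?thesis using assms by (simp add: zero_le_mult_iff)
qed

lemma lambert_coeff_tendsto_0:
  assumes "0 < x" "x < 1"
  shows "lambert_coeff x \<longlonglongrightarrow> 0"
proof -
  have 1: "(\<lambda>d. x ^ d) \<longlonglongrightarrow> 0" using assms by (intro LIMSEQ_power_zero) auto
  have "(\<lambda>d. (1 / (1 - x)) * (1 / real d) - x ^ d / (1 - x ^ d)) \<longlonglongrightarrow> (1 / (1 - x)) * 0 - 0 / (1 - 0)"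
    by (intro tendsto_intros 1 lim_1_over_n) auto
  then show ?thesis by (simp add: lambert_coeff_def[abs_def] mult.commute)
qed

lemma lambert_coeff_nonneg:
  assumes "0 < x" "x < 1" "d > 0"
  shows "0 \<le> lambert_coeff x d"
proof (rule ccontr)
  assume "\<not> 0 \<le> lambert_coeff x d"
  moreover have "lambert_coeff x e \<le> lambert_coeff x d" if "d \<le> e" for e
    using that assms
    by (induction e rule: dec_induct) (auto intro: order_trans[OF lambert_coeff_Suc_le])
  then have "0 \<le> lambert_coeff x d"
    by (intro LIMSEQ_le_const2[OF lambert_coeff_tendsto_0[OF assms(1,2)]]) auto
  ultimately show False by simp
qed

context nonprincipal_dchar
begin

text \<open>
  This is Monsky's argument: if \<open>L1\<close> vanishes, the Lambert series
  \<open>\<Sum>d. \<xi> d * x ^ d / (1 - x ^ d)\<close> stays bounded as \<open>x \<rightarrow> 1\<close> by summation by parts, whereas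
  its power series coefficients are nonnegative and at least \<open>1\<close> at the squares.
\<close>

lemma L1_real_neq_0:
  assumes real: "\<And>a. \<xi> a \<in> {-1, 0, 1}"
  shows "L1 \<noteq> 0"
proof
  assume L0: "L1 = 0"
  define f where "f a = Re (\<xi> a)" for a
  have \<xi>: "\<xi> a = of_real (f a)" for a using real[of a] by (auto simp: f_def)
  have f: "f (Suc 0) = 1" "\<And>a b. f (a * b) = f a * f b" "\<And>a. f a \<in> {-1, 0, 1}"
  proof -
    show "f (Suc 0) = 1" by (simp add: f_def dchars_1[OF dchar])
    show "f a \<in> {-1, 0, 1}" for a using real[of a] by (auto simp: f_def)
    have "of_real (f (a * b)) = (of_real (f a * f b) :: complex)" for a b
      by (simp add: \<xi>[symmetric] dchars_mult[OF dchar])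
    then show "f (a * b) = f a * f b" for a b by (simp only: of_real_eq_iff)
  qed
  define r where "r m = (\<Sum>d | d dvd m. f d)" for m
  have r: "0 \<le> r m" "(\<exists>s. m = s ^ 2) \<Longrightarrow> 1 \<le> r m" if "m > 0" for m
    using sum_real_dchar_divisors_nonneg[of f m] f that unfolding r_def by blast+
  define A where "A N = (\<Sum>d=1..N. f d / real d)" for N
  have LA: "Lsum N = of_real (A N)" for N
    by (simp add: Lsum_def A_def \<xi>)
  have "(\<lambda>N. of_real (A N) :: complex) \<longlonglongrightarrow> of_real 0"
    using Lsum_tendsto unfolding L0 LA[abs_def] by simp
  then have A: "A \<longlonglongrightarrow> 0"
    by (simp only: tendsto_of_real_iff)
  \<comment> \<open>The series is cut off at \<open>N\<close>. The last summand bounds the missing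
    tails of the geometric series; like \<open>A N\<close>, it vanishes as \<open>N\<close>
    grows.\<close>
  have bound: "(\<Sum>m=1..N. r m * x ^ m) \<le> \<bar>A N\<bar> / (1 - x) + 2 * real n + real N * x ^ N / (1 - x)"
    if x: "0 < x" "x < 1" for x N
  proof -
    have pos: "0 < 1 - x ^ d" if "d > 0" for d
      using x that by (simp add: power_less_one_iff)
    have inner: "(\<Sum>e=1..k. x ^ (d * e)) = x ^ d / (1 - x ^ d) - x ^ (d * Suc k) / (1 - x ^ d)"
      if "d > 0" for d k
    proof (induction k)
      case (Suc k)
      have "x ^ (d * Suc (Suc k)) = x ^ (d * Suc k) * x ^ d"
        by (simp add: power_add[symmetric] add_ac)
      then have "x ^ (d * Suc k) / (1 - x ^ d) - x ^ (d * Suc (Suc k)) / (1 - x ^ d)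
          = x ^ (d * Suc k) * (1 - x ^ d) / (1 - x ^ d)"
        by (simp only: diff_divide_distrib[symmetric]) (simp only: right_diff_distrib mult_1_right)
      also have "\<dots> = x ^ (d * Suc k)" using pos[OF that] by simp
      finally show ?case using Suc.IH by simp
    qed simp
    have "(\<Sum>m=1..N. r m * x ^ m) = (\<Sum>m=1..N. \<Sum>d | d dvd m. f d * x ^ (d * (m div d)))"
      by (intro sum.cong refl) (auto simp: r_def sum_distrib_right)
    also have "\<dots> = (\<Sum>d=1..N. \<Sum>e=1..N div d. f d * x ^ (d * e))"
      by (rule sum_divisors_swap)
    also have "\<dots> = (\<Sum>d=1..N. f d * (x ^ d / (1 - x ^ d) - x ^ (d * Suc (N div d)) / (1 - x ^ d)))"
    proof (rule sum.cong[OF refl])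
      fix d assume "d \<in> {1..N}"
      then have "d > 0" by simp
      show "(\<Sum>e=1..N div d. f d * x ^ (d * e)) = f d * (x ^ d / (1 - x ^ d) - x ^ (d * Suc (N div d)) / (1 - x ^ d))"
        by (simp only: sum_distrib_left[symmetric] inner[OF \<open>d > 0\<close>])
    qed
    also have "\<dots> = A N / (1 - x) - (\<Sum>d=1..N. lambert_coeff x d * f d)
        - (\<Sum>d=1..N. f d * x ^ (d * Suc (N div d)) / (1 - x ^ d))"
      unfolding A_def sum_divide_distrib sum_subtractf[symmetric] lambert_coeff_def
      by (intro sum.cong refl) (simp add: algebra_simps)
    also have "\<dots> \<le> \<bar>A N\<bar> / (1 - x) + 2 * real n + real N * x ^ N / (1 - x)"
    proof -
      have "A N / (1 - x) \<le> \<bar>A N\<bar> / (1 - x)"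
        using x by (intro divide_right_mono) auto
      moreover have "\<bar>\<Sum>d=1..N. lambert_coeff x d * f d\<bar> \<le> 2 * real n"
      proof -
        \<comment> \<open>Summation by parts leaves \<open>2 * n\<close> times the first
          coefficient, which is 1 for every \<open>x\<close>; this makes the bound uniform as
          \<open>x\<close> approaches 1.\<close>
        have "norm (\<Sum>d\<in>{0<..N}. of_real (lambert_coeff x d) * \<xi> d) \<le> 2 * real n * lambert_coeff x (Suc 0)"
          using x by (intro norm_sum_Abel_le norm_sum_dchar_le[OF n_pos dchar nonprincipal]
              lambert_coeff_Suc_le lambert_coeff_nonneg) auto
        also have "lambert_coeff x (Suc 0) = 1"
          using x by (simp add: lambert_coeff_def field_simps)
        also have "(\<Sum>d\<in>{0<..N}. of_real (lambert_coeff x d) * \<xi> d) = of_real (\<Sum>d=1..N. lambert_coeff x d * f d)"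
          unfolding of_real_sum by (rule sum.cong) (auto simp: \<xi>)
        finally show ?thesis by (simp only: norm_of_real)
      qed
      moreover have "\<bar>\<Sum>d=1..N. f d * x ^ (d * Suc (N div d)) / (1 - x ^ d)\<bar> \<le> (\<Sum>d=1..N. x ^ N / (1 - x))"
      proof (rule order_trans[OF sum_abs], rule sum_mono)
        fix d assume d: "d \<in> {1..N}"
        have "N < d * Suc (N div d)"
          using dividend_less_times_div[of d N] d by simp
        then have "x ^ (d * Suc (N div d)) \<le> x ^ N"
          using x by (intro power_decreasing) auto
        moreover have "x ^ d \<le> x ^ 1" using x d by (intro power_decreasing) auto
        moreover have "\<bar>f d\<bar> \<le> 1" using f(3)[of d] by auto
        ultimately have "\<bar>f d\<bar> * x ^ (d * Suc (N div d)) / (1 - x ^ d) \<le> 1 * x ^ N / (1 - x)"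
          using x d by (intro frac_le mult_mono) auto
        then show "\<bar>f d * x ^ (d * Suc (N div d)) / (1 - x ^ d)\<bar> \<le> x ^ N / (1 - x)"
          using x pos[of d] d by (simp add: abs_mult)
      qed
      ultimately show ?thesis by simp
    qed
    finally show ?thesis .
  qed
  have squares: "(\<Sum>k=1..K. x ^ (k ^ 2)) \<le> 2 * real n" if x: "0 < x" "x < 1" for x K
  proof (rule LIMSEQ_le_const)
    have "(\<lambda>N. real N * x ^ N) \<longlonglongrightarrow> 0"
      using x by (intro powser_times_n_limit_0) auto
    then have "(\<lambda>N. \<bar>A N\<bar> / (1 - x) + 2 * real n + real N * x ^ N / (1 - x)) \<longlonglongrightarrow> \<bar>0\<bar> / (1 - x) + 2 * real n + 0 / (1 - x)"
      using x by (intro tendsto_intros A) auto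
    then show "(\<lambda>N. \<bar>A N\<bar> / (1 - x) + 2 * real n + real N * x ^ N / (1 - x)) \<longlonglongrightarrow> 2 * real n"
      by simp
    show "\<exists>N0. \<forall>N\<ge>N0. (\<Sum>k=1..K. x ^ (k ^ 2)) \<le> \<bar>A N\<bar> / (1 - x) + 2 * real n + real N * x ^ N / (1 - x)"
    proof (intro exI allI impI)
      fix N assume N: "K ^ 2 \<le> N"
      have "inj_on (\<lambda>k::nat. k ^ 2) {1..K}" by (auto simp: inj_on_def power_eq_iff_eq_base)
      then have "(\<Sum>k=1..K. x ^ (k ^ 2)) = (\<Sum>m\<in>(\<lambda>k. k ^ 2) ` {1..K}. x ^ m)"
        by (simp add: sum.reindex)
      also have "\<dots> \<le> (\<Sum>m\<in>(\<lambda>k. k ^ 2) ` {1..K}. r m * x ^ m)"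
      proof (rule sum_mono)
        fix m assume "m \<in> (\<lambda>k. k ^ 2) ` {1..K}"
        then obtain k where k: "m = k ^ 2" "1 \<le> k" by auto
        then have "0 < m" by simp
        then have "1 \<le> r m" using k(1) by (intro r(2) exI[of _ k])
        then show "x ^ m \<le> r m * x ^ m" using x mult_right_mono[of 1 "r m" "x ^ m"] by simp
      qed
      also have "\<dots> \<le> (\<Sum>m=1..N. r m * x ^ m)"
      proof (rule sum_mono2)
        show "(\<lambda>k. k ^ 2) ` {1..K} \<subseteq> {1..N}"
        proof clarify
          fix k assume k: "k \<in> {1..K}"
          then have "k ^ 2 \<le> K ^ 2" by (intro power_mono) auto
          then have "k ^ 2 \<le> N" using N by (rule order_trans)
          then show "k ^ 2 \<in> {1..N}" using k by simp
        qed
      qed (use r(1) x in auto)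
      finally show "(\<Sum>k=1..K. x ^ (k ^ 2)) \<le> \<bar>A N\<bar> / (1 - x) + 2 * real n + real N * x ^ N / (1 - x)"
        using bound[OF x, of N] by linarith
    qed
  qed
  \<comment> \<open>As \<open>x\<close> tends to 1 every square contributes 1, so
    \<open>2 * n + 1\<close> squares exceed the bound \<open>2 * n\<close>.\<close>
  define K where "K = Suc (2 * n)"
  have "((\<lambda>x::real. \<Sum>k=1..K. x ^ (k ^ 2)) \<longlongrightarrow> (\<Sum>k=1..K. 1 ^ (k ^ 2))) (at_left 1)"
    by (intro tendsto_intros)
  moreover have "eventually (\<lambda>x::real. (\<Sum>k=1..K. x ^ (k ^ 2)) \<le> 2 * real n) (at_left 1)"
    using eventually_at_left_real[of 0 1] by (rule eventually_mono) (use squares in auto)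
  ultimately have "(\<Sum>k=1..K. 1 ^ (k ^ 2)) \<le> 2 * real n"
    by (intro tendsto_upperbound) auto
  then show False by (simp add: K_def)
qed

end

section \<open>Dirichlet's theorem on primes in residue classes\<close>

lemma (in nonprincipal_dchar) nonprincipal_dchar_cnj: "nonprincipal_dchar n (\<lambda>a. cnj (\<xi> a))"
proof
  show "(\<lambda>a. cnj (\<xi> a)) \<in> dchars n" by (rule dchars_cnj[OF dchar])
  show "(\<lambda>a. cnj (\<xi> a)) \<noteq> principal_dchar n"
  proof
    assume *: "(\<lambda>a. cnj (\<xi> a)) = principal_dchar n"
    have "\<xi> a = principal_dchar n a" for a
      using arg_cong[OF fun_cong[OF *, of a], of cnj] by (simp add: principal_dchar_def of_bool_def)
    then show False using nonprincipal by blast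
  qed
qed (rule n_pos)

lemma (in nonprincipal_dchar) L1_cnj: "nonprincipal_dchar.L1 (\<lambda>a. cnj (\<xi> a)) = cnj L1"
proof -
  interpret c: nonprincipal_dchar n "\<lambda>a. cnj (\<xi> a)" by (rule nonprincipal_dchar_cnj)
  have eq: "c.Lsum = (\<lambda>N. cnj (Lsum N))"
    by (rule ext) (simp add: c.Lsum_def Lsum_def)
  have "(\<lambda>N. cnj (Lsum N)) \<longlonglongrightarrow> c.L1"
    using c.Lsum_tendsto unfolding eq .
  moreover have "(\<lambda>N. cnj (Lsum N)) \<longlonglongrightarrow> cnj L1"
    by (intro tendsto_intros Lsum_tendsto)
  ultimately show ?thesis by (rule LIMSEQ_unique)
qed

text \<open>Both cases in one form, so that they can be summed over all characters: a vanishing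
  \<open>L1\<close> contributes \<open>- ln x\<close>, any other only a bounded amount.\<close>

lemma (in nonprincipal_dchar) mangoldt_sum_dchar_alternative:
  "\<exists>C. \<forall>x>0. norm (mangoldt_sum \<xi> x + of_real (of_bool (L1 = 0) * ln (real x))) \<le> C"
proof (cases "L1 = 0")
  case True
  then show ?thesis using mangoldt_sum_dchar_L1_0 by (intro exI[of _ "2 * real n"]) simp
next
  case False
  then show ?thesis using mangoldt_sum_dchar_bounded[OF False] by auto
qed

definition mangoldt_nonprime :: "nat \<Rightarrow> real" where
  "mangoldt_nonprime x = (\<Sum>m | m \<in> {1..x} \<and> \<not> prime m. mangoldt m / real m)"

lemma mangoldt_sum_principal:
  "mangoldt_sum (principal_dchar n) x = of_real (\<Sum>m | m \<in> {1..x} \<and> coprime m n. mangoldt m / real m)"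
proof -
  have "mangoldt_sum (principal_dchar n) x = (\<Sum>m=1..x. if coprime m n then of_real (mangoldt m / real m) else 0)"
    unfolding mangoldt_sum_def by (intro sum.cong refl) (simp add: principal_dchar_def)
  also have "\<dots> = (\<Sum>m | m \<in> {1..x} \<and> coprime m n. of_real (mangoldt m / real m))"
    by (rule sum.inter_filter[symmetric]) simp
  finally show ?thesis by simp
qed

lemma Re_mangoldt_sum_principal_le:
  assumes "x > 0"
  shows "Re (mangoldt_sum (principal_dchar n) x) \<le> ln (real x) + 4"
proof -
  have "(\<Sum>m | m \<in> {1..x} \<and> coprime m n. mangoldt m / real m) \<le> (\<Sum>m=1..x. mangoldt m / real m)"
    by (rule sum_mono2) (auto simp: mangoldt_nonneg)
  then show ?thesis
    using sum_mangoldt_div_le[OF assms] by (simp add: mangoldt_sum_principal)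
qed

text \<open>The terms lost by the coprimality condition belong to nonprimes or to the primes
  dividing \<open>n\<close>.\<close>

lemma Re_mangoldt_sum_principal_ge:
  assumes "n > 0" "x > 0"
  shows "ln (real x) - 1 - (\<Sum>p\<in>prime_factors n. ln (real p)) - mangoldt_nonprime x
    \<le> Re (mangoldt_sum (principal_dchar n) x)"
proof -
  let ?g = "\<lambda>m. mangoldt m / real m :: real"
  have "(\<Sum>m=1..x. ?g m) = (\<Sum>m\<in>{m \<in> {1..x}. coprime m n} \<union> {m \<in> {1..x}. \<not> coprime m n}. ?g m)"
    by (rule sum.cong) auto
  also have "\<dots> = (\<Sum>m | m \<in> {1..x} \<and> coprime m n. ?g m) + (\<Sum>m | m \<in> {1..x} \<and> \<not> coprime m n. ?g m)"
    by (rule sum.union_disjoint) auto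
  finally have 1: "(\<Sum>m=1..x. ?g m)
      = (\<Sum>m | m \<in> {1..x} \<and> coprime m n. ?g m) + (\<Sum>m | m \<in> {1..x} \<and> \<not> coprime m n. ?g m)" .
  have "(\<Sum>m | m \<in> {1..x} \<and> \<not> coprime m n. ?g m)
      \<le> (\<Sum>m \<in> {m. m \<in> {1..x} \<and> \<not> prime m} \<union> prime_factors n. ?g m)"
  proof (rule sum_mono2)
    show "{m. m \<in> {1..x} \<and> \<not> coprime m n} \<subseteq> {m. m \<in> {1..x} \<and> \<not> prime m} \<union> prime_factors n"
    proof
      fix m assume m: "m \<in> {m. m \<in> {1..x} \<and> \<not> coprime m n}"
      show "m \<in> {m. m \<in> {1..x} \<and> \<not> prime m} \<union> prime_factors n"
      proof (cases "prime m")
        case True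
        then have "m dvd n" using m prime_imp_coprime[of m n] by auto
        then show ?thesis using True assms(1) by (simp add: prime_factors_dvd)
      qed (use m in simp)
    qed
  qed (auto simp: mangoldt_nonneg)
  also have "\<dots> \<le> mangoldt_nonprime x + (\<Sum>p\<in>prime_factors n. ?g p)"
    unfolding mangoldt_nonprime_def
    by (subst sum.union_inter[symmetric]) (auto intro!: sum_nonneg simp: mangoldt_nonneg)
  also have "(\<Sum>p\<in>prime_factors n. ?g p) \<le> (\<Sum>p\<in>prime_factors n. ln (real p))"
  proof (rule sum_mono)
    fix p assume "p \<in> prime_factors n"
    then have p: "prime p" by auto
    then have "real p \<ge> 1" "ln (real p) \<ge> 0" using prime_gt_0_nat[OF p] by simp_all
    then have "ln (real p) / real p \<le> ln (real p) / 1" by (intro divide_left_mono) auto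
    then show "?g p \<le> ln (real p)" using p by simp
  qed
  finally have "(\<Sum>m | m \<in> {1..x} \<and> \<not> coprime m n. ?g m)
      \<le> mangoldt_nonprime x + (\<Sum>p\<in>prime_factors n. ln (real p))" by simp
  then show ?thesis
    using sum_mangoldt_div_ge[OF assms(2)] 1 by (simp add: mangoldt_sum_principal)
qed

text \<open>Orthogonality, with \<open>b\<close> in the role of the inverse of a residue class: the
  condition \<open>[b * m = 1] (mod n)\<close> picks out that class without conjugate
  characters.\<close>

lemma sum_dchars_mangoldt_sum:
  assumes n: "n > 0" and b: "coprime b n"
  shows "(\<Sum>\<xi>\<in>dchars n. \<xi> b * mangoldt_sum \<xi> x)
    = of_real (real (card (dchars n)) * (\<Sum>m | m \<in> {1..x} \<and> [b * m = 1] (mod n). mangoldt m / real m))"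
proof -
  have "(\<Sum>\<xi>\<in>dchars n. \<xi> b * mangoldt_sum \<xi> x)
      = (\<Sum>\<xi>\<in>dchars n. \<Sum>m=1..x. \<xi> (b * m) * of_real (mangoldt m / real m))"
    by (intro sum.cong refl) (simp add: mangoldt_sum_def sum_distrib_left dchars_mult mult.assoc)
  also have "\<dots> = (\<Sum>m=1..x. (\<Sum>\<xi>\<in>dchars n. \<xi> (b * m)) * of_real (mangoldt m / real m))"
    by (subst sum.swap) (simp only: sum_distrib_right)
  also have "\<dots> = (\<Sum>m=1..x. if [b * m = 1] (mod n) then of_real (real (card (dchars n)) * (mangoldt m / real m)) else 0)"
  proof (intro sum.cong refl)
    fix m
    show "(\<Sum>\<xi>\<in>dchars n. \<xi> (b * m)) * of_real (mangoldt m / real m)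
        = (if [b * m = 1] (mod n) then of_real (real (card (dchars n)) * (mangoldt m / real m)) else 0)"
    proof (cases "coprime m n")
      case True
      then have "coprime (b * m) n" using b by simp
      then show ?thesis by (simp add: sum_dchars[OF n])
    next
      case False
      then have nc: "\<not> coprime (b * m) n" by simp
      then have "\<not> [b * m = 1] (mod n)"
        using cong_imp_coprime[of 1 "b * m" n] by (auto simp: cong_sym_eq)
      moreover have "(\<Sum>\<xi>\<in>dchars n. \<xi> (b * m)) = 0"
        using nc by (intro sum.neutral ballI dchars_not_coprime)
      ultimately show ?thesis by simp
    qed
  qed
  also have "\<dots> = (\<Sum>m | m \<in> {1..x} \<and> [b * m = 1] (mod n). of_real (real (card (dchars n)) * (mangoldt m / real m)))"
    by (rule sum.inter_filter[symmetric]) simp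
  also have "\<dots> = of_real (real (card (dchars n)) * (\<Sum>m | m \<in> {1..x} \<and> [b * m = 1] (mod n). mangoldt m / real m))"
    by (simp add: sum_distrib_left)
  finally show ?thesis .
qed

lemma exists_real_gt_ln: "\<exists>x::nat. x > 0 \<and> K < ln (real x)"
proof -
  obtain x :: nat where "exp (K + 1) < real x" using reals_Archimedean2 by blast
  moreover from this have "real x > 0" using exp_gt_zero[of "K + 1"] by linarith
  ultimately have "K + 1 < ln (real x)" by (metis exp_less_cancel_iff exp_ln)
  then show ?thesis using \<open>real x > 0\<close> by (intro exI[of _ x]) auto
qed

text \<open>For \<open>n > 0\<close> the sums defining \<open>L1\<close> diverge at the principal
  character, hence the first conjunct.\<close>

definition dchar_vanishes :: "nat \<Rightarrow> (nat \<Rightarrow> complex) \<Rightarrow> bool" where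
  "dchar_vanishes n \<xi> \<longleftrightarrow> \<xi> \<noteq> principal_dchar n \<and> nonprincipal_dchar.L1 \<xi> = 0"

lemma dchars_uniform_bound:
  assumes n: "n > 0"
  shows "\<exists>C. \<forall>\<xi>\<in>dchars n - {principal_dchar n}. \<forall>x>0.
    norm (mangoldt_sum \<xi> x + of_real (of_bool (dchar_vanishes n \<xi>) * ln (real x))) \<le> C"
proof -
  let ?D = "dchars n - {principal_dchar n}"
  have "\<forall>\<xi>\<in>?D. \<exists>C. \<forall>x>0. norm (mangoldt_sum \<xi> x + of_real (of_bool (dchar_vanishes n \<xi>) * ln (real x))) \<le> C"
  proof
    fix \<xi> assume \<xi>: "\<xi> \<in> ?D"
    then interpret nonprincipal_dchar n \<xi> using n by unfold_locales auto
    show "\<exists>C. \<forall>x>0. norm (mangoldt_sum \<xi> x + of_real (of_bool (dchar_vanishes n \<xi>) * ln (real x))) \<le> C"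
      using mangoldt_sum_dchar_alternative nonprincipal
      by (simp add: dchar_vanishes_def)
  qed
  from bchoice[OF this]
  obtain C where C: "\<forall>\<xi>\<in>?D. \<forall>x>0. norm (mangoldt_sum \<xi> x + of_real (of_bool (dchar_vanishes n \<xi>) * ln (real x))) \<le> C \<xi>"
    by (elim exE)
  show ?thesis
  proof (intro exI[of _ "\<Sum>\<psi>\<in>?D. \<bar>C \<psi>\<bar>"] ballI allI impI)
    fix \<xi> and x :: nat assume \<xi>: "\<xi> \<in> ?D" and x: "x > 0"
    have "norm (mangoldt_sum \<xi> x + of_real (of_bool (dchar_vanishes n \<xi>) * ln (real x))) \<le> C \<xi>"
      using bspec[OF C \<xi>] x by blast
    also have "\<dots> \<le> \<bar>C \<xi>\<bar>" by simp
    also have "\<dots> \<le> (\<Sum>\<psi>\<in>?D. \<bar>C \<psi>\<bar>)"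
      using finite_dchars[OF n] by (intro member_le_sum \<xi>) auto
    finally show "norm (mangoldt_sum \<xi> x + of_real (of_bool (dchar_vanishes n \<xi>) * ln (real x)))
        \<le> (\<Sum>\<psi>\<in>?D. \<bar>C \<psi>\<bar>)" .
  qed
qed

lemma sum_dchars_split:
  assumes n: "n > 0" and b: "coprime b n" and "x > 0"
    and C: "\<forall>\<xi>\<in>dchars n - {principal_dchar n}. \<forall>x>0.
      norm (mangoldt_sum \<xi> x + of_real (of_bool (dchar_vanishes n \<xi>) * ln (real x))) \<le> C"
  shows "\<bar>real (card (dchars n)) * (\<Sum>m | m \<in> {1..x} \<and> [b * m = 1] (mod n). mangoldt m / real m)
      - Re (mangoldt_sum (principal_dchar n) x)
      + ln (real x) * (\<Sum>\<xi>\<in>dchars n. Re (\<xi> b) * of_bool (dchar_vanishes n \<xi>))\<bar> \<le> real (card (dchars n)) * \<bar>C\<bar>"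
proof -
  let ?D = "dchars n - {principal_dchar n}"
  let ?V = "\<lambda>\<xi>. of_real (of_bool (dchar_vanishes n \<xi>) * ln (real x)) :: complex"
  have fin: "finite (dchars n)" by (rule finite_dchars[OF n])
  have pin: "principal_dchar n \<in> dchars n" by (rule principal_dchar_in_dchars[OF n])
  have "principal_dchar n b = 1" using b by (simp add: principal_dchar_def)
  then have "(\<Sum>\<xi>\<in>dchars n. \<xi> b * mangoldt_sum \<xi> x)
      = mangoldt_sum (principal_dchar n) x + (\<Sum>\<xi>\<in>?D. \<xi> b * mangoldt_sum \<xi> x)"
    using fin pin by (simp add: sum.remove)
  moreover have "(\<Sum>\<xi>\<in>dchars n. \<xi> b * ?V \<xi>) = (\<Sum>\<xi>\<in>?D. \<xi> b * ?V \<xi>)"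
    using fin by (intro sum.mono_neutral_right) (auto simp: dchar_vanishes_def)
  ultimately have "(\<Sum>\<xi>\<in>dchars n. \<xi> b * mangoldt_sum \<xi> x) - mangoldt_sum (principal_dchar n) x + (\<Sum>\<xi>\<in>dchars n. \<xi> b * ?V \<xi>)
      = (\<Sum>\<xi>\<in>?D. \<xi> b * (mangoldt_sum \<xi> x + ?V \<xi>))"
    by (simp only: distrib_left sum.distrib) simp
  also have "norm \<dots> \<le> (\<Sum>\<xi>\<in>?D. \<bar>C\<bar>)"
  proof (rule sum_norm_le)
    fix \<xi> assume \<xi>: "\<xi> \<in> ?D"
    have "norm (\<xi> b) * norm (mangoldt_sum \<xi> x + ?V \<xi>) \<le> 1 * C"
      using \<xi> C \<open>x > 0\<close> by (intro mult_mono norm_dchars_le[OF n]) auto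
    then show "norm (\<xi> b * (mangoldt_sum \<xi> x + ?V \<xi>)) \<le> \<bar>C\<bar>"
      unfolding norm_mult by linarith
  qed
  also have "\<dots> \<le> real (card (dchars n)) * \<bar>C\<bar>"
    using fin by (simp add: card_mono mult_right_mono)
  finally have *: "norm ((\<Sum>\<xi>\<in>dchars n. \<xi> b * mangoldt_sum \<xi> x) - mangoldt_sum (principal_dchar n) x
      + (\<Sum>\<xi>\<in>dchars n. \<xi> b * ?V \<xi>)) \<le> real (card (dchars n)) * \<bar>C\<bar>" .
  have "Re (\<Sum>\<xi>\<in>dchars n. \<xi> b * ?V \<xi>) = ln (real x) * (\<Sum>\<xi>\<in>dchars n. Re (\<xi> b) * of_bool (dchar_vanishes n \<xi>))"
    unfolding Re_sum sum_distrib_left by (intro sum.cong refl) simp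
  then have "Re ((\<Sum>\<xi>\<in>dchars n. \<xi> b * mangoldt_sum \<xi> x) - mangoldt_sum (principal_dchar n) x
      + (\<Sum>\<xi>\<in>dchars n. \<xi> b * ?V \<xi>))
    = real (card (dchars n)) * (\<Sum>m | m \<in> {1..x} \<and> [b * m = 1] (mod n). mangoldt m / real m)
      - Re (mangoldt_sum (principal_dchar n) x)
      + ln (real x) * (\<Sum>\<xi>\<in>dchars n. Re (\<xi> b) * of_bool (dchar_vanishes n \<xi>))"
    unfolding sum_dchars_mangoldt_sum[OF n b] by simp
  then show ?thesis using order_trans[OF abs_Re_le_cmod *] by simp
qed

text \<open>
  By positivity of the sum over \<open>m \<equiv> 1\<close> at most one \<open>L\<close>-value vanishes. Since the \<open>L\<close>-value of
  the conjugate character vanishes as well, that character would be real.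
\<close>

lemma not_dchar_vanishes:
  assumes n: "n > 0" and \<xi>: "\<xi> \<in> dchars n"
  shows "\<not> dchar_vanishes n \<xi>"
proof
  assume v: "dchar_vanishes n \<xi>"
  then interpret nonprincipal_dchar n \<xi>
    using n \<xi> by unfold_locales (auto simp: dchar_vanishes_def)
  let ?cnj = "\<lambda>a. cnj (\<xi> a)"
  let ?V = "{\<psi> \<in> dchars n. dchar_vanishes n \<psi>}"
  have fin: "finite (dchars n)" by (rule finite_dchars[OF n])
  have L0: "L1 = 0" using v by (simp add: dchar_vanishes_def)
  interpret c: nonprincipal_dchar n ?cnj by (rule nonprincipal_dchar_cnj)
  have vc: "dchar_vanishes n ?cnj"
    using c.nonprincipal L1_cnj L0 by (simp add: dchar_vanishes_def)
  have "?cnj \<noteq> \<xi>"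
  proof
    assume real: "?cnj = \<xi>"
    have "\<xi> a \<in> {-1, 0, 1}" for a
    proof (cases "coprime a n")
      case True
      have "\<xi> a \<in> \<real>" using fun_cong[OF real, of a] by (simp add: Reals_cnj_iff)
      then obtain t where t: "\<xi> a = of_real t" by (auto elim: Reals_cases)
      then have "\<bar>t\<bar> = 1" using norm_dchars_coprime[OF n \<xi> True] by simp
      then have "t = 1 \<or> t = -1" by linarith
      then show ?thesis by (auto simp: t)
    next
      case False
      then show ?thesis by (simp add: dchars_not_coprime[OF \<xi>])
    qed
    then show False using L1_real_neq_0 L0 by blast
  qed
  then have "2 \<le> card {\<xi>, ?cnj}" by simp
  also have "\<dots> \<le> card ?V"
    using v vc \<xi> c.dchar fin by (intro card_mono) auto
  finally have card: "2 \<le> real (card ?V)" by simp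
  obtain C where C: "\<forall>\<xi>\<in>dchars n - {principal_dchar n}. \<forall>x>0.
      norm (mangoldt_sum \<xi> x + of_real (of_bool (dchar_vanishes n \<xi>) * ln (real x))) \<le> C"
    using dchars_uniform_bound[OF n] by (elim exE)
  \<comment> \<open>With two vanishing values the expression estimated below is at least
    \<open>2 * ln x - (ln x + 4)\<close>, the 4 being that of the Mertens bound; for this
    \<open>x\<close> it exceeds the error term.\<close>
  obtain x :: nat where x: "x > 0" "4 + real (card (dchars n)) * \<bar>C\<bar> < ln (real x)"
    using exists_real_gt_ln by blast
  let ?T = "\<Sum>m | m \<in> {1..x} \<and> [1 * m = 1] (mod n). mangoldt m / real m :: real"
  have "(\<Sum>\<xi>\<in>dchars n. Re (\<xi> 1) * of_bool (dchar_vanishes n \<xi>)) = (\<Sum>\<xi>\<in>dchars n. if dchar_vanishes n \<xi> then 1 else 0)"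
    by (intro sum.cong refl) (simp add: dchars_1)
  also have "\<dots> = real (card ?V)"
    using fin by (simp add: sum.If_cases Int_def)
  finally have sum: "(\<Sum>\<xi>\<in>dchars n. Re (\<xi> 1) * of_bool (dchar_vanishes n \<xi>)) = real (card ?V)" .
  have "\<bar>real (card (dchars n)) * ?T - Re (mangoldt_sum (principal_dchar n) x) + ln (real x) * real (card ?V)\<bar>
      \<le> real (card (dchars n)) * \<bar>C\<bar>"
    using sum_dchars_split[OF n _ x(1) C, of 1] unfolding sum by simp
  moreover have "0 \<le> real (card (dchars n)) * ?T"
    by (intro mult_nonneg_nonneg sum_nonneg) (auto simp: mangoldt_nonneg)
  moreover have "ln (real x) * 2 \<le> ln (real x) * real (card ?V)"
    using card x by (intro mult_left_mono) auto
  ultimately show False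
    using Re_mangoldt_sum_principal_le[OF x(1), of n] x(2) by linarith
qed

text \<open>If the class contained no prime, its \<open>mangoldt\<close> sum would come from
  nonprimes and stay bounded, while the principal character contributes \<open>ln x\<close> and no
  other character cancels it. One prime is enough, since membership in the closure is tested one
  residue class at a time.\<close>

theorem prime_in_residue_class:
  fixes a n :: nat
  assumes n: "n > 0" and a: "coprime a n"
  shows "\<exists>p. prime p \<and> [p = a] (mod n)"
proof (rule ccontr)
  assume no: "\<nexists>p. prime p \<and> [p = a] (mod n)"
  obtain b where b: "[a * b = 1] (mod n)" using cong_solve_coprime_nat[OF a] by auto
  have ba: "[b * a = 1] (mod n)" using b by (simp only: mult.commute)
  have cb: "coprime b n"
    using cong_imp_coprime[OF cong_sym[OF ba]] by simp
  have iff: "[m = a] (mod n)" if "[b * m = 1] (mod n)" for m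
  proof -
    have "[b * m = b * a] (mod n)" using that ba by (metis cong_sym cong_trans)
    then show ?thesis using cb by (simp add: cong_mult_lcancel_nat)
  qed
  obtain C where C: "\<forall>\<xi>\<in>dchars n - {principal_dchar n}. \<forall>x>0.
      norm (mangoldt_sum \<xi> x + of_real (of_bool (dchar_vanishes n \<xi>) * ln (real x))) \<le> C"
    using dchars_uniform_bound[OF n] by (elim exE)
  obtain Q where Q: "\<forall>x. mangoldt_nonprime x \<le> Q"
    using sum_mangoldt_nonprime_bounded unfolding mangoldt_nonprime_def by (elim exE)
  let ?c = "real (card (dchars n))"
  obtain x :: nat where x: "x > 0" "1 + (\<Sum>p\<in>prime_factors n. ln (real p)) + Q + ?c * Q + ?c * \<bar>C\<bar> < ln (real x)"
    using exists_real_gt_ln by blast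
  let ?T = "\<Sum>m | m \<in> {1..x} \<and> [b * m = 1] (mod n). mangoldt m / real m :: real"
  have sum: "(\<Sum>\<xi>\<in>dchars n. Re (\<xi> b) * of_bool (dchar_vanishes n \<xi>)) = 0"
    by (intro sum.neutral) (simp add: not_dchar_vanishes[OF n])
  have "\<bar>?c * ?T - Re (mangoldt_sum (principal_dchar n) x)\<bar> \<le> ?c * \<bar>C\<bar>"
    using sum_dchars_split[OF n cb x(1) C] unfolding sum by simp
  moreover have "?T \<le> mangoldt_nonprime x"
    unfolding mangoldt_nonprime_def
    by (rule sum_mono2) (use no iff in \<open>auto simp: mangoldt_nonneg\<close>)
  then have "?T \<le> Q" using Q[rule_format, of x] by linarith
  then have "?c * ?T \<le> ?c * Q" by (intro mult_left_mono) auto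
  moreover have "mangoldt_nonprime x \<le> Q" using Q by blast
  ultimately show False
    using Re_mangoldt_sum_principal_ge[OF n x(1)] x(2) by linarith
qed

section \<open>Gluing, units and closures in the profinite integers\<close>

lemma zhat_exists:
  assumes g: "\<And>m n. 0 < n \<Longrightarrow> m dvd n \<Longrightarrow> g n mod int m = g m mod int m"
  shows "\<exists>x. \<forall>n>0. zproj n x = g n mod int n"
proof -
  define h where "h = (\<lambda>n\<in>{0<..}. g n mod int n)"
  have "h \<in> (\<Pi>\<^sub>E n\<in>{0<..}. {0..<int n}) \<and> (\<forall>m n. 0 < n \<and> m dvd n \<longrightarrow> h n mod int m = h m)"
    unfolding h_def by (rule residues_compatible) (rule g)
  then have "zhat_fun (Abs_zhat h) = h"
    by (intro Abs_zhat_inverse) simp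
  then have "\<forall>n>0. zproj n (Abs_zhat h) = g n mod int n"
    by (simp add: zproj_def h_def)
  then show ?thesis by blast
qed

lemma pigeonhole_power_cong:
  fixes m d :: nat
  assumes "d > 0"
  shows "\<exists>i j. i < j \<and> j \<le> d \<and> [m ^ i = m ^ j] (mod d)"
proof -
  have "\<not> inj_on (\<lambda>i. m ^ i mod d) {..d}"
  proof
    assume "inj_on (\<lambda>i. m ^ i mod d) {..d}"
    then have "card {..d} \<le> card {..<d}"
      using assms by (intro card_inj_on_le) auto
    then show False by simp
  qed
  then obtain i j where "i \<le> d" "j \<le> d" "i \<noteq> j" "[m ^ i = m ^ j] (mod d)"
    by (auto simp: inj_on_def cong_def)
  then show ?thesis by (cases i j rule: linorder_cases) (auto dest: cong_sym)
qed

text \<open>The powers of \<open>m\<close> modulo \<open>d\<close> have a preperiod and a period of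
  at most \<open>d\<close>; \<open>fact d\<close> is at least the first and a multiple of the
  second.\<close>

lemma power_fact_idempotent_cong:
  fixes m d :: nat
  assumes "d > 0"
  shows "[m ^ fact d * m ^ fact d = m ^ fact d] (mod d)"
proof -
  obtain i j where ij: "i < j" "j \<le> d" "[m ^ i = m ^ j] (mod d)"
    using pigeonhole_power_cong[OF assms] by blast
  define t where "t = j - i"
  have t: "1 \<le> t" "t \<le> d" "j = i + t" using ij by (auto simp: t_def)
  have period: "[m ^ (k + q * t) = m ^ k] (mod d)" if "i \<le> k" for k q
  proof (induction q)
    case (Suc q)
    have "i \<le> k + q * t" using that by simp
    then obtain l where l: "k + q * t = l + i" using le_Suc_ex by (metis add.commute)
    then have "k + Suc q * t = l + j" using t(3) by simp
    then have eqs: "m ^ (k + Suc q * t) = m ^ l * m ^ j" "m ^ (k + q * t) = m ^ l * m ^ i"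
      by (simp_all only: l power_add)
    have "[m ^ l * m ^ j = m ^ l * m ^ i] (mod d)"
      using ij(3) by (intro cong_scalar_left) (rule cong_sym)
    then have "[m ^ (k + Suc q * t) = m ^ (k + q * t)] (mod d)"
      by (simp only: eqs)
    then show ?case using Suc.IH by (rule cong_trans)
  qed simp
  have "t dvd fact d" using t by (intro dvd_fact) auto
  then obtain q where q: "fact d = t * q" by (elim dvdE)
  have "i \<le> fact d" using ij fact_ge_self[of d] by linarith
  then have "[m ^ (fact d + q * t) = m ^ fact d] (mod d)" by (rule period)
  moreover have "fact d + q * t = fact d + fact d" by (simp only: q mult.commute)
  ultimately show ?thesis by (simp only: power_add)
qed

text \<open>Modulo \<open>d\<close> the left side is a power of the idempotent
  \<open>m ^ fact d\<close>, hence equal to it. This is the compatibility that makes the limit of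
  the powers an element of \<open>zhat\<close>.\<close>

lemma power_fact_cong:
  fixes m d n :: nat
  assumes "n > 0" "d dvd n"
  shows "[m ^ fact n = m ^ fact d] (mod d)"
proof -
  have d: "d > 0" "d \<le> n" using dvd_pos_nat[OF assms] dvd_imp_le[OF assms(2,1)] by simp_all
  have idem: "[(m ^ fact d) ^ Suc k = m ^ fact d] (mod d)" for k
  proof (induction k)
    case (Suc k)
    have "[m ^ fact d * (m ^ fact d) ^ Suc k = m ^ fact d * m ^ fact d] (mod d)"
      by (rule cong_scalar_left[OF Suc.IH])
    then have "[(m ^ fact d) ^ Suc (Suc k) = m ^ fact d * m ^ fact d] (mod d)"
      by (simp only: power_Suc)
    then show ?case using power_fact_idempotent_cong[OF d(1)] by (rule cong_trans)
  qed simp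
  have "(fact d :: nat) dvd fact n" using d(2) by (rule fact_dvd)
  then obtain r where r: "(fact n :: nat) = fact d * r" by (elim dvdE)
  moreover have "(fact n :: nat) \<noteq> 0" by simp
  ultimately obtain k where "r = Suc k" by (cases r) auto
  then show ?thesis using idem[of k] by (simp only: r power_mult)
qed

text \<open>
  The powers \<open>m ^ fact k\<close> converge to an idempotent that is \<open>0\<close> at the primes dividing \<open>m\<close> and
  \<open>1\<close> at the others; \<open>e\<close> is the complementary idempotent.
\<close>

lemma zhat_split:
  assumes "m > 0"
  shows "\<exists>e. zproj m e = 1 mod int m \<and> (\<forall>n>0. coprime m n \<longrightarrow> zproj n e = 0)"
proof -
  have "\<exists>x. \<forall>n>0. zproj n x = int (m ^ fact n) mod int n"
  proof (rule zhat_exists)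
    fix d n :: nat assume "0 < n" "d dvd n"
    then show "int (m ^ fact n) mod int d = int (m ^ fact d) mod int d"
      using power_fact_cong[of n d m] unfolding cong_def by (simp only: of_nat_mod[symmetric])
  qed
  then obtain x where x: "\<And>n. n > 0 \<Longrightarrow> zproj n x = int (m ^ fact n) mod int n" by blast
  have "m dvd m ^ fact m" by (intro dvd_power) simp
  then have "int m dvd int (m ^ fact m)" by (simp only: of_nat_dvd_iff)
  then have "zproj m x = 0"
    unfolding x[OF assms] by (rule dvd_imp_mod_0)
  then have "zproj m (1 - x) = 1 mod int m" using assms by (simp add: mod_simps)
  moreover have "zproj n (1 - x) = 0" if "n > 0" "coprime m n" for n
  proof -
    have "totient n dvd fact n"
      using that by (intro dvd_fact) (auto simp: totient_le Suc_le_eq)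
    then obtain q where q: "fact n = totient n * q" by (elim dvdE)
    have "[(m ^ totient n) ^ q = 1 ^ q] (mod n)"
      using that by (intro cong_pow euler_theorem)
    then have "[m ^ fact n = 1] (mod n)" unfolding q power_mult by simp
    then have "int (m ^ fact n mod n) = int (1 mod n)" unfolding cong_def by (rule arg_cong)
    then have "int (m ^ fact n) mod int n = 1 mod int n" by (simp only: of_nat_mod of_nat_1)
    then show ?thesis using that(1) x[OF that(1)] by (simp add: mod_simps)
  qed
  ultimately show ?thesis by blast
qed

text \<open>The element \<open>b + e * (a - b)\<close>, with \<open>e\<close> from
  \<open>zhat_split\<close>, serves as a Chinese remainder theorem for \<open>m\<close> against all
  moduli coprime to \<open>m\<close> at once.\<close>

lemma zhat_glue:
  assumes "m > 0"
  shows "\<exists>c. zproj m c = zproj m a \<and> (\<forall>n>0. coprime m n \<longrightarrow> zproj n c = zproj n b)"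
proof -
  obtain e where e: "zproj m e = 1 mod int m" "\<And>n. n > 0 \<Longrightarrow> coprime m n \<Longrightarrow> zproj n e = 0"
    using zhat_split[OF assms] by blast
  have "[zproj m b + zproj m e * (zproj m a - zproj m b) = zproj m b + 1 * (zproj m a - zproj m b)] (mod int m)"
    unfolding e(1) by (intro cong_add cong_mult cong_refl) (simp add: cong_def)
  then have "zproj m (b + e * (a - b)) = zproj m a"
    using assms by (simp add: cong_def mod_add_right_eq mod_mult_right_eq)
  moreover have "zproj n (b + e * (a - b)) = zproj n b" if "n > 0" "coprime m n" for n
    using that e(2) by simp
  ultimately show ?thesis by blast
qed

lemma zproj_poly_cong:
  assumes n: "n > 0" and eq: "zproj n a = zproj n b"
  shows "zproj n (poly f a) = zproj n (poly f b)"
  by (induction f) (simp_all add: n eq)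

lemma zproj_eq_0_iff_dvd: "n > 0 \<Longrightarrow> m dvd n \<Longrightarrow> zproj m x = 0 \<longleftrightarrow> int m dvd zproj n x"
  using zproj_mod[of n m x] by (simp add: dvd_eq_mod_eq_0)

lemma coprime_zproj:
  assumes n: "n > 0" and u: "\<And>p. prime p \<Longrightarrow> p dvd n \<Longrightarrow> zproj p u \<noteq> 0"
  shows "coprime (nat (zproj n u)) n"
proof (rule ccontr)
  assume "\<not> coprime (nat (zproj n u)) n"
  then have "gcd (nat (zproj n u)) n \<noteq> 1" by (simp only: coprime_iff_gcd_eq_1 not_False_eq_True)
  then obtain p where p: "prime p" "p dvd gcd (nat (zproj n u)) n" using prime_factor_nat by blast
  then have "int p dvd int (nat (zproj n u))" by (simp only: of_nat_dvd_iff) simp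
  then have "int p dvd zproj n u" using zproj_range[OF n, of u] by simp
  then have "zproj p u = 0" using zproj_eq_0_iff_dvd[OF n, of p u] p(2) by simp
  then show False using u p by simp
qed

text \<open>Being nonzero modulo every prime makes each projection invertible; inverses are unique
  modulo \<open>n\<close>, so they form a compatible family.\<close>

lemma zhat_units_iff: "u \<in> zhat_units \<longleftrightarrow> (\<forall>p. prime p \<longrightarrow> zproj p u \<noteq> 0)"
proof
  assume "u \<in> zhat_units"
  then obtain v where v: "1 = u * v" by (auto simp: zhat_units_def)
  show "\<forall>p. prime p \<longrightarrow> zproj p u \<noteq> 0"
  proof (intro allI impI notI)
    fix p assume p: "prime p" "zproj p u = 0"
    then have "p > 1" by (intro prime_gt_1_nat)
    then have "zproj p (u * v) = 0" "zproj p 1 = 1" using p by simp_all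
    then show False using v by simp
  qed
next
  assume u: "\<forall>p. prime p \<longrightarrow> zproj p u \<noteq> 0"
  have cop: "coprime (zproj n u) (int n)" if "n > 0" for n
  proof -
    have "coprime (nat (zproj n u)) n" using u that by (intro coprime_zproj) auto
    then have "coprime (int (nat (zproj n u))) (int n)" by (simp only: coprime_int_iff)
    then show ?thesis using zproj_range[OF that, of u] by simp
  qed
  have "\<forall>n. \<exists>y. n > 0 \<longrightarrow> [zproj n u * y = 1] (mod int n)"
  proof
    fix n
    show "\<exists>y. n > 0 \<longrightarrow> [zproj n u * y = 1] (mod int n)"
      using cong_solve_coprime_int[OF cop[of n]] by (cases "n > 0") auto
  qed
  from choice[OF this] obtain g where "\<forall>n. n > 0 \<longrightarrow> [zproj n u * g n = 1] (mod int n)"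
    by (elim exE)
  then have g: "[zproj n u * g n = 1] (mod int n)" if "n > 0" for n using that by simp
  have "\<exists>x. \<forall>n>0. zproj n x = g n mod int n"
  proof (rule zhat_exists)
    fix m n :: nat assume n: "0 < n" "m dvd n"
    then have m: "0 < m" by (rule dvd_pos_nat)
    have 1: "[zproj n u * g n = 1] (mod int m)"
      using cong_dvd_modulus[OF g[OF n(1)], of "int m"] n(2) by simp
    have "[zproj m u = zproj n u] (mod int m)"
      using zproj_mod[OF n, of u] m by (simp add: cong_def)
    then have "[zproj m u * g n = zproj n u * g n] (mod int m)" by (rule cong_scalar_right)
    from cong_trans[OF this cong_trans[OF 1 cong_sym[OF g[OF m]]]]
    have "[g n = g m] (mod int m)" by (simp only: cong_mult_lcancel[OF cop[OF m]])
    then show "g n mod int m = g m mod int m" by (simp only: cong_def)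
  qed
  then obtain x where x: "\<And>n. n > 0 \<Longrightarrow> zproj n x = g n mod int n" by blast
  have "1 = u * x"
  proof (rule zhat_eqI)
    fix n :: nat assume n: "0 < n"
    then show "zproj n 1 = zproj n (u * x)"
      using g[OF n] x[OF n] by (simp add: mod_simps cong_def)
  qed
  then have "u dvd 1" by (rule dvdI)
  then show "u \<in> zhat_units" by (simp add: zhat_units_def)
qed

lemma closure_zhat_iff: "x \<in> closure S \<longleftrightarrow> (\<forall>n>0. zproj n x \<in> zproj n ` S)"
proof
  assume x: "x \<in> closure S"
  show "\<forall>n>0. zproj n x \<in> zproj n ` S"
  proof (intro allI impI)
    fix n :: nat assume n: "n > 0"
    have "S \<inter> (zproj n -` {zproj n x}) \<noteq> {}"
      using x[unfolded closure_iff_nhds_not_empty, rule_format,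
          of "zproj n -` {zproj n x}" "zproj n -` {zproj n x}"] open_zproj_vimage[OF n] by simp
    then obtain s where "s \<in> S" "zproj n s = zproj n x" by auto
    then show "zproj n x \<in> zproj n ` S" by (metis imageI)
  qed
next
  assume *: "\<forall>n>0. zproj n x \<in> zproj n ` S"
  show "x \<in> closure S"
  proof (rule ccontr)
    assume "x \<notin> closure S"
    then have "x \<in> - closure S" "open (- closure S)" by auto
    then obtain n where n: "n > 0" "zproj n -` {zproj n x} \<subseteq> - closure S"
      unfolding open_zhat_iff by blast
    then obtain s where "s \<in> S" "zproj n x = zproj n s" using * by blast
    then show False using n(2) closure_subset[of S] by fastforce
  qed
qed

lemma zproj_image_closure: "n > 0 \<Longrightarrow> zproj n ` closure S = zproj n ` S"
  using closure_subset[of S] by (auto simp: closure_zhat_iff)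

text \<open>The second inclusion is Dirichlet's theorem.\<close>

lemma closure_zhat_primes: "closure zhat_primes = zhat_primes \<union> zhat_units"
proof (intro equalityI subsetI)
  fix x assume x: "x \<in> closure zhat_primes"
  show "x \<in> zhat_primes \<union> zhat_units"
  proof (cases "x \<in> zhat_units")
    case False
    then obtain p where p: "prime p" "zproj p x = 0" by (auto simp: zhat_units_iff)
    \<comment> \<open>A prime \<open>q\<close> with the residue of \<open>x\<close> modulo
      \<open>p * n\<close> is divisible by \<open>p\<close>, so it is \<open>p\<close>; as
      \<open>n\<close> is arbitrary, \<open>x\<close> is \<open>p\<close>.\<close>
    have "x = of_nat p"
    proof (rule zhat_eqI)
      fix n :: nat assume n: "0 < n"
      then have pn: "0 < p * n" using p(1) by (simp add: prime_gt_0_nat)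
      then have "zproj (p * n) x \<in> zproj (p * n) ` zhat_primes"
        using x unfolding closure_zhat_iff by blast
      then obtain q where q: "prime q" "zproj (p * n) x = zproj (p * n) (of_nat q)"
        unfolding zhat_primes_def by blast
      have eq: "zproj p x = zproj p (of_nat q)" "zproj n x = zproj n (of_nat q)"
        using zproj_eq_dvd[OF pn _ q(2)] by simp_all
      then have "int q mod int p = 0"
        using p by (simp add: zproj_of_nat prime_gt_0_nat)
      then have "p dvd q" by presburger
      then have "p = q" using p(1) q(1) by (simp add: primes_dvd_imp_eq)
      then show "zproj n x = zproj n (of_nat p)" using eq(2) by simp
    qed
    then show ?thesis using p(1) by (simp add: zhat_primes_def)
  qed simp
next
  fix x assume "x \<in> zhat_primes \<union> zhat_units"
  then show "x \<in> closure zhat_primes"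
  proof
    assume "x \<in> zhat_primes"
    then show ?thesis using closure_subset by blast
  next
    assume x: "x \<in> zhat_units"
    show ?thesis
      unfolding closure_zhat_iff
    proof (intro allI impI)
      fix n :: nat assume n: "n > 0"
      define a where "a = nat (zproj n x)"
      have a: "int a = zproj n x" using zproj_range[OF n, of x] by (simp add: a_def)
      have "coprime a n"
        unfolding a_def using x n by (intro coprime_zproj) (auto simp: zhat_units_iff)
      from prime_in_residue_class[OF n this]
      obtain p where p: "prime p" "[p = a] (mod n)" by blast
      have "zproj n (of_nat p) = int (p mod n)" using n by (simp add: zproj_of_nat of_nat_mod)
      also have "\<dots> = int (a mod n)" using p(2) by (simp add: cong_def)
      also have "\<dots> = zproj n x" using n by (simp add: of_nat_mod a)
      finally show "zproj n x \<in> zproj n ` zhat_primes"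
        by (intro image_eqI[of _ _ "of_nat p"]) (simp_all add: zhat_primes_def p(1))
    qed
  qed
qed

section \<open>Sets given by local conditions\<close>

definition zhat_loc :: "(nat \<Rightarrow> int set) \<Rightarrow> zhat set" where
  "zhat_loc R = {a. \<forall>p. prime p \<longrightarrow> zproj p a \<in> R p}"

definition res_loc :: "(nat \<Rightarrow> int set) \<Rightarrow> nat \<Rightarrow> int set" where
  "res_loc R n = {a \<in> {0..<int n}. \<forall>p. prime p \<longrightarrow> p dvd n \<longrightarrow> a mod int p \<in> R p}"

lemma finite_res_loc [simp]: "finite (res_loc R n)"
  by (rule finite_subset[of _ "{0..<int n}"]) (auto simp: res_loc_def)

lemma zproj_image_subset_res_loc:
  assumes n: "n > 0" and S: "\<And>a p. a \<in> S \<Longrightarrow> prime p \<Longrightarrow> p dvd n \<Longrightarrow> zproj p a \<in> R p"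
  shows "zproj n ` S \<subseteq> res_loc R n"
proof
  fix x assume "x \<in> zproj n ` S"
  then obtain a where a: "x = zproj n a" "a \<in> S" by (rule imageE)
  show "x \<in> res_loc R n"
    using zproj_range[OF n, of a] S[OF a(2)] zproj_mod[OF n, of _ a]
    by (simp add: res_loc_def a(1))
qed

text \<open>A residue that satisfies the conditions at the primes dividing \<open>n\<close> is glued
  with a point of the set at all other primes; this is where nonemptiness enters.\<close>

lemma zproj_image_loc:
  assumes n: "n > 0" and ne: "zhat_loc R \<noteq> {}"
  shows "zproj n ` zhat_loc R = res_loc R n"
proof
  show "zproj n ` zhat_loc R \<subseteq> res_loc R n"
    by (rule zproj_image_subset_res_loc[OF n]) (simp add: zhat_loc_def)
  show "res_loc R n \<subseteq> zproj n ` zhat_loc R"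
  proof
    fix x assume x: "x \<in> res_loc R n"
    then have x_range: "x \<in> {0..<int n}" by (simp add: res_loc_def)
    obtain b where b: "b \<in> zhat_loc R" using ne by blast
    obtain c where c: "zproj n c = zproj n (of_int x)" "\<And>m. m > 0 \<Longrightarrow> coprime n m \<Longrightarrow> zproj m c = zproj m b"
      using zhat_glue[OF n] by blast
    have "zproj p c \<in> R p" if p: "prime p" for p
    proof (cases "p dvd n")
      case True
      then have "zproj p c = x mod int p"
        using zproj_mod[OF n True, of c] c(1) zproj_of_int_surj[OF n x_range] by simp
      then show ?thesis using x p True by (simp add: res_loc_def)
    next
      case False
      then have "coprime n p" by (subst coprime_commute) (rule prime_imp_coprime[OF p])
      then have "zproj p c = zproj p b" using p by (intro c(2)) (simp_all add: prime_gt_0_nat)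
      then show ?thesis using b p by (simp add: zhat_loc_def)
    qed
    then have "c \<in> zhat_loc R" by (simp add: zhat_loc_def)
    moreover have "x = zproj n c" using c(1) zproj_of_int_surj[OF n x_range] by simp
    ultimately show "x \<in> zproj n ` zhat_loc R" by (intro image_eqI)
  qed
qed

lemma inj_on_mod_coprime:
  assumes "coprime m n" "X \<subseteq> {0..<int (m * n)}"
  shows "inj_on (\<lambda>a. (a mod int m, a mod int n)) X"
proof (rule inj_onI)
  fix x y assume xy: "x \<in> X" "y \<in> X" "(x mod int m, x mod int n) = (y mod int m, y mod int n)"
  then have "[x = y] (mod int m)" "[x = y] (mod int n)" by (simp_all add: cong_def)
  then have "[x = y] (mod int m * int n)"
    using assms(1) by (intro coprime_cong_mult) auto
  then show "x = y" using xy(1,2) assms(2) by (auto simp: cong_def subset_iff)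
qed

lemma zproj_mod_image: "n > 0 \<Longrightarrow> m dvd n \<Longrightarrow> (\<lambda>a. a mod int m) ` zproj n ` S = zproj m ` S"
  by (simp add: image_image zproj_mod)

lemma zproj_image_range: "n > 0 \<Longrightarrow> zproj n ` S \<subseteq> {0..<int n}"
  using zproj_range by auto

lemma card_zproj_mult_coprime_le:
  assumes "coprime m n" "m > 0" "n > 0"
  shows "card (zproj (m * n) ` S) \<le> card (zproj m ` S) * card (zproj n ` S)"
proof -
  have mn: "m * n > 0" using assms by simp
  have "card (zproj (m * n) ` S) \<le> card (zproj m ` S \<times> zproj n ` S)"
  proof (rule card_inj_on_le)
    show "inj_on (\<lambda>a. (a mod int m, a mod int n)) (zproj (m * n) ` S)"
      using assms(1) zproj_image_range[OF mn] by (rule inj_on_mod_coprime)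
    show "(\<lambda>a. (a mod int m, a mod int n)) ` zproj (m * n) ` S \<subseteq> zproj m ` S \<times> zproj n ` S"
      using zproj_mod[OF mn, of m] zproj_mod[OF mn, of n] by auto
  qed (use assms in \<open>simp add: finite_zproj_image\<close>)
  then show ?thesis by (simp add: card_cartesian_product)
qed

lemma card_res_loc_mult_coprime:
  assumes cop: "coprime m n" and pos: "m > 0" "n > 0"
  shows "card (res_loc R (m * n)) = card (res_loc R m) * card (res_loc R n)"
proof -
  let ?h = "\<lambda>a. (a mod int m, a mod int n)"
  have modmod: "x mod int m mod int p = x mod int p" if "p dvd m" for x m p
    using that by (simp add: mod_mod_cancel)
  have "bij_betw ?h (res_loc R (m * n)) (res_loc R m \<times> res_loc R n)"
    unfolding bij_betw_def
  proof
    show "inj_on ?h (res_loc R (m * n))"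
      using cop by (rule inj_on_mod_coprime) (auto simp: res_loc_def)
    show "?h ` res_loc R (m * n) = res_loc R m \<times> res_loc R n"
    proof (intro equalityI subsetI)
      fix z assume "z \<in> ?h ` res_loc R (m * n)"
      then obtain x where x: "z = ?h x" "x \<in> res_loc R (m * n)" by (rule imageE)
      then show "z \<in> res_loc R m \<times> res_loc R n"
        using pos by (simp add: res_loc_def modmod)
    next
      fix z assume "z \<in> res_loc R m \<times> res_loc R n"
      then obtain a b where z: "z = (a, b)" "a \<in> res_loc R m" "b \<in> res_loc R n" by (rule SigmaE)
      obtain x where x: "[x = a] (mod int m)" "[x = b] (mod int n)"
        using binary_chinese_remainder_int[of "int m" "int n" a b] cop by auto
      define y where "y = x mod int (m * n)"
      have "y mod int m = x mod int m" "y mod int n = x mod int n"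
        unfolding y_def by (rule modmod, simp)+
      then have y: "y mod int m = a" "y mod int n = b"
        using x z pos by (simp_all add: cong_def res_loc_def)
      have "y \<in> res_loc R (m * n)"
        unfolding res_loc_def
      proof (intro CollectI conjI allI impI)
        show "y \<in> {0..<int (m * n)}" using pos by (simp add: y_def)
        fix p assume p: "prime p" "p dvd m * n"
        then consider "p dvd m" | "p dvd n" by (auto simp: prime_dvd_mult_iff)
        then show "y mod int p \<in> R p"
        proof cases
          case 1
          then have "y mod int p = a mod int p" using y(1) modmod[OF 1, of y] by simp
          then show ?thesis using z(2) p(1) 1 by (simp add: res_loc_def)
        next
          case 2
          then have "y mod int p = b mod int p" using y(2) modmod[OF 2, of y] by simp
          then show ?thesis using z(3) p(1) 2 by (simp add: res_loc_def)
        qed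
      qed
      then show "z \<in> ?h ` res_loc R (m * n)"
        by (intro image_eqI[of _ _ y]) (simp_all add: z(1) y)
    qed
  qed
  from bij_betw_same_card[OF this] show ?thesis by (simp add: card_cartesian_product)
qed

lemma card_res_loc_prime_power:
  assumes p: "prime p" and R: "R p \<subseteq> {0..<int p}"
  shows "card (res_loc R (p ^ Suc e)) = card (R p) * p ^ e"
proof -
  have p0: "p > 0" using p by (simp add: prime_gt_0_nat)
  have iff: "x \<in> res_loc R (p ^ Suc e) \<longleftrightarrow> x \<in> {0..<int (p ^ Suc e)} \<and> x mod int p \<in> R p" for x
  proof -
    have "q = p" if q: "prime q" "q dvd p ^ Suc e" for q
      using primes_dvd_imp_eq[OF q(1) p prime_dvd_power[OF q]] .
    moreover have "p dvd p ^ Suc e" by simp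
    ultimately show ?thesis using p unfolding res_loc_def by blast
  qed
  let ?g = "\<lambda>(r, j). r + int p * j"
  have "bij_betw ?g (R p \<times> {0..<int (p ^ e)}) (res_loc R (p ^ Suc e))"
    unfolding bij_betw_def
  proof
    have r: "(r + int p * j) mod int p = r" "(r + int p * j) div int p = j" if "r \<in> R p" for r j
      using that R p0 by auto
    show "inj_on ?g (R p \<times> {0..<int (p ^ e)})"
    proof (rule inj_onI, clarify)
      fix r j r' j' assume *: "r \<in> R p" "r' \<in> R p" "r + int p * j = r' + int p * j'"
      then show "r = r' \<and> j = j'" using r[of r j] r[of r' j'] by simp
    qed
    show "?g ` (R p \<times> {0..<int (p ^ e)}) = res_loc R (p ^ Suc e)"
    proof (intro equalityI subsetI)
      fix x assume "x \<in> ?g ` (R p \<times> {0..<int (p ^ e)})"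
      then obtain r j where x: "x = r + int p * j" "r \<in> R p" "0 \<le> j" "j < int (p ^ e)" by auto
      have "int p * (j + 1) \<le> int p * int (p ^ e)"
        using x(4) by (intro mult_left_mono) auto
      moreover have "0 \<le> int p * j" using x(3) by simp
      moreover have "0 \<le> r" "r < int p" using x(2) R by auto
      ultimately have "0 \<le> x" "x < int (p ^ Suc e)" unfolding x(1) by (simp_all add: distrib_left)
      then show "x \<in> res_loc R (p ^ Suc e)"
        unfolding iff using r(1)[OF x(2), of j] x(2) by (simp add: x(1))
    next
      fix x assume "x \<in> res_loc R (p ^ Suc e)"
      then have x: "0 \<le> x" "x < int p * int (p ^ e)" "x mod int p \<in> R p" unfolding iff by auto
      have "0 \<le> x div int p" using x p0 by (simp add: pos_imp_zdiv_nonneg_iff)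
      moreover have "x div int p < int (p ^ e)"
      proof -
        have "int p * (x div int p) \<le> x"
          using p0 mult_div_mod_eq[of "int p" x] pos_mod_sign[of "int p" x] by linarith
        then have "int p * (x div int p) < int p * int (p ^ e)" using x(2) by linarith
        then show ?thesis using p0 by (simp only: mult_less_cancel_left_pos of_nat_0_less_iff)
      qed
      ultimately show "x \<in> ?g ` (R p \<times> {0..<int (p ^ e)})"
        using x(3) by (intro image_eqI[of _ _ "(x mod int p, x div int p)"]) simp_all
    qed
  qed
  from bij_betw_same_card[OF this] show ?thesis
    by (simp add: card_cartesian_product del: of_nat_power power_Suc)
qed

lemma card_res_loc:
  assumes "n > 0" and R: "\<And>p. prime p \<Longrightarrow> R p \<subseteq> {0..<int p}"
  shows "real (card (res_loc R n)) = real n * (\<Prod>p\<in>prime_factors n. real (card (R p)) / real p)"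
  using \<open>n > 0\<close>
proof (induction n rule: less_induct)
  case (less n)
  show ?case
  proof (cases "n = 1")
    case True
    have "res_loc R 1 = {0}" by (auto simp: res_loc_def)
    then show ?thesis using True by simp
  next
    case False
    then have "n > 1" using less.prems by linarith
    from prime_power_split[OF this] obtain p e m where
      n: "prime p" "e > 0" "n = p ^ e * m" "\<not> p dvd m" "m > 0" "m < n" by blast
    obtain e' where e': "e = Suc e'" using n(2) by (cases e) auto
    have p0: "p > 0" using n(1) by (simp add: prime_gt_0_nat)
    have cop: "coprime (p ^ e) m" using n prime_imp_coprime[of p m] by simp
    have "prime_factors n = insert p (prime_factors m)"
      using n(1,2,5) p0 unfolding n(3)
      by (subst prime_factors_product) (simp_all add: prime_factorization_prime_power)
    moreover have "p \<notin> prime_factors m" using n(4) by auto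
    ultimately have prod: "(\<Prod>q\<in>prime_factors n. real (card (R q)) / real q)
        = real (card (R p)) / real p * (\<Prod>q\<in>prime_factors m. real (card (R q)) / real q)"
      by simp
    have "card (res_loc R n) = card (res_loc R (p ^ e)) * card (res_loc R m)"
      unfolding n(3) using p0 n(5) by (intro card_res_loc_mult_coprime cop) auto
    also have "card (res_loc R (p ^ e)) = card (R p) * p ^ e'"
      unfolding e' by (rule card_res_loc_prime_power[of p R e', OF n(1) R[OF n(1)]])
    finally have "real (card (res_loc R n)) = real (card (R p)) * real (p ^ e') * real (card (res_loc R m))"
      by simp
    also have "real (card (res_loc R m)) = real m * (\<Prod>q\<in>prime_factors m. real (card (R q)) / real q)"
      by (rule less.IH[OF n(6,5)])
    also have "real (card (R p)) * real (p ^ e') * (real m * (\<Prod>q\<in>prime_factors m. real (card (R q)) / real q))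
        = real n * (\<Prod>q\<in>prime_factors n. real (card (R q)) / real q)"
    proof -
      have rn: "real n = real p * (real (p ^ e') * real m)" using n(3) by (simp add: e')
      show ?thesis unfolding prod rn using p0 by simp
    qed
    finally show ?thesis .
  qed
qed

text \<open>Two local sets are compared with each other instead of with \<open>n\<close>, since the
  density of the set of unit values may tend to 0.\<close>

lemma card_res_loc_ratio:
  assumes n: "n > 0" and R: "\<And>p. prime p \<Longrightarrow> R p \<subseteq> {0..<int p} \<and> R p \<noteq> {}"
    and R': "\<And>p. prime p \<Longrightarrow> R' p \<subseteq> {0..<int p}"
  shows "real (card (res_loc R' n))
    = real (card (res_loc R n)) * (\<Prod>p\<in>prime_factors n. real (card (R' p)) / real (card (R p)))"
proof -
  have "real (card (R p)) \<noteq> 0" if "p \<in> prime_factors n" for p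
  proof -
    have "prime p" using that by auto
    then have "finite (R p)" "R p \<noteq> {}" using R finite_subset[of "R p" "{0..<int p}"] by auto
    then show ?thesis by simp
  qed
  then have "(\<Prod>p\<in>prime_factors n. real (card (R' p)) / real p)
      = (\<Prod>p\<in>prime_factors n. (real (card (R p)) / real p) * (real (card (R' p)) / real (card (R p))))"
    by (intro prod.cong refl) simp
  also have "\<dots> = (\<Prod>p\<in>prime_factors n. real (card (R p)) / real p)
      * (\<Prod>p\<in>prime_factors n. real (card (R' p)) / real (card (R p)))"
    by (rule prod.distrib)
  finally show ?thesis
    using card_res_loc[OF n, of R] card_res_loc[OF n, of R'] R R' by simp
qed

section \<open>Counting roots modulo primes and prime powers\<close>

lemma card_zproj_root_mod_prime:
  fixes f :: "zhat poly"
  assumes p: "prime p" and nz: "\<exists>a. zproj p (poly f a) \<noteq> 0"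
  shows "card (zproj p ` {a. zproj p (poly f a) = 0}) \<le> degree f"
  using nz
proof (induction "degree f" arbitrary: f rule: less_induct)
  case less
  have p0: "p > 0" using p by (simp add: prime_gt_0_nat)
  show ?case
  proof (cases "\<exists>r. zproj p (poly f r) = 0")
    case False
    then have "{a. zproj p (poly f a) = 0} = {}" by blast
    then show ?thesis by simp
  next
    case True
    then obtain r where r: "zproj p (poly f r) = 0" by blast
    define g where "g = synthetic_div f r"
    \<comment> \<open>The division takes place over \<open>zhat\<close>, where dividing by the monic
      \<open>x - r\<close> is harmless; absence of zero divisors is used only after reduction modulo
      \<open>p\<close>.\<close>
    have f: "f = [:- r, 1:] * g + [:poly f r:]"
      unfolding g_def by (rule synthetic_div_correct'[symmetric])
    have val: "zproj p (poly f a) = (zproj p (a - r) * zproj p (poly g a)) mod int p" for a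
    proof -
      have "poly f a = (a - r) * poly g a + poly f r"
        using arg_cong[OF f, of "\<lambda>q. poly q a"] by (simp add: left_diff_distrib)
      then show ?thesis using p0 r by simp
    qed
    have "degree f \<noteq> 0"
    proof
      assume "degree f = 0"
      then have "g = 0" by (simp add: g_def synthetic_div_eq_0_iff)
      then have "zproj p (poly f a) = 0" for a using val[of a] p0 by simp
      then show False using less.prems by blast
    qed
    then have deg: "degree g < degree f" "Suc (degree g) = degree f"
      by (simp_all add: g_def degree_synthetic_div)
    have "\<exists>a. zproj p (poly g a) \<noteq> 0"
    proof (rule ccontr)
      assume "\<not> ?thesis"
      then have "zproj p (poly f a) = 0" for a using val[of a] by simp
      then show False using less.prems by blast
    qed
    then have IH: "card (zproj p ` {a. zproj p (poly g a) = 0}) \<le> degree g"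
      using deg(1) less.hyps by blast
    have "zproj p ` {a. zproj p (poly f a) = 0} \<subseteq> insert (zproj p r) (zproj p ` {a. zproj p (poly g a) = 0})"
    proof clarify
      fix a assume a: "zproj p (poly f a) = 0" "zproj p a \<notin> zproj p ` {a. zproj p (poly g a) = 0}"
      then have "zproj p (poly g a) \<noteq> 0" by blast
      then have "\<not> int p dvd zproj p (poly g a)"
        using zproj_range[OF p0, of "poly g a"] zdvd_not_zless by auto
      moreover have "int p dvd zproj p (a - r) * zproj p (poly g a)"
        using a(1) val[of a] by (simp add: dvd_eq_mod_eq_0)
      ultimately have "int p dvd zproj p (a - r)"
        using p by (simp add: prime_dvd_mult_iff)
      then have "int p dvd zproj p a - zproj p r"
        using p0 by (simp add: dvd_eq_mod_eq_0)
      then have "zproj p a mod int p = zproj p r mod int p" by (simp only: mod_eq_dvd_iff)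
      then show "zproj p a = zproj p r" using p0 by simp
    qed
    then have "card (zproj p ` {a. zproj p (poly f a) = 0})
        \<le> card (insert (zproj p r) (zproj p ` {a. zproj p (poly g a) = 0}))"
      using p0 by (intro card_mono) (simp_all add: finite_zproj_image)
    also have "\<dots> \<le> Suc (card (zproj p ` {a. zproj p (poly g a) = 0}))"
      using p0 by (simp add: card_insert_if finite_zproj_image)
    finally show ?thesis using IH deg(2) by simp
  qed
qed

text \<open>
  If \<open>r\<close> is a root modulo \<open>p ^ e\<close> and \<open>f = (x - r) g + f r\<close>, every other root is congruent to
  \<open>r\<close> modulo \<open>p ^ u\<close> or a root of \<open>g\<close> modulo \<open>p ^ (e - u)\<close>.
\<close>

lemma roots_mod_prime_power:
  fixes f :: "zhat poly"
  assumes p: "prime p" and nz: "\<exists>a. zproj p (poly f a) \<noteq> 0"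
    and "degree f \<le> d" "Suc (d * u) \<le> e"
  shows "\<exists>X. finite X \<and> card X \<le> d \<and> (\<forall>a. zproj (p ^ e) (poly f a) = 0 \<longrightarrow> zproj (p ^ u) a \<in> X)"
  using assms(2-)
proof (induction d arbitrary: f e)
  case 0
  have p0: "p > 0" using p by (simp add: prime_gt_0_nat)
  obtain b where b: "zproj p (poly f b) \<noteq> 0" using 0 by blast
  obtain c where c: "f = [:c:]" using 0 by (auto elim: degree_eq_zeroE)
  \<comment> \<open>The exponent is still positive here: every root split off costs
    \<open>u\<close>, and \<open>Suc (d * u)\<close> leaves one factor \<open>p\<close>, modulo
    which the constant is nonzero.\<close>
  have "zproj (p ^ e) (poly f a) \<noteq> 0" for a
  proof
    assume "zproj (p ^ e) (poly f a) = 0"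
    moreover have "p dvd p ^ e" using 0 by (intro dvd_power) simp
    ultimately have "zproj p (poly f a) = 0" using zproj_eq_0_iff_dvd[of "p ^ e" p] p0 by simp
    then show False using b by (simp add: c)
  qed
  then show ?case by (intro exI[of _ "{}"]) simp
next
  case (Suc d)
  have p0: "p > 0" using p by (simp add: prime_gt_0_nat)
  have pe: "p ^ e > 0" "p ^ u > 0" using p0 by simp_all
  show ?case
  proof (cases "\<exists>r. zproj (p ^ e) (poly f r) = 0")
    case False
    then show ?thesis by (intro exI[of _ "{}"]) simp
  next
    case True
    then obtain r where r: "zproj (p ^ e) (poly f r) = 0" by blast
    define g where "g = synthetic_div f r"
    have f: "f = [:- r, 1:] * g + [:poly f r:]"
      unfolding g_def by (rule synthetic_div_correct'[symmetric])
    have val: "zproj m (poly f a) = (zproj m (a - r) * zproj m (poly g a)) mod int m"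
      if "m > 0" "zproj m (poly f r) = 0" for m a
    proof -
      have "poly f a = (a - r) * poly g a + poly f r"
        using arg_cong[OF f, of "\<lambda>q. poly q a"] by (simp add: left_diff_distrib)
      then show ?thesis using that by simp
    qed
    have "p dvd p ^ e" using Suc.prems by (intro dvd_power) simp
    then have rp: "zproj p (poly f r) = 0"
      using r zproj_eq_0_iff_dvd[OF pe(1), of p "poly f r"] by simp
    obtain b where b: "zproj p (poly f b) \<noteq> 0" using Suc.prems by blast
    then have "zproj p (poly g b) \<noteq> 0" using val[OF p0 rp, of b] by auto
    moreover have "degree g \<le> d" using Suc.prems by (simp add: g_def degree_synthetic_div)
    moreover have le: "u \<le> e" "Suc (d * u) \<le> e - u" using Suc.prems by simp_all
    ultimately obtain X where X: "finite X" "card X \<le> d"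
        "\<And>a. zproj (p ^ (e - u)) (poly g a) = 0 \<Longrightarrow> zproj (p ^ u) a \<in> X"
      using Suc.IH[of g "e - u"] by blast
    have "zproj (p ^ u) a \<in> insert (zproj (p ^ u) r) X" if a: "zproj (p ^ e) (poly f a) = 0" for a
    proof (cases "zproj (p ^ (e - u)) (poly g a) = 0")
      case False
      have dvd: "int p ^ e dvd zproj (p ^ e) (a - r) * zproj (p ^ e) (poly g a)"
        using a val[OF pe(1) r, of a] by (simp add: dvd_eq_mod_eq_0)
      have elem: "prime_elem (int p)" using p by simp
      \<comment> \<open>The \<open>e\<close> factors \<open>p\<close> are distributed among
        \<open>a - r\<close> and the value of \<open>g\<close>; fewer than \<open>e - u\<close> can
        go to the latter, so at least \<open>u\<close> go to \<open>a - r\<close>.\<close>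
      from prime_elem_power_dvd_prod[OF dvd elem] obtain x y where xy: "x + y = e" "int p ^ x dvd zproj (p ^ e) (a - r)"
          "int p ^ y dvd zproj (p ^ e) (poly g a)"
        by (elim exE conjE)
      have "\<not> e - u \<le> y"
      proof
        assume "e - u \<le> y"
        then have "int p ^ (e - u) dvd int p ^ y" by (rule le_imp_power_dvd)
        then have "int (p ^ (e - u)) dvd zproj (p ^ e) (poly g a)"
          unfolding of_nat_power using xy(3) by (rule dvd_trans)
        moreover have "p ^ (e - u) dvd p ^ e" by (intro le_imp_power_dvd) simp
        ultimately show False using False zproj_eq_0_iff_dvd[OF pe(1)] by blast
      qed
      then have "u \<le> x" using xy(1) by linarith
      then have "int p ^ u dvd int p ^ x" by (rule le_imp_power_dvd)
      then have "int (p ^ u) dvd zproj (p ^ e) (a - r)"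
        unfolding of_nat_power using xy(2) by (rule dvd_trans)
      moreover have "p ^ u dvd p ^ e" using le(1) by (intro le_imp_power_dvd)
      ultimately have "zproj (p ^ u) (a - r) = 0" using zproj_eq_0_iff_dvd[OF pe(1)] by blast
      then have "int (p ^ u) dvd zproj (p ^ u) a - zproj (p ^ u) r"
        using pe(2) by (simp add: dvd_eq_mod_eq_0)
      then have "zproj (p ^ u) a mod int (p ^ u) = zproj (p ^ u) r mod int (p ^ u)"
        by (simp only: mod_eq_dvd_iff)
      then show ?thesis using pe(2) by (simp only: zproj_mod_self) simp
    qed (use X(3) in simp)
    moreover have "card (insert (zproj (p ^ u) r) X) \<le> Suc d"
      using X(1,2) by (simp add: card_insert_if)
    ultimately show ?thesis using X(1) by (intro exI[of _ "insert (zproj (p ^ u) r) X"]) simp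
  qed
qed

lemma card_le_card_mod_image:
  fixes X :: "int set"
  assumes "X \<subseteq> {0..<int (m * q)}" "(\<lambda>x. x mod int m) ` X \<subseteq> Y" "finite Y" "m > 0"
  shows "card X \<le> card Y * q"
proof -
  have "card X \<le> card (Y \<times> {0..<int q})"
  proof (rule card_inj_on_le)
    show "inj_on (\<lambda>x. (x mod int m, x div int m)) X"
    proof (rule inj_onI)
      fix x y assume "(x mod int m, x div int m) = (y mod int m, y div int m)"
      then have "int m * (x div int m) + x mod int m = int m * (y div int m) + y mod int m"
        by (simp only: prod.inject)
      then show "x = y" by (simp only: mult_div_mod_eq)
    qed
    show "(\<lambda>x. (x mod int m, x div int m)) ` X \<subseteq> Y \<times> {0..<int q}"
    proof clarify
      fix x assume x: "x \<in> X"
      then have x': "0 \<le> x" "x < int m * int q" using assms(1) by auto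
      have "int m * (x div int m) \<le> x"
        using assms(4) mult_div_mod_eq[of "int m" x] pos_mod_sign[of "int m" x] by linarith
      then have "int m * (x div int m) < int m * int q" using x'(2) by linarith
      then have "x div int m < int q" using assms(4) by (simp only: mult_less_cancel_left_pos of_nat_0_less_iff)
      moreover have "0 \<le> x div int m" using x' assms(4) by (simp add: pos_imp_zdiv_nonneg_iff)
      ultimately show "x mod int m \<in> Y \<and> x div int m \<in> {0..<int q}" using x assms(2) by auto
    qed
  qed (use assms(3) in simp)
  then show ?thesis by (simp add: card_cartesian_product)
qed

section \<open>Procounting measures\<close>

text \<open>For \<open>n\<close> fine enough to describe \<open>U\<close>, the Haar measure cancels
  against the density factor; from here on only residues are counted.\<close>

lemma measure_approx_measure:
  assumes n: "n > 0" and U: "zhat_level U n"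
  shows "measure (approx_measure S n) U
    = real (card (zproj n ` S \<inter> zproj n ` U)) / real (card (zproj n ` S))"
proof -
  let ?C = "zproj n -` zproj n ` S"
  interpret prob_space zhat_haar using normalized_haar_zhat_haar by (simp add: normalized_haar_def)
  have sets: "sets zhat_haar = sets borel"
    using normalized_haar_zhat_haar by (simp add: normalized_haar_def)
  have U_eq: "U = zproj n -` zproj n ` U" using U by (simp add: zhat_level_def)
  have U_open: "open U" by (subst U_eq) (rule open_zproj_vimage[OF n])
  have CU_eq: "?C \<inter> U = zproj n -` (zproj n ` S \<inter> zproj n ` U)"
    by (subst (1) U_eq) (simp add: vimage_Int)
  have img: "zproj n ` (?C \<inter> U) = zproj n ` S \<inter> zproj n ` U"
    unfolding CU_eq by auto
  have "open (?C \<inter> U)" "compact (?C \<inter> U)"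
    unfolding CU_eq compact_zhat_iff_closed
    by (rule open_zproj_vimage[OF n], rule closed_zproj_vimage[OF n])
  moreover have "zhat_level (?C \<inter> U) n"
    unfolding zhat_level_def img using n CU_eq by simp
  ultimately have haar: "measure zhat_haar (?C \<inter> U) = real (card (zproj n ` S \<inter> zproj n ` U)) / real n"
    using normalized_haar_density[OF normalized_haar_zhat_haar] zhat_density_eq img by simp
  have C_sets: "?C \<in> sets zhat_haar" "U \<in> sets zhat_haar"
    using sets open_zproj_vimage[OF n] U_open by simp_all
  let ?c = "real n / real (card (zproj n ` S))"
  have "emeasure (approx_measure S n) U = (\<integral>\<^sup>+ x. ennreal ?c * indicator ?C x * indicator U x \<partial>zhat_haar)"
    unfolding approx_measure_def using C_sets by (intro emeasure_density) auto
  also have "\<dots> = (\<integral>\<^sup>+ x. ennreal ?c * indicator (?C \<inter> U) x \<partial>zhat_haar)"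
    by (intro nn_integral_cong) (simp add: indicator_inter_arith mult.assoc)
  also have "\<dots> = ennreal ?c * emeasure zhat_haar (?C \<inter> U)"
    using C_sets by (intro nn_integral_cmult_indicator) auto
  also have "\<dots> = ennreal (?c * measure zhat_haar (?C \<inter> U))"
    unfolding emeasure_eq_measure by (rule ennreal_mult[symmetric]) simp_all
  finally have "measure (approx_measure S n) U = ?c * measure zhat_haar (?C \<inter> U)"
    by (simp add: measure_def)
  then show ?thesis using n unfolding haar by simp
qed

lemma eventually_dvd_filter_level:
  assumes "zhat_level U m"
  shows "eventually (\<lambda>n. n > 0 \<and> m dvd n \<and> zhat_level U n) dvd_filter"
  using assms zhat_level_dvd[OF assms] unfolding eventually_dvd_filter
  by (intro exI[of _ m]) (simp add: zhat_level_def)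

text \<open>Changing numerator and denominator costs \<open>2 * d / card X\<close>, where
  \<open>d\<close> is the size of the symmetric difference; the smallness assumption makes
  \<open>card X\<close> at least half of the union, which gives the 4.\<close>

lemma card_ratio_diff_le:
  assumes fin: "finite X" "finite Y" and ne: "Y \<noteq> {}"
    and small: "2 * card (sym_diff X Y) \<le> card (X \<union> Y)"
  shows "\<bar>real (card (X \<inter> V)) / real (card X) - real (card (Y \<inter> V)) / real (card Y)\<bar>
    \<le> 4 * (real (card (sym_diff X Y)) / real (card (X \<union> Y)))"
proof -
  define d where "d = real (card (sym_diff X Y))"
  define u where "u = real (card (X \<union> Y))"
  have fs: "finite (sym_diff X Y)" using fin by simp
  have sub: "card A \<le> card B + card (sym_diff X Y)"
    if "A \<subseteq> B \<union> sym_diff X Y" "finite B" for A B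
  proof -
    have "card A \<le> card (B \<union> sym_diff X Y)" using that fs by (intro card_mono) auto
    also have "\<dots> \<le> card B + card (sym_diff X Y)" by (rule card_Un_le)
    finally show ?thesis .
  qed
  have u: "card (X \<union> Y) \<le> card X + card (sym_diff X Y)"
    using fin by (intro sub) auto
  have XY: "\<bar>real (card X) - real (card Y)\<bar> \<le> d"
  proof -
    have "card X \<le> card Y + card (sym_diff X Y)" "card Y \<le> card X + card (sym_diff X Y)"
      using fin by (intro sub; auto)+
    then show ?thesis unfolding d_def by linarith
  qed
  have XVYV: "\<bar>real (card (X \<inter> V)) - real (card (Y \<inter> V))\<bar> \<le> d"
  proof -
    have "card (X \<inter> V) \<le> card (Y \<inter> V) + card (sym_diff X Y)"
      "card (Y \<inter> V) \<le> card (X \<inter> V) + card (sym_diff X Y)"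
      using fin by (intro sub; auto)+
    then show ?thesis unfolding d_def by linarith
  qed
  have upos: "u > 0" using fin ne by (simp add: u_def card_gt_0_iff)
  have X: "u \<le> 2 * real (card X)" using u small unfolding u_def by linarith
  then have Xpos: "real (card X) > 0" using upos by linarith
  have Ypos: "real (card Y) > 0" using fin ne by (simp add: card_gt_0_iff)
  have YV: "real (card (Y \<inter> V)) \<le> real (card Y)" using fin by (simp add: card_mono)
  let ?x = "real (card X)" and ?y = "real (card Y)" and ?xv = "real (card (X \<inter> V))" and ?yv = "real (card (Y \<inter> V))"
  have "?xv / ?x - ?yv / ?y = ((?xv - ?yv) * ?y + ?yv * (?y - ?x)) / (?x * ?y)"
    using Xpos Ypos by (simp add: field_simps)
  also have "\<bar>\<dots>\<bar> = \<bar>(?xv - ?yv) * ?y + ?yv * (?y - ?x)\<bar> / (?x * ?y)"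
    using Xpos Ypos by (simp add: abs_mult)
  also have "\<dots> \<le> (2 * d * ?y) / (?x * ?y)"
  proof (rule divide_right_mono)
    have "\<bar>(?xv - ?yv) * ?y\<bar> \<le> d * ?y"
      using XVYV Ypos by (simp add: abs_mult mult_right_mono)
    moreover have "\<bar>?yv * (?y - ?x)\<bar> \<le> ?y * d"
      using XY YV unfolding abs_mult by (intro mult_mono) (auto simp: abs_minus_commute)
    ultimately show "\<bar>(?xv - ?yv) * ?y + ?yv * (?y - ?x)\<bar> \<le> 2 * d * ?y"
      using abs_triangle_ineq[of "(?xv - ?yv) * ?y" "?yv * (?y - ?x)"]
      by (simp only: mult.commute[of ?y d] mult.assoc)
  qed (use Xpos Ypos in simp)
  also have "\<dots> = 2 * d / ?x" using Ypos by simp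
  also have "\<dots> \<le> 2 * d / (u / 2)"
    using X upos by (intro divide_left_mono) (auto simp: d_def)
  also have "\<dots> = 4 * (d / u)" by simp
  finally show ?thesis unfolding d_def u_def .
qed

lemma close_pair_has_procounting_measure:
  assumes cp: "close_pair S T" and S: "S \<noteq> {}" and T: "has_procounting_measure T \<nu>"
  shows "has_procounting_measure S \<nu>"
proof -
  have Tne: "T \<noteq> {}" using T by (simp add: has_procounting_measure_def)
  define q where "q n = real (card (sym_diff (zproj n ` S) (zproj n ` T))) / real (card (zproj n ` (S \<union> T)))" for n
  have q: "(q \<longlongrightarrow> 0) dvd_filter"
    using cp by (simp add: close_pair_def q_def[abs_def])
  have "((\<lambda>n. measure (approx_measure S n) U) \<longlongrightarrow> measure \<nu> U) dvd_filter"
    if U: "compact U" "open U" for U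
  proof -
    obtain m where m: "zhat_level U m" using ex_zhat_level U by blast
    have lim: "((\<lambda>n. measure (approx_measure T n) U) \<longlongrightarrow> measure \<nu> U) dvd_filter"
      using T U by (simp add: has_procounting_measure_def)
    have ev: "eventually (\<lambda>n. q n < 1 / 2) dvd_filter"
      using q by (rule order_tendstoD) simp
    have "((\<lambda>n. measure (approx_measure S n) U - measure (approx_measure T n) U) \<longlongrightarrow> 0) dvd_filter"
    proof (rule tendsto_0_le[where K = 4])
      show "(q \<longlongrightarrow> 0) dvd_filter" by (rule q)
      show "eventually (\<lambda>n. norm (measure (approx_measure S n) U - measure (approx_measure T n) U) \<le> norm (q n) * 4) dvd_filter"
        using ev eventually_dvd_filter_level[OF m]
      proof eventually_elim
        case (elim n)
        then have n: "n > 0" "zhat_level U n" by simp_all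
        have "zproj n ` (S \<union> T) = zproj n ` S \<union> zproj n ` T" by (rule image_Un)
        then have qn: "q n = real (card (sym_diff (zproj n ` S) (zproj n ` T))) / real (card (zproj n ` S \<union> zproj n ` T))"
          by (simp only: q_def)
        have "0 < real (card (zproj n ` S \<union> zproj n ` T))"
          using Tne n(1) by (simp add: card_gt_0_iff finite_zproj_image)
        then have "2 * card (sym_diff (zproj n ` S) (zproj n ` T)) \<le> card (zproj n ` S \<union> zproj n ` T)"
          using elim(1) unfolding qn by (simp add: divide_less_eq)
        then have "\<bar>real (card (zproj n ` S \<inter> zproj n ` U)) / real (card (zproj n ` S))
            - real (card (zproj n ` T \<inter> zproj n ` U)) / real (card (zproj n ` T))\<bar> \<le> 4 * q n"
          unfolding qn using Tne n(1) by (intro card_ratio_diff_le) (simp_all add: finite_zproj_image)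
        moreover have "0 \<le> q n" by (simp add: q_def)
        ultimately show ?case
          using n by (simp add: measure_approx_measure)
      qed
    qed
    from tendsto_add[OF this lim] show ?thesis by simp
  qed
  then show ?thesis
    using T S unfolding has_procounting_measure_def by blast
qed

text \<open>Adding \<open>e * (b' - b)\<close> moves the residue modulo \<open>m\<close> from that
  of \<open>b\<close> to that of \<open>b'\<close> and changes nothing at primes not dividing
  \<open>m\<close>, so the local conditions persist.\<close>

lemma zhat_loc_translate:
  assumes m: "m > 0" and e: "zproj m e = 1 mod int m" "\<And>n. n > 0 \<Longrightarrow> coprime m n \<Longrightarrow> zproj n e = 0"
    and B: "a \<in> zhat_loc R" "b' \<in> zhat_loc R" and eq: "zproj m a = zproj m b"
  shows "zproj m (a + e * (b' - b)) = zproj m b'" "a + e * (b' - b) \<in> zhat_loc R"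
proof -
  have shift: "zproj k (a + e * (b' - b)) = zproj k b'" if k: "k dvd m" for k
  proof -
    have k0: "k > 0" using m k by (rule dvd_pos_nat)
    have ek: "zproj k e = 1 mod int k"
      using zproj_mod[OF m k, of e] k by (simp add: e(1) mod_mod_cancel)
    have ak: "zproj k a = zproj k b" using zproj_eq_dvd[OF m k eq] .
    have "[zproj k b + zproj k e * (zproj k b' - zproj k b) = zproj k b + 1 * (zproj k b' - zproj k b)] (mod int k)"
      unfolding ek by (intro cong_add cong_mult cong_refl) (simp add: cong_def)
    then show ?thesis
      using k0 by (simp add: ak cong_def mod_add_right_eq mod_mult_right_eq)
  qed
  show "zproj m (a + e * (b' - b)) = zproj m b'" by (rule shift) simp
  have "zproj p (a + e * (b' - b)) \<in> R p" if p: "prime p" for p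
  proof (cases "p dvd m")
    case True
    then show ?thesis using shift[OF True] B(2) p by (simp add: zhat_loc_def)
  next
    case False
    then have "coprime m p" by (subst coprime_commute) (rule prime_imp_coprime[OF p])
    then have "zproj p e = 0" using p by (intro e(2)) (simp_all add: prime_gt_0_nat)
    then have "zproj p (a + e * (b' - b)) = zproj p a" using p by (simp add: prime_gt_0_nat)
    then show ?thesis using B(1) p by (simp add: zhat_loc_def)
  qed
  then show "a + e * (b' - b) \<in> zhat_loc R" by (simp add: zhat_loc_def)
qed

text \<open>The translation maps one fibre injectively into the other; exchanging \<open>x\<close>
  and \<open>x'\<close> gives equality.\<close>

lemma card_fibre_le:
  assumes m: "m > 0" and n: "n > 0" "m dvd n"
    and x: "x \<in> zproj m ` zhat_loc R" "x' \<in> zproj m ` zhat_loc R"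
  shows "card {y \<in> zproj n ` zhat_loc R. y mod int m = x} \<le> card {y \<in> zproj n ` zhat_loc R. y mod int m = x'}"
proof -
  obtain b b' where b: "b \<in> zhat_loc R" "x = zproj m b" "b' \<in> zhat_loc R" "x' = zproj m b'"
    using x by (elim imageE)
  obtain e where e: "zproj m e = 1 mod int m" "\<And>n. n > 0 \<Longrightarrow> coprime m n \<Longrightarrow> zproj n e = 0"
    using zhat_split[OF m] by blast
  let ?t = "e * (b' - b)"
  let ?h = "\<lambda>y. (y + zproj n ?t) mod int n"
  have h: "?h (zproj n a) = zproj n (a + ?t)" for a
    using n(1) by (simp only: zproj_ring(3))
  show ?thesis
  proof (rule card_inj_on_le)
    show "inj_on ?h {y \<in> zproj n ` zhat_loc R. y mod int m = x}"
    proof (rule inj_onI, clarify)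
      fix a c assume "?h (zproj n a) = ?h (zproj n c)"
      then have "zproj n (a + ?t) = zproj n (c + ?t)" by (simp only: h)
      then have "zproj n (a + ?t - ?t) = zproj n (c + ?t - ?t)"
        using n(1) by (simp only: zproj_ring(4))
      then show "zproj n a = zproj n c" by simp
    qed
    show "?h ` {y \<in> zproj n ` zhat_loc R. y mod int m = x} \<subseteq> {y \<in> zproj n ` zhat_loc R. y mod int m = x'}"
    proof
      fix z assume "z \<in> ?h ` {y \<in> zproj n ` zhat_loc R. y mod int m = x}"
      then obtain a where a: "a \<in> zhat_loc R" "z = ?h (zproj n a)" "zproj n a mod int m = x" by auto
      have "zproj m a = zproj m b" using a(3) zproj_mod[OF n] b(2) by simp
      note tr = zhat_loc_translate[OF m e a(1) b(3) this]
      have z: "z = zproj n (a + ?t)" using a(2) h by simp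
      then have "z mod int m = x'" using tr(1) zproj_mod[OF n] b(4) by simp
      then show "z \<in> {y \<in> zproj n ` zhat_loc R. y mod int m = x'}"
        using z tr(2) by blast
    qed
    show "finite {y \<in> zproj n ` zhat_loc R. y mod int m = x'}"
      using n(1) by (simp add: finite_zproj_image)
  qed
qed

text \<open>When all fibres have the same size, this size cancels in the ratio, so the net is
  constant on the multiples of a level \<open>m\<close> of \<open>U\<close>.\<close>

lemma procounting_measure_exists_loc:
  assumes ne: "zhat_loc R \<noteq> {}"
  shows "procounting_measure_exists (zhat_loc R)"
  unfolding procounting_measure_exists_iff[OF ne]
proof (intro allI impI, elim conjE)
  fix U :: "zhat set" assume U: "compact U" "open U"
  let ?B = "zhat_loc R"
  obtain m where m: "zhat_level U m" using ex_zhat_level U by blast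
  then have m0: "m > 0" by (simp add: zhat_level_def)
  let ?l = "real (card (zproj m ` ?B \<inter> zproj m ` U)) / real (card (zproj m ` ?B))"
  have "measure (approx_measure ?B n) U = ?l" if n: "n > 0" "m dvd n" "zhat_level U n" for n
  proof -
    let ?F = "\<lambda>x. {y \<in> zproj n ` ?B. y mod int m = x}"
    have fin: "finite (zproj n ` ?B)" "finite (zproj m ` ?B)"
      using n m0 by (simp_all add: finite_zproj_image)
    obtain b where b: "b \<in> ?B" using ne by blast
    define c where "c = card (?F (zproj m b))"
    have c: "card (?F x) = c" if "x \<in> zproj m ` ?B" for x
      unfolding c_def
      by (intro antisym card_fibre_le[OF m0 n(1,2)] that imageI b)
    have count: "card {y \<in> zproj n ` ?B. y mod int m \<in> W} = card (zproj m ` ?B \<inter> W) * c" for W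
    proof -
      let ?S = "{y \<in> zproj n ` ?B. y mod int m \<in> W}"
      have sub: "(\<lambda>y. y mod int m) ` ?S \<subseteq> zproj m ` ?B \<inter> W"
        using zproj_mod[OF n(1,2)] by auto
      have "card ?S = (\<Sum>y\<in>?S. 1)" by simp
      also have "\<dots> = (\<Sum>x\<in>zproj m ` ?B \<inter> W. \<Sum>y | y \<in> ?S \<and> y mod int m = x. 1)"
        using fin sub by (intro sum.group[symmetric]) auto
      also have "\<dots> = (\<Sum>x\<in>zproj m ` ?B \<inter> W. c)"
      proof (rule sum.cong[OF refl])
        fix x assume x: "x \<in> zproj m ` ?B \<inter> W"
        then have "{y. y \<in> ?S \<and> y mod int m = x} = ?F x" by auto
        then show "(\<Sum>y | y \<in> ?S \<and> y mod int m = x. 1) = c" using c[of x] x by simp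
      qed
      finally show ?thesis by simp
    qed
    have "zproj n ` ?B \<inter> zproj n ` U = {y \<in> zproj n ` ?B. y mod int m \<in> zproj m ` U}"
    proof (intro equalityI subsetI)
      fix y assume "y \<in> zproj n ` ?B \<inter> zproj n ` U"
      then show "y \<in> {y \<in> zproj n ` ?B. y mod int m \<in> zproj m ` U}"
        using zproj_mod[OF n(1,2)] by auto
    next
      fix y assume "y \<in> {y \<in> zproj n ` ?B. y mod int m \<in> zproj m ` U}"
      then obtain a where a: "a \<in> ?B" "y = zproj n a" "zproj m a \<in> zproj m ` U"
        using zproj_mod[OF n(1,2)] by auto
      then have "a \<in> zproj m -` zproj m ` U" by simp
      then have "a \<in> U" using m unfolding zhat_level_def by metis
      then show "y \<in> zproj n ` ?B \<inter> zproj n ` U" using a by blast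
    qed
    then have 1: "card (zproj n ` ?B \<inter> zproj n ` U) = card (zproj m ` ?B \<inter> zproj m ` U) * c"
      using count[of "zproj m ` U"] by simp
    have 2: "card (zproj n ` ?B) = card (zproj m ` ?B) * c"
      using count[of UNIV] by simp
    have "zproj n b \<in> ?F (zproj m b)" using b zproj_mod[OF n(1,2)] by simp
    moreover have "finite (?F (zproj m b))" using fin(1) by simp
    ultimately have "c > 0" unfolding c_def card_gt_0_iff by blast
    then show ?thesis
      using n by (simp add: measure_approx_measure 1 2)
  qed
  then have "eventually (\<lambda>n. measure (approx_measure ?B n) U = ?l) dvd_filter"
    using eventually_dvd_filter_level[OF m] by (auto elim: eventually_mono)
  then show "\<exists>l. ((\<lambda>n. measure (approx_measure ?B n) U) \<longlongrightarrow> l) dvd_filter"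
    by (intro exI[of _ ?l] tendsto_eventually)
qed

section \<open>Polynomials with unit values\<close>

text \<open>Primes up to \<open>M\<close> are granted the trivial factor \<open>p\<close>; writing
  it as \<open>2 * p\<close> times one half puts them into a constant independent of
  \<open>P\<close>.\<close>

lemma prod_le_power_half:
  fixes g :: "nat \<Rightarrow> real"
  assumes P: "finite P" "\<And>p. p \<in> P \<Longrightarrow> p \<ge> 1" and g: "\<And>p. p \<in> P \<Longrightarrow> 0 \<le> g p"
    "\<And>p. p \<in> P \<Longrightarrow> g p \<le> real p" "\<And>p. p \<in> P \<Longrightarrow> M < p \<Longrightarrow> g p \<le> 1 / 2"
  shows "(\<Prod>p\<in>P. g p) \<le> (\<Prod>p=1..M. 2 * real p) * (1 / 2) ^ card P"
proof -
  have "(\<Prod>p\<in>P. g p) \<le> (\<Prod>p\<in>P. (if p \<le> M then 2 * real p else 1) * (1 / 2))"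
    using g by (intro prod_mono) auto
  also have "\<dots> = (\<Prod>p\<in>P. if p \<le> M then 2 * real p else 1) * (1 / 2) ^ card P"
    by (simp only: prod.distrib prod_constant)
  also have "(\<Prod>p\<in>P. if p \<le> M then 2 * real p else 1) = (\<Prod>p\<in>{p \<in> P. p \<le> M}. 2 * real p)"
    using P(1) by (simp add: prod.inter_filter)
  also have "\<dots> \<le> (\<Prod>p=1..M. 2 * real p)"
    using P(2) by (intro prod_mono2) auto
  finally show ?thesis by (simp add: mult_right_mono)
qed

locale unit_values =
  fixes f :: "nat \<Rightarrow> zhat poly" and k :: nat
  assumes ex_unit_value: "\<exists>b. \<forall>j\<in>{1..k}. poly (f j) b \<in> zhat_units"
begin

definition unit_res :: "nat \<Rightarrow> int set" where
  "unit_res p = zproj p ` {a. \<forall>j\<in>{1..k}. zproj p (poly (f j) a) \<noteq> 0}"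

lemma unit_res_iff:
  assumes "p > 0"
  shows "zproj p a \<in> unit_res p \<longleftrightarrow> (\<forall>j\<in>{1..k}. zproj p (poly (f j) a) \<noteq> 0)"
proof
  assume "zproj p a \<in> unit_res p"
  then obtain b where "zproj p a = zproj p b" "\<forall>j\<in>{1..k}. zproj p (poly (f j) b) \<noteq> 0"
    by (auto simp: unit_res_def)
  then show "\<forall>j\<in>{1..k}. zproj p (poly (f j) a) \<noteq> 0"
    using zproj_poly_cong[OF assms] by metis
qed (auto simp: unit_res_def)

lemma loc_unit_res: "zhat_loc unit_res = {a. \<forall>j\<in>{1..k}. poly (f j) a \<in> zhat_units}"
  unfolding zhat_loc_def zhat_units_iff by (auto simp: unit_res_iff prime_gt_0_nat)

lemma loc_unit_res_ne: "zhat_loc unit_res \<noteq> {}"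
  using ex_unit_value by (auto simp: loc_unit_res)

lemma unit_res_range: "prime p \<Longrightarrow> unit_res p \<subseteq> {0..<int p}"
  unfolding unit_res_def by (intro zproj_image_range prime_gt_0_nat)

lemma unit_res_ne: "prime p \<Longrightarrow> unit_res p \<noteq> {}"
  using loc_unit_res_ne by (auto simp: zhat_loc_def)

lemma card_unit_res_pos: "prime p \<Longrightarrow> 1 \<le> card (unit_res p)"
  using unit_res_ne finite_subset[OF unit_res_range] by (simp add: Suc_le_eq card_gt_0_iff)

lemma exists_nonzero_value: "j \<in> {1..k} \<Longrightarrow> prime p \<Longrightarrow> \<exists>a. zproj p (poly (f j) a) \<noteq> 0"
  using ex_unit_value unfolding zhat_units_iff by blast

definition total_degree :: nat where
  "total_degree = (\<Sum>j=1..k. degree (f j))"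

text \<open>A residue outside \<open>unit_res p\<close> is a root modulo \<open>p\<close> of some
  \<open>f j\<close>, and \<open>f j\<close> has at most its degree many, as it is not identically 0
  there.\<close>

lemma card_unit_res_ge:
  assumes p: "prime p"
  shows "p \<le> card (unit_res p) + total_degree"
proof -
  have p0: "p > 0" using p by (rule prime_gt_0_nat)
  let ?Z = "\<lambda>j. zproj p ` {a. zproj p (poly (f j) a) = 0}"
  have "{0..<int p} \<subseteq> unit_res p \<union> (\<Union>j\<in>{1..k}. ?Z j)"
  proof
    fix x assume "x \<in> {0..<int p}"
    then have x: "x = zproj p (of_int x)" using zproj_of_int_surj[OF p0] by simp
    show "x \<in> unit_res p \<union> (\<Union>j\<in>{1..k}. ?Z j)"
    proof (cases "\<forall>j\<in>{1..k}. zproj p (poly (f j) (of_int x)) \<noteq> 0")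
      case True
      then have "zproj p (of_int x) \<in> unit_res p" using unit_res_iff[OF p0] by blast
      then show ?thesis using x by simp
    next
      case False
      then obtain j where "j \<in> {1..k}" "of_int x \<in> {a. zproj p (poly (f j) a) = 0}" by blast
      then show ?thesis using x by blast
    qed
  qed
  then have "card {0..<int p} \<le> card (unit_res p \<union> (\<Union>j\<in>{1..k}. ?Z j))"
    using p0 finite_subset[OF unit_res_range[OF p]] by (intro card_mono) (simp_all add: finite_zproj_image)
  also have "\<dots> \<le> card (unit_res p) + card (\<Union>j\<in>{1..k}. ?Z j)" by (rule card_Un_le)
  also have "card (\<Union>j\<in>{1..k}. ?Z j) \<le> (\<Sum>j\<in>{1..k}. card (?Z j))"
    by (rule card_UN_le) simp
  also have "\<dots> \<le> total_degree"
    unfolding total_degree_def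
    by (intro sum_mono card_zproj_root_mod_prime[OF p] exists_nonzero_value p)
  finally show ?thesis by simp
qed

section \<open>Fibres over prime values\<close>

definition const_primes :: "nat \<Rightarrow> nat set" where
  "const_primes j = {p. prime p \<and> (\<forall>a b. zproj p (poly (f j) a) = zproj p (poly (f j) b))}"

text \<open>\<open>K\<close> is chosen before \<open>n\<close> and \<open>c\<close> because the
  bound is later summed over all primes \<open>c\<close> dividing \<open>n\<close>.\<close>

lemma card_fibre_nonconst:
  assumes "finite (const_primes j)"
  shows "\<exists>K\<ge>0. \<forall>n>0. \<forall>c. real (card (zproj n ` {a. poly (f j) a = c}))
    \<le> K * (1 / 2) ^ card (prime_factors n) * real (card (zproj n ` zhat_loc unit_res))"
proof -
  obtain M0 where M0: "\<And>p. p \<in> const_primes j \<Longrightarrow> p \<le> M0"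
    using assms unfolding finite_nat_set_iff_bounded_le by blast
  \<comment> \<open>A prime beyond \<open>M\<close> is not in \<open>const_primes j\<close>, so
    \<open>f j - c\<close> has at most \<open>degree (f j)\<close> roots for every \<open>c\<close>,
    while the unit residues number more than \<open>2 * degree (f j)\<close>; this gives the ratio
    1/2.\<close>
  define M where "M = M0 + 2 * degree (f j) + total_degree"
  show ?thesis
  proof (intro exI[of _ "\<Prod>p=1..M. 2 * real p"] conjI allI impI)
    show "0 \<le> (\<Prod>p=1..M. 2 * real p)" by (intro prod_nonneg) simp
    fix n :: nat and c assume n: "n > 0"
    define S where "S p = zproj p ` {a. zproj p (poly (f j) a) = zproj p c}" for p
    have S_range: "S p \<subseteq> {0..<int p}" if "prime p" for p
      unfolding S_def using that by (intro zproj_image_range prime_gt_0_nat)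
    have card_S: "card (S p) \<le> p" if "prime p" for p
      using card_mono[OF _ S_range[OF that]] by simp
    have card_S_deg: "card (S p) \<le> degree (f j)" if p: "prime p" "M < p" for p
    proof -
      have p0: "p > 0" using p(1) by (rule prime_gt_0_nat)
      have "p \<notin> const_primes j" using M0[of p] p(2) by (auto simp: M_def)
      then obtain a b where ab: "zproj p (poly (f j) a) \<noteq> zproj p (poly (f j) b)"
        using p(1) by (auto simp: const_primes_def)
      have eq0: "zproj p (poly (f j - [:c:]) a) = 0 \<longleftrightarrow> zproj p (poly (f j) a) = zproj p c" for a
      proof -
        have "zproj p (poly (f j - [:c:]) a) = (zproj p (poly (f j) a) - zproj p c) mod int p"
          using p0 by simp
        also have "\<dots> = 0 \<longleftrightarrow> zproj p (poly (f j) a) mod int p = zproj p c mod int p"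
          unfolding mod_eq_dvd_iff by (rule dvd_eq_mod_eq_0[symmetric])
        finally show ?thesis using p0 by (simp only: zproj_mod_self)
      qed
      have "\<exists>a. zproj p (poly (f j - [:c:]) a) \<noteq> 0"
        unfolding eq0 using ab by metis
      then have "card (zproj p ` {a. zproj p (poly (f j - [:c:]) a) = 0}) \<le> degree (f j - [:c:])"
        by (rule card_zproj_root_mod_prime[OF p(1)])
      also have "degree (f j - [:c:]) \<le> degree (f j)"
        by (rule degree_diff_le) simp_all
      finally show ?thesis by (simp only: eq0 S_def)
    qed
    have "zproj n ` {a. poly (f j) a = c} \<subseteq> res_loc S n"
      using n by (intro zproj_image_subset_res_loc) (auto simp: S_def)
    then have "real (card (zproj n ` {a. poly (f j) a = c})) \<le> real (card (res_loc S n))"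
      by (simp add: card_mono)
    also have "\<dots> = real (card (res_loc unit_res n))
        * (\<Prod>p\<in>prime_factors n. real (card (S p)) / real (card (unit_res p)))"
      using n unit_res_range unit_res_ne S_range by (intro card_res_loc_ratio) auto
    also have "\<dots> \<le> real (card (res_loc unit_res n)) * ((\<Prod>p=1..M. 2 * real p) * (1 / 2) ^ card (prime_factors n))"
    proof (intro mult_left_mono prod_le_power_half)
      fix p assume "p \<in> prime_factors n"
      then have p: "prime p" by auto
      then show "p \<ge> 1" using prime_ge_1_nat by blast
      have R1: "1 \<le> real (card (unit_res p))" using card_unit_res_pos[OF p] by simp
      show "0 \<le> real (card (S p)) / real (card (unit_res p))" by simp
      have "real (card (S p)) / real (card (unit_res p)) \<le> real (card (S p)) / 1"
        using R1 by (intro divide_left_mono) auto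
      then show "real (card (S p)) / real (card (unit_res p)) \<le> real p"
        using card_S[OF p] by simp
      assume "M < p"
      then have "2 * card (S p) \<le> card (unit_res p)"
        using card_S_deg[OF p] card_unit_res_ge[OF p] by (simp add: M_def)
      then have "2 * real (card (S p)) \<le> real (card (unit_res p))" by linarith
      then show "real (card (S p)) / real (card (unit_res p)) \<le> 1 / 2"
        using R1 by (simp add: divide_le_eq)
    qed simp_all
    finally show "real (card (zproj n ` {a. poly (f j) a = c}))
      \<le> (\<Prod>p=1..M. 2 * real p) * (1 / 2) ^ card (prime_factors n) * real (card (zproj n ` zhat_loc unit_res))"
      by (simp only: zproj_image_loc[OF n loc_unit_res_ne] mult_ac)
  qed
qed

definition attained_primes :: "nat \<Rightarrow> nat set" where
  "attained_primes j = {p. prime p \<and> (\<exists>a. poly (f j) a = of_nat p)}"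

text \<open>Two attained primes are congruent modulo each of the infinitely many primes in \<open>const_primes j\<close>.\<close>

lemma finite_attained_primes:
  assumes "infinite (const_primes j)"
  shows "finite (attained_primes j)"
proof -
  have "p = q" if pq: "p \<in> attained_primes j" "q \<in> attained_primes j" for p q
  proof -
    obtain l where l: "l \<in> const_primes j" "max p q < l"
      using assms unfolding infinite_nat_iff_unbounded by blast
    obtain a b where ab: "poly (f j) a = of_nat p" "poly (f j) b = of_nat q"
      using pq by (auto simp: attained_primes_def)
    have "zproj l (poly (f j) a) = zproj l (poly (f j) b)"
      using l(1) unfolding const_primes_def by blast
    then have "int p mod int l = int q mod int l"
      using l(2) by (simp add: ab zproj_of_nat)
    then show "p = q" using l(2) by simp
  qed
  then have "attained_primes j = {} \<or> (\<exists>p. attained_primes j = {p})" by blast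
  then show ?thesis by auto
qed

text \<open>Here the prime value \<open>p\<close> is fixed and nothing is gained at other primes.
  Once \<open>n\<close> is divisible by a high power of \<open>p\<close>, the roots of
  \<open>f j - p\<close> lie in at most \<open>d\<close> classes modulo \<open>p ^ u\<close>, and
  the conditions dropped at the primes in \<open>E\<close> cost only a constant.\<close>

lemma eventually_card_fibre_le:
  assumes j: "j \<in> {1..k}" and p: "prime p" and E: "finite E" and "\<epsilon> > 0"
  defines "S \<equiv> \<lambda>n. {a. poly (f j) a = of_nat p \<and> (\<forall>l. prime l \<longrightarrow> l dvd n \<longrightarrow> l \<notin> E \<longrightarrow> zproj l a \<in> unit_res l)}"
  shows "eventually (\<lambda>n. real (card (zproj n ` S n)) \<le> \<epsilon> * real (card (zproj n ` zhat_loc unit_res))) dvd_filter"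
proof -
  have p1: "p > 1" and p0: "p > 0" using prime_gt_1_nat[OF p] prime_gt_0_nat[OF p] by blast+
  \<comment> \<open>\<open>Suc\<close> keeps \<open>d\<close> positive even for constant
    \<open>f j\<close>, so that \<open>u \<le> d * u\<close>.\<close>
  define d where "d = Suc (degree (f j))"
  \<comment> \<open>The factor \<open>d\<close> counts the classes modulo \<open>p ^ u\<close>, the
    product pays for the primes in \<open>E\<close>, and the last factor \<open>p\<close> for
    bounding \<open>card (unit_res p)\<close> below by 1. \<open>max 1\<close> ensures that the
    product over a subset of \<open>E\<close> is at most the product over \<open>E\<close>.\<close>
  define Q where "Q = real d * (\<Prod>l\<in>E. max 1 (real l)) * real p"
  have "(\<lambda>u. Q * (1 / real p) ^ u) \<longlonglongrightarrow> Q * 0"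
    using p1 by (intro tendsto_intros LIMSEQ_power_zero) simp
  then have "eventually (\<lambda>u. Q * (1 / real p) ^ u < \<epsilon>) sequentially"
    using \<open>\<epsilon> > 0\<close> by (intro order_tendstoD) auto
  then obtain u where u: "Q * (1 / real p) ^ u < \<epsilon>"
    by (auto simp: eventually_sequentially)
  show ?thesis
    unfolding eventually_dvd_filter
  proof (intro exI[of _ "p ^ Suc (d * u)"] conjI allI impI)
    show "0 < p ^ Suc (d * u)" using p0 by simp
    fix n :: nat assume n: "n > 0" "p ^ Suc (d * u) dvd n"
    define e where "e = multiplicity p n"
    obtain m where m: "n = p ^ e * m" "\<not> p dvd m"
    proof (rule multiplicity_decompose'[of n p])
      show "n \<noteq> 0" "\<not> is_unit p" using n(1) p by auto
    qed (auto simp: e_def)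
    have m0: "m > 0" using m n(1) by (cases m) auto
    have le: "Suc (d * u) \<le> e"
      unfolding e_def using n p by (intro multiplicity_geI) auto
    have "u * 1 \<le> d * u" unfolding d_def by simp
    then have ue: "u \<le> e" using le by linarith
    obtain e' where e': "e = Suc e'" using le by (cases e) auto
    have cop: "coprime (p ^ e) m" using prime_imp_coprime[OF p m(2)] by simp
    have pe0: "p ^ e > 0" using p0 by simp
    let ?S1 = "zproj (p ^ e) ` S n" and ?S2 = "zproj m ` S n"
    \<comment> \<open>Modulo \<open>p\<close> the shift by \<open>p\<close> is invisible, and
      \<open>f j\<close> takes a unit value, so the count of roots modulo powers of \<open>p\<close>
      applies.\<close>
    have nz: "\<exists>a. zproj p (poly (f j - [:of_nat p:]) a) \<noteq> 0"
    proof -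
      obtain a where "zproj p (poly (f j) a) \<noteq> 0" using exists_nonzero_value[OF j p] by blast
      moreover have "zproj p (of_nat p) = 0" using p0 by (simp add: zproj_of_nat)
      ultimately have "zproj p (poly (f j - [:of_nat p:]) a) \<noteq> 0"
        using p0 by simp
      then show ?thesis by blast
    qed
    have "degree (f j - [:of_nat p:]) \<le> degree (f j)"
      by (rule degree_diff_le) simp_all
    then have deg: "degree (f j - [:of_nat p:]) \<le> d" by (simp add: d_def)
    obtain X where X: "finite X" "card X \<le> d"
        "\<And>a. zproj (p ^ e) (poly (f j - [:of_nat p:]) a) = 0 \<Longrightarrow> zproj (p ^ u) a \<in> X"
      using roots_mod_prime_power[OF p nz deg le] by blast
    have "p ^ e = p ^ u * p ^ (e - u)" using ue by (simp add: power_add[symmetric])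
    moreover have "?S1 \<subseteq> {0..<int (p ^ e)}" by (rule zproj_image_range[OF pe0])
    ultimately have S1_range: "?S1 \<subseteq> {0..<int (p ^ u * p ^ (e - u))}" by metis
    have "card ?S1 \<le> card X * p ^ (e - u)"
    proof (rule card_le_card_mod_image[OF S1_range _ X(1)])
      have "(\<lambda>x. x mod int (p ^ u)) ` ?S1 = zproj (p ^ u) ` S n"
        using pe0 ue by (intro zproj_mod_image le_imp_power_dvd)
      also have "\<dots> \<subseteq> X"
      proof clarify
        fix a assume "a \<in> S n"
        then have "poly (f j - [:of_nat p:]) a = 0" by (simp add: S_def)
        then show "zproj (p ^ u) a \<in> X" using pe0 by (intro X(3)) simp
      qed
      finally show "(\<lambda>x. x mod int (p ^ u)) ` ?S1 \<subseteq> X" .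
    qed (use p0 in simp)
    also have "\<dots> \<le> d * p ^ (e - u)" using X(2) by (rule mult_right_mono) simp
    finally have "real (card ?S1) \<le> real (d * p ^ (e - u))" by (simp only: of_nat_le_iff)
    also have "real (d * p ^ (e - u)) = real d * (real p * (1 / real p) ^ u) * real (p ^ e')"
    proof -
      have eq: "real p ^ (e - u) * real p ^ u = real p * real p ^ e'"
        using ue e' by (simp add: power_add[symmetric] power_Suc[symmetric] del: power_Suc)
      have "real p * real p ^ e' / real p ^ u = real p ^ (e - u)"
        unfolding eq[symmetric] using p0 by simp
      then show ?thesis by (simp add: power_inverse divide_inverse mult_ac)
    qed
    also have "\<dots> \<le> real d * (real p * (1 / real p) ^ u) * real (card (res_loc unit_res (p ^ e)))"
    proof (rule mult_left_mono)
      have "card (res_loc unit_res (p ^ e)) = card (unit_res p) * p ^ e'"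
        unfolding e' by (rule card_res_loc_prime_power[of p unit_res e', OF p unit_res_range[OF p]])
      moreover have "1 * p ^ e' \<le> card (unit_res p) * p ^ e'"
        using card_unit_res_pos[OF p] by (rule mult_right_mono) simp
      ultimately show "real (p ^ e') \<le> real (card (res_loc unit_res (p ^ e)))"
        by (simp only: of_nat_le_iff mult_1)
    qed simp
    finally have S1: "real (card ?S1) \<le> real d * (real p * (1 / real p) ^ u) * real (card (res_loc unit_res (p ^ e)))" .
    define R' where "R' l = (if l \<in> E then {0..<int l} else unit_res l)" for l
    have R'_range: "R' l \<subseteq> {0..<int l}" if "prime l" for l
      using unit_res_range[OF that] by (simp add: R'_def)
    have "?S2 \<subseteq> res_loc R' m"
    proof (rule zproj_image_subset_res_loc[OF m0])
      fix a l assume a: "a \<in> S n" "prime l" "l dvd m"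
      then have "l dvd n" by (simp add: m(1))
      then show "zproj l a \<in> R' l"
        using a zproj_range[OF prime_gt_0_nat[OF a(2)], of a] by (simp add: R'_def S_def)
    qed
    then have "real (card ?S2) \<le> real (card (res_loc R' m))" by (simp add: card_mono)
    also have "\<dots> = real (card (res_loc unit_res m))
        * (\<Prod>l\<in>prime_factors m. real (card (R' l)) / real (card (unit_res l)))"
      using m0 unit_res_range unit_res_ne R'_range by (intro card_res_loc_ratio) auto
    also have "\<dots> \<le> real (card (res_loc unit_res m)) * (\<Prod>l\<in>E. max 1 (real l))"
    proof (rule mult_left_mono)
      have "(\<Prod>l\<in>prime_factors m. real (card (R' l)) / real (card (unit_res l)))
          \<le> (\<Prod>l\<in>prime_factors m. if l \<in> E then max 1 (real l) else 1)"
      proof (rule prod_mono)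
        fix l assume "l \<in> prime_factors m"
        then have l: "prime l" by auto
        have R1: "1 \<le> real (card (unit_res l))" using card_unit_res_pos[OF l] by simp
        have "real l / real (card (unit_res l)) \<le> real l / 1"
          using R1 by (intro divide_left_mono) auto
        then show "0 \<le> real (card (R' l)) / real (card (unit_res l)) \<and>
            real (card (R' l)) / real (card (unit_res l)) \<le> (if l \<in> E then max 1 (real l) else 1)"
          using R1 by (auto simp: R'_def le_max_iff_disj)
      qed
      also have "\<dots> = (\<Prod>l\<in>{l \<in> prime_factors m. l \<in> E}. max 1 (real l))"
        by (rule prod.inter_filter[symmetric]) simp
      also have "\<dots> \<le> (\<Prod>l\<in>E. max 1 (real l))"
        using E by (intro prod_mono2) auto
      finally show "(\<Prod>l\<in>prime_factors m. real (card (R' l)) / real (card (unit_res l))) \<le> (\<Prod>l\<in>E. max 1 (real l))" .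
    qed simp
    finally have S2: "real (card ?S2) \<le> real (card (res_loc unit_res m)) * (\<Prod>l\<in>E. max 1 (real l))" .
    have "card (zproj n ` S n) \<le> card ?S1 * card ?S2"
      unfolding m(1) using cop pe0 m0 by (rule card_zproj_mult_coprime_le)
    then have "real (card (zproj n ` S n)) \<le> real (card ?S1) * real (card ?S2)"
      by (simp only: of_nat_mult[symmetric] of_nat_le_iff)
    also have "\<dots> \<le> (real d * (real p * (1 / real p) ^ u) * real (card (res_loc unit_res (p ^ e))))
        * (real (card (res_loc unit_res m)) * (\<Prod>l\<in>E. max 1 (real l)))"
      using S1 S2 by (intro mult_mono) auto
    also have "\<dots> = Q * (1 / real p) ^ u * real (card (res_loc unit_res (p ^ e)) * card (res_loc unit_res m))"
      by (simp add: Q_def mult_ac)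
    also have "card (res_loc unit_res (p ^ e)) * card (res_loc unit_res m) = card (zproj n ` zhat_loc unit_res)"
      using card_res_loc_mult_coprime[OF cop pe0 m0, of unit_res] m(1) zproj_image_loc[OF n(1) loc_unit_res_ne] by simp
    also have "Q * (1 / real p) ^ u * real (card (zproj n ` zhat_loc unit_res)) \<le> \<epsilon> * real (card (zproj n ` zhat_loc unit_res))"
      using u by (intro mult_right_mono) auto
    finally show "real (card (zproj n ` S n)) \<le> \<epsilon> * real (card (zproj n ` zhat_loc unit_res))" .
  qed
qed

section \<open>Comparison with the set of unit values\<close>

definition closure_values :: "zhat set" where
  "closure_values = {a. \<forall>j\<in>{1..k}. poly (f j) a \<in> closure zhat_primes}"

lemma loc_subset_closure_values: "zhat_loc unit_res \<subseteq> closure_values"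
  by (auto simp: loc_unit_res closure_values_def closure_zhat_primes)

text \<open>A nonunit in the closure of the primes is a prime, and a prime that vanishes modulo
  \<open>q\<close> is \<open>q\<close>.\<close>

lemma closure_values_zero_eq:
  assumes a: "a \<in> closure_values" "j \<in> {1..k}" and q: "prime q" "zproj q (poly (f j) a) = 0"
  shows "poly (f j) a = of_nat q"
proof -
  have "poly (f j) a \<notin> zhat_units" using q by (auto simp: zhat_units_iff)
  then have "poly (f j) a \<in> zhat_primes"
    using a unfolding closure_values_def closure_zhat_primes by blast
  then obtain p where p: "prime p" "poly (f j) a = of_nat p" by (auto simp: zhat_primes_def)
  then have "int p mod int q = 0" using q by (simp add: zproj_of_nat prime_gt_0_nat)
  then have "q dvd p" by presburger
  then have "q = p" using p(1) q(1) by (simp add: primes_dvd_imp_eq)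
  then show ?thesis using p(2) by simp
qed

definition exceptional_primes :: "nat set" where
  "exceptional_primes = (\<Union>j\<in>{j \<in> {1..k}. infinite (const_primes j)}. attained_primes j)"

text \<open>The second clause retains the unit conditions known for the points in question; without
  it the part of the fibre away from \<open>p\<close> could outgrow the image of the unit set by an
  unbounded factor.\<close>

definition exceptional_set :: "nat \<Rightarrow> nat \<Rightarrow> nat \<Rightarrow> zhat set" where
  "exceptional_set j p n = {a. poly (f j) a = of_nat p \<and>
    (\<forall>l. prime l \<longrightarrow> l dvd n \<longrightarrow> l \<notin> exceptional_primes \<longrightarrow> zproj l a \<in> unit_res l)}"

text \<open>Where some \<open>f j\<close> vanishes modulo a prime \<open>q\<close> dividing
  \<open>n\<close>, its value is \<open>q\<close>. If this happens for no index with finite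
  \<open>const_primes\<close>, all such \<open>q\<close> are exceptional, and the unit conditions
  hold at the other primes dividing \<open>n\<close>.\<close>

lemma diff_subset:
  assumes n: "n > 0"
  shows "zproj n ` closure_values - zproj n ` zhat_loc unit_res
    \<subseteq> (\<Union>j\<in>{j \<in> {1..k}. finite (const_primes j)}. \<Union>q\<in>prime_factors n. zproj n ` {a. poly (f j) a = of_nat q})
      \<union> (\<Union>(j, p)\<in>(SIGMA j:{j \<in> {1..k}. infinite (const_primes j)}. attained_primes j). zproj n ` exceptional_set j p n)"
    (is "_ \<subseteq> ?L \<union> ?R")
proof
  fix x assume x: "x \<in> zproj n ` closure_values - zproj n ` zhat_loc unit_res"
  then obtain a where a: "x = zproj n a" "a \<in> closure_values" by blast
  show "x \<in> ?L \<union> ?R"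
  proof (cases "\<exists>j q. j \<in> {1..k} \<and> finite (const_primes j) \<and> prime q \<and> q dvd n \<and> zproj q (poly (f j) a) = 0")
    case True
    then obtain j q where jq: "j \<in> {1..k}" "finite (const_primes j)" "prime q" "q dvd n" "zproj q (poly (f j) a) = 0"
      by blast
    have "poly (f j) a = of_nat q" using closure_values_zero_eq[OF a(2) jq(1,3,5)] .
    moreover have "q \<in> prime_factors n" using jq(3,4) n by (simp add: prime_factors_dvd)
    ultimately have "x \<in> ?L" using a(1) jq(1,2) by blast
    then show ?thesis by blast
  next
    case False
    have "x \<notin> res_loc unit_res n"
      using x zproj_image_loc[OF n loc_unit_res_ne] by simp
    then obtain q where q: "prime q" "q dvd n" "x mod int q \<notin> unit_res q"
      using zproj_range[OF n, of a] unfolding res_loc_def a(1) by auto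
    have "zproj q a \<notin> unit_res q" using q(3) zproj_mod[OF n q(2)] a(1) by simp
    then obtain j where j: "j \<in> {1..k}" "zproj q (poly (f j) a) = 0"
      unfolding unit_res_iff[OF prime_gt_0_nat[OF q(1)]] by blast
    have inf: "infinite (const_primes j)" using False j q by blast
    have val: "poly (f j) a = of_nat q" using closure_values_zero_eq[OF a(2) j(1) q(1) j(2)] .
    have att: "q \<in> attained_primes j" using val q(1) unfolding attained_primes_def by blast
    have "zproj l a \<in> unit_res l" if l: "prime l" "l dvd n" "l \<notin> exceptional_primes" for l
    proof (rule ccontr)
      assume "zproj l a \<notin> unit_res l"
      then obtain i where i: "i \<in> {1..k}" "zproj l (poly (f i) a) = 0"
        unfolding unit_res_iff[OF prime_gt_0_nat[OF l(1)]] by blast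
      have "infinite (const_primes i)" using False i l by blast
      moreover have "l \<in> attained_primes i"
        using closure_values_zero_eq[OF a(2) i(1) l(1) i(2)] l(1) unfolding attained_primes_def by blast
      ultimately show False using l(3) i(1) unfolding exceptional_primes_def by blast
    qed
    then have "a \<in> exceptional_set j q n" using val by (simp add: exceptional_set_def)
    then have "x \<in> ?R" using a(1) inf j(1) att by blast
    then show ?thesis by blast
  qed
qed

lemma filterlim_card_prime_factors: "filterlim (\<lambda>n. card (prime_factors n)) at_top dvd_filter"
  unfolding filterlim_at_top
proof
  fix Z :: nat
  obtain P :: "nat set" where P: "P \<subseteq> {p. prime p}" "finite P" "card P = Z"
    using infinite_arbitrarily_large[OF primes_infinite, of Z] by blast
  show "eventually (\<lambda>n. Z \<le> card (prime_factors n)) dvd_filter"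
    unfolding eventually_dvd_filter
  proof (intro exI[of _ "\<Prod>P"] conjI allI impI)
    show "0 < \<Prod>P" using P(1) by (intro prod_pos) (auto simp: prime_gt_0_nat)
    fix n :: nat assume n: "n > 0" "\<Prod>P dvd n"
    have "P \<subseteq> prime_factors n"
    proof
      fix p assume p: "p \<in> P"
      then have "p dvd \<Prod>P" using P(2) by (intro dvd_prod_eqI[OF _ _ refl])
      then have "p dvd n" using n(2) by (rule dvd_trans)
      then show "p \<in> prime_factors n" using p P(1) n(1) by (auto simp: prime_factors_dvd)
    qed
    then show "Z \<le> card (prime_factors n)" using card_mono[of "prime_factors n" P] P(3) by simp
  qed
qed

text \<open>With w primes dividing \<open>n\<close>, the fibres of the first kind contribute a
  multiple of w times the w-th power of 1/2, and w tends to infinity. Those of the second kind have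
  a finite index set independent of \<open>n\<close>, so termwise limits suffice.\<close>

lemma card_diff_ratio_tendsto_0:
  "((\<lambda>n. real (card (zproj n ` closure_values - zproj n ` zhat_loc unit_res)) / real (card (zproj n ` zhat_loc unit_res)))
    \<longlongrightarrow> 0) dvd_filter"
proof -
  let ?J1 = "{j \<in> {1..k}. finite (const_primes j)}"
  let ?J2 = "SIGMA j:{j \<in> {1..k}. infinite (const_primes j)}. attained_primes j"
  let ?b = "\<lambda>n. real (card (zproj n ` zhat_loc unit_res))"
  let ?w = "\<lambda>n. card (prime_factors n)"
  have J2: "finite ?J2" by (intro finite_SigmaI) (auto simp: finite_attained_primes)
  have E: "finite exceptional_primes"
    unfolding exceptional_primes_def by (intro finite_UN_I) (auto simp: finite_attained_primes)
  have b_pos: "?b n > 0" if "n > 0" for n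
    using that loc_unit_res_ne by (simp add: card_gt_0_iff finite_zproj_image)
  have "\<forall>j\<in>?J1. \<exists>K\<ge>0. \<forall>n>0. \<forall>c. real (card (zproj n ` {a. poly (f j) a = c})) \<le> K * (1 / 2) ^ ?w n * ?b n"
    by (intro ballI card_fibre_nonconst) simp
  from bchoice[OF this] obtain K where K: "\<forall>j\<in>?J1. K j \<ge> 0 \<and>
      (\<forall>n>0. \<forall>c. real (card (zproj n ` {a. poly (f j) a = c})) \<le> K j * (1 / 2) ^ ?w n * ?b n)"
    by (elim exE)
  define g where "g n = (\<Sum>j\<in>?J1. K j * (real (?w n) * (1 / 2) ^ ?w n))
    + (\<Sum>(j, p)\<in>?J2. real (card (zproj n ` exceptional_set j p n)) / ?b n)" for n
  have "((\<lambda>n. real (?w n) * (1 / 2) ^ ?w n) \<longlongrightarrow> 0) dvd_filter"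
    by (rule filterlim_compose[OF powser_times_n_limit_0 filterlim_card_prime_factors]) simp
  then have 1: "((\<lambda>n. \<Sum>j\<in>?J1. K j * (real (?w n) * (1 / 2) ^ ?w n)) \<longlongrightarrow> (\<Sum>j\<in>?J1. K j * 0)) dvd_filter"
    by (intro tendsto_sum tendsto_mult tendsto_const)
  have 2: "((\<lambda>n. real (card (zproj n ` exceptional_set j p n)) / ?b n) \<longlongrightarrow> 0) dvd_filter"
    if jp: "(j, p) \<in> ?J2" for j p
  proof (rule tendstoI)
    fix e :: real assume e: "e > 0"
    have j: "j \<in> {1..k}" and p: "prime p" using jp by (auto simp: attained_primes_def)
    have "eventually (\<lambda>n. real (card (zproj n ` exceptional_set j p n)) \<le> e / 2 * ?b n) dvd_filter"
      unfolding exceptional_set_def using e by (intro eventually_card_fibre_le j p E) simp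
    moreover have "eventually (\<lambda>n. n > 0) dvd_filter" by (auto simp: eventually_dvd_filter)
    ultimately show "eventually (\<lambda>n. dist (real (card (zproj n ` exceptional_set j p n)) / ?b n) 0 < e) dvd_filter"
    proof eventually_elim
      case (elim n)
      then have "real (card (zproj n ` exceptional_set j p n)) / ?b n \<le> e / 2"
        using b_pos[OF elim(2)] by (simp only: divide_le_eq if_True)
      moreover have "0 \<le> real (card (zproj n ` exceptional_set j p n)) / ?b n" by simp
      ultimately show ?case using e unfolding dist_real_def by linarith
    qed
  qed
  have "((\<lambda>n. \<Sum>(j, p)\<in>?J2. real (card (zproj n ` exceptional_set j p n)) / ?b n) \<longlongrightarrow> (\<Sum>(j, p)\<in>?J2. 0)) dvd_filter"
    unfolding case_prod_unfold by (rule tendsto_sum) (rule 2, simp)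
  from tendsto_add[OF 1 this] have g: "(g \<longlongrightarrow> 0) dvd_filter"
    by (simp add: g_def[abs_def] case_prod_unfold)
  show ?thesis
  proof (rule tendsto_sandwich[OF _ _ tendsto_const g])
    show "eventually (\<lambda>n. real (card (zproj n ` closure_values - zproj n ` zhat_loc unit_res)) / ?b n \<le> g n) dvd_filter"
      unfolding eventually_dvd_filter
    proof (intro exI[of _ 1] conjI allI impI)
      fix n :: nat assume n: "n > 0"
      let ?L = "\<lambda>j. \<Union>q\<in>prime_factors n. zproj n ` {a. poly (f j) a = of_nat q}"
      let ?R = "\<lambda>(j, p). zproj n ` exceptional_set j p n"
      have "card (zproj n ` closure_values - zproj n ` zhat_loc unit_res) \<le> card ((\<Union>j\<in>?J1. ?L j) \<union> (\<Union>z\<in>?J2. ?R z))"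
        using diff_subset[OF n] J2 n by (intro card_mono) (auto simp: finite_zproj_image)
      also have "\<dots> \<le> card (\<Union>j\<in>?J1. ?L j) + card (\<Union>z\<in>?J2. ?R z)" by (rule card_Un_le)
      also have "\<dots> \<le> (\<Sum>j\<in>?J1. card (?L j)) + (\<Sum>z\<in>?J2. card (?R z))"
        using J2 by (intro add_mono card_UN_le) simp_all
      finally have "real (card (zproj n ` closure_values - zproj n ` zhat_loc unit_res))
          \<le> (\<Sum>j\<in>?J1. real (card (?L j))) + (\<Sum>z\<in>?J2. real (card (?R z)))"
        by (simp only: of_nat_le_iff of_nat_add[symmetric] of_nat_sum[symmetric])
      also have "(\<Sum>j\<in>?J1. real (card (?L j))) \<le> (\<Sum>j\<in>?J1. K j * (real (?w n) * (1 / 2) ^ ?w n) * ?b n)"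
      proof (rule sum_mono)
        fix j assume j: "j \<in> ?J1"
        have "card (?L j) \<le> (\<Sum>q\<in>prime_factors n. card (zproj n ` {a. poly (f j) a = of_nat q}))"
          by (rule card_UN_le) simp
        then have "real (card (?L j)) \<le> (\<Sum>q\<in>prime_factors n. real (card (zproj n ` {a. poly (f j) a = of_nat q})))"
          by (simp only: of_nat_le_iff of_nat_sum[symmetric])
        also have "\<dots> \<le> (\<Sum>q\<in>prime_factors n. K j * (1 / 2) ^ ?w n * ?b n)"
          using bspec[OF K j] n by (intro sum_mono) blast
        finally show "real (card (?L j)) \<le> K j * (real (?w n) * (1 / 2) ^ ?w n) * ?b n"
          by (simp add: mult_ac)
      qed
      also have "(\<Sum>j\<in>?J1. K j * (real (?w n) * (1 / 2) ^ ?w n) * ?b n) + (\<Sum>z\<in>?J2. real (card (?R z))) = g n * ?b n"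
        using b_pos[OF n] by (simp add: g_def distrib_right sum_distrib_right case_prod_unfold)
      finally show "real (card (zproj n ` closure_values - zproj n ` zhat_loc unit_res)) / ?b n \<le> g n"
        using b_pos[OF n] by (simp only: divide_le_eq if_True)
    qed simp
  qed simp
qed

lemma close_pair_closure_values: "close_pair closure_values (zhat_loc unit_res)"
proof -
  let ?A = closure_values and ?B = "zhat_loc unit_res"
  have un: "?A \<union> ?B = ?A" using loc_subset_closure_values by blast
  have "((\<lambda>n. real (card (sym_diff (zproj n ` ?A) (zproj n ` ?B))) / real (card (zproj n ` ?A))) \<longlongrightarrow> 0) dvd_filter"
  \<comment> \<open>Replacing the denominator by the size of the smaller image only increases the
    ratio.\<close>
  proof (rule tendsto_sandwich[OF _ _ tendsto_const card_diff_ratio_tendsto_0])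
    show "eventually (\<lambda>n. real (card (sym_diff (zproj n ` ?A) (zproj n ` ?B))) / real (card (zproj n ` ?A))
        \<le> real (card (zproj n ` ?A - zproj n ` ?B)) / real (card (zproj n ` ?B))) dvd_filter"
      unfolding eventually_dvd_filter
    proof (intro exI[of _ 1] conjI allI impI)
      fix n :: nat assume n: "n > 0"
      have sub: "zproj n ` ?B \<subseteq> zproj n ` ?A" using loc_subset_closure_values by (rule image_mono)
      then have "sym_diff (zproj n ` ?A) (zproj n ` ?B) = zproj n ` ?A - zproj n ` ?B" by blast
      moreover have "card (zproj n ` ?B) \<le> card (zproj n ` ?A)"
        using sub n by (intro card_mono finite_zproj_image)
      moreover have "0 < card (zproj n ` ?B)"
        using n loc_unit_res_ne by (simp add: card_gt_0_iff finite_zproj_image)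
      ultimately show "real (card (sym_diff (zproj n ` ?A) (zproj n ` ?B))) / real (card (zproj n ` ?A))
          \<le> real (card (zproj n ` ?A - zproj n ` ?B)) / real (card (zproj n ` ?B))"
        by (simp only:) (intro divide_left_mono, simp_all)
    qed simp
  qed simp
  then show ?thesis
    unfolding close_pair_def un using loc_unit_res_ne loc_subset_closure_values by blast
qed

lemma closure_values_ne: "closure_values \<noteq> {}"
  using loc_unit_res_ne loc_subset_closure_values by blast

end

section \<open>Passage to closures and procounting measures\<close>

lemma close_pair_closure:
  assumes "close_pair (closure S) T"
  shows "close_pair S T"
proof -
  have "closure S \<union> T \<noteq> {}" using assms by (simp add: close_pair_def)
  then have "S \<union> T \<noteq> {}" by auto
  moreover have ev: "eventually (\<lambda>n. real (card (sym_diff (zproj n ` closure S) (zproj n ` T))) / real (card (zproj n ` (closure S \<union> T)))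
      = real (card (sym_diff (zproj n ` S) (zproj n ` T))) / real (card (zproj n ` (S \<union> T)))) dvd_filter"
    unfolding eventually_dvd_filter
  proof (intro exI[of _ 1] conjI allI impI)
    fix n :: nat assume "n > 0"
    then show "real (card (sym_diff (zproj n ` closure S) (zproj n ` T))) / real (card (zproj n ` (closure S \<union> T)))
        = real (card (sym_diff (zproj n ` S) (zproj n ` T))) / real (card (zproj n ` (S \<union> T)))"
      by (simp only: image_Un zproj_image_closure)
  qed simp
  moreover note Lim_transform_eventually[OF assms[unfolded close_pair_def, THEN conjunct2] ev]
  ultimately show ?thesis
    unfolding close_pair_def by (intro conjI)
qed

lemma close_pair_procounting_measure:
  assumes "close_pair S (zhat_loc R)" "S \<noteq> {}" "zhat_loc R \<noteq> {}"
  shows "procounting_measure_exists S \<and> procounting_measure_exists (zhat_loc R) \<and>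
    procounting_measure S = procounting_measure (zhat_loc R)"
proof -
  obtain \<nu> where \<nu>: "has_procounting_measure (zhat_loc R) \<nu>"
    using procounting_measure_exists_loc[OF assms(3)] unfolding procounting_measure_exists_def by blast
  then have S: "has_procounting_measure S \<nu>"
    by (rule close_pair_has_procounting_measure[OF assms(1,2)])
  show ?thesis
    unfolding procounting_measure_eqI[OF \<nu>] procounting_measure_eqI[OF S] procounting_measure_exists_def
    using \<nu> S by blast
qed

lemma poly_tuple_in_PiE_iff:
  "poly_tuple k f a \<in> (\<Pi>\<^sub>E i\<in>{1..k}. C) \<longleftrightarrow> (\<forall>j\<in>{1..k}. poly (f j) a \<in> C)"
  unfolding poly_tuple_def by (rule restrict_PiE_iff)

theorem theoremB:
  fixes f :: "nat \<Rightarrow> zhat poly" and k :: nat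
  assumes "range (poly_tuple k f) \<inter> (\<Pi>\<^sub>E i\<in>{1..k}. zhat_units) \<noteq> {}"
  defines "A \<equiv> poly_tuple k f -` (\<Pi>\<^sub>E i\<in>{1..k}. closure zhat_primes)"
    and "B \<equiv> poly_tuple k f -` (\<Pi>\<^sub>E i\<in>{1..k}. zhat_units)"
  shows "close_pair zhat_primes zhat_units \<and> close_pair A B \<and>
    procounting_measure_exists zhat_primes \<and> procounting_measure_exists zhat_units \<and>
    procounting_measure_exists A \<and> procounting_measure_exists B \<and>
    procounting_measure zhat_primes = procounting_measure zhat_units \<and>
    procounting_measure A = procounting_measure B"
proof -
  have "\<exists>b. \<forall>j\<in>{1..k}. poly (f j) b \<in> zhat_units"
    using assms(1) poly_tuple_in_PiE_iff[of k f _ zhat_units] by blast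
  then interpret g: unit_values f k by unfold_locales
  have AB: "A = g.closure_values" "B = zhat_loc g.unit_res"
    unfolding A_def B_def g.closure_values_def g.loc_unit_res
    by (simp_all only: vimage_def poly_tuple_in_PiE_iff)
  have close: "close_pair A B"
    unfolding AB by (rule g.close_pair_closure_values)
  have main: "procounting_measure_exists A \<and> procounting_measure_exists B \<and>
      procounting_measure A = procounting_measure B"
    using close_pair_procounting_measure[OF g.close_pair_closure_values g.closure_values_ne g.loc_unit_res_ne]
    unfolding AB .

  \<comment> \<open>The identity polynomial with \<open>k = 1\<close>: it has the unit value 1, and
    its two sets are the closure of the primes and the units.\<close>
  interpret h: unit_values "\<lambda>_. [:0, 1:]" 1
    by unfold_locales (auto simp: zhat_units_def intro: exI[of _ 1])
  have h: "h.closure_values = closure zhat_primes" "zhat_loc h.unit_res = zhat_units"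
    unfolding h.closure_values_def h.loc_unit_res by simp_all
  have close_primes: "close_pair zhat_primes zhat_units"
    using h.close_pair_closure_values unfolding h by (rule close_pair_closure)
  have "zhat_primes \<noteq> {}" using two_is_prime_nat unfolding zhat_primes_def by blast
  then have "procounting_measure_exists zhat_primes \<and> procounting_measure_exists zhat_units \<and>
      procounting_measure zhat_primes = procounting_measure zhat_units"
    using close_pair_procounting_measure[of zhat_primes h.unit_res] close_primes h.loc_unit_res_ne
    unfolding h by blast
  then show ?thesis using close close_primes main by blast
qed

end
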